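(* Let $X$ be the $n\times n$ random matrix with independent entries $X_{ij}=\rho^{-1/2}\varepsilon_{ij}B_{ij}$, where the uniform signs $\varepsilon_{ij}\in\{-1,1\}$ and $B_{ij}\sim\operatorname{Bernoulli}(\rho)$ are all mutually independent. For fixed $\beta\ge0$ put $\rho=n^{-\beta}$. Then, as $n\to\infty$, $$\mathbb E\|X\|\asymp_\beta\begin{cases}n^{1/2},&0\le\beta<1,\\ n^{1/2}(\log n/\log\log n)^{1/2},&\beta=1,\\ n^{\beta/2},&1<\beta\le2,\\ n^{2-\beta/2},&\beta>2,\end{cases}$$ where $\|\cdot\|$ is the operator norm and $\asymp_\beta$ means two-sided bounds with positive constants depending only on $\beta$, for all sufficiently large $n$. *)

theory Defs
  imports "HOL-Probability.Probability"
begin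

text \<open>
  The dimension varies in the asymptotic statement, so an \<open>n \<times> n\<close> matrix is a function
  of two natural-number indices of which only the values below \<open>n\<close> matter, and likewise
  for vectors. \<open>L2_set x {..<n}\<close> is the Euclidean norm on \<open>\<real>\<^sup>n\<close>.
\<close>

definition op_norm :: "nat \<Rightarrow> (nat \<Rightarrow> nat \<Rightarrow> real) \<Rightarrow> real" where
  "op_norm n A =
     (SUP x \<in> {x. L2_set x {..<n} \<le> 1}. L2_set (\<lambda>i. \<Sum>j<n. A i j * x j) {..<n})"

text \<open>
  The two families are summed into one, so that all \<open>2 * n\<^sup>2\<close> variables are jointly
  independent; \<open>indep_vars\<close> includes their measurability. Both families are real-valued,
  hence the laws on the right-hand sides are transported to the Borel algebra.
\<close>

definition signs_and_selectors ::
  "'a measure \<Rightarrow> nat \<Rightarrow> real \<Rightarrow> (nat \<Rightarrow> nat \<Rightarrow> 'a \<Rightarrow> real) \<Rightarrow> (nat \<Rightarrow> nat \<Rightarrow> 'a \<Rightarrow> real) \<Rightarrow> bool"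
where
  "signs_and_selectors M n \<rho> \<epsilon> B \<longleftrightarrow>
     prob_space M \<and>
     prob_space.indep_vars M (\<lambda>_. borel)
       (case_sum (\<lambda>(i, j). \<epsilon> i j) (\<lambda>(i, j). B i j))
       (({..<n} \<times> {..<n}) <+> ({..<n} \<times> {..<n})) \<and>
     (\<forall>i<n. \<forall>j<n.
        distr M borel (\<epsilon> i j) = distr (measure_pmf (pmf_of_set {-1, 1 :: real})) borel (\<lambda>x. x) \<and>
        distr M borel (B i j) = distr (measure_pmf (bernoulli_pmf \<rho>)) borel of_bool)"

definition sparse_matrix ::
  "real \<Rightarrow> (nat \<Rightarrow> nat \<Rightarrow> 'a \<Rightarrow> real) \<Rightarrow> (nat \<Rightarrow> nat \<Rightarrow> 'a \<Rightarrow> real) \<Rightarrow> 'a \<Rightarrow> nat \<Rightarrow> nat \<Rightarrow> real"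
where
  "sparse_matrix \<rho> \<epsilon> B \<omega> i j = \<rho> powr (- 1 / 2) * \<epsilon> i j \<omega> * B i j \<omega>"

text \<open>Only used for \<open>\<beta> \<ge> 0\<close> and large \<open>n\<close>, where \<open>ln (ln n)\<close> is positive.\<close>

definition growth_rate :: "real \<Rightarrow> nat \<Rightarrow> real" where
  "growth_rate \<beta> n =
     (if \<beta> < 1 then real n powr (1 / 2)
      else if \<beta> = 1 then real n powr (1 / 2) * (ln (real n) / ln (ln (real n))) powr (1 / 2)
      else if \<beta> \<le> 2 then real n powr (\<beta> / 2)
      else real n powr (2 - \<beta> / 2))"

end

theory Submission
  imports Defs "HOL-Real_Asymp.Real_Asymp"
begin

text \<open>
  Write Y for the matrix of the products of signs and selectors, so that its entries lie in
  \<open>{-1, 0, 1}\<close>, are symmetric, and have second moment \<open>\<rho> = n powr - \<beta>\<close>. Since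
  \<open>X = n powr (\<beta> / 2) * Y\<close>, the claim is about the expected norm of Y.

  \<^bold>\<open>Upper bounds for \<beta> at most 2.\<close> The starting point is the method of moments. For p a power of two,
  the 2p-th power of the norm is at most the trace of the p-th power of \<open>Y\<^sup>T Y\<close>. Its
  expectation is a sum over closed walks of length 2p in the complete bipartite graph on n + n
  vertices; only walks that use every edge an even number of times survive, and such a walk with e
  distinct edges contributes \<open>\<rho> ^ e\<close>. Instead of counting these walks by shape, one compares two
  models: a closed walk with e edges has v \<le> e + 1 vertices, and its shape occurs at most
  \<open>n ^ v\<close> times in dimension n and at least \<open>p ^ v\<close> times in dimension 2p. Hence, if
  \<open>1 \<le> m \<le> min n p\<close> and \<open>n * \<rho> \<le> m * q\<close>, the sum for (n, \<rho>) is at most n times the sum for a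
  matrix of dimension 2p and density q (\<open>walk_sum_comparison\<close>).

  In the new model the dimension is proportional to the order of the moment, and there a union bound
  over a net loses only a constant factor (\<open>walk_sum_sparse_le\<close>). The gain from sparsity comes from the moment
  generating function of an entry, which is at most \<open>exp (u\<^sup>2 / L)\<close> whenever
  \<open>q * L * exp L \<le> 2\<close> (\<open>sparse_sign_mgf_le\<close>): the entries are subgaussian with a variance
  parameter of order \<open>1 / ln (1 / q)\<close> rather than 1. Altogether the expected norm of Y is at most a
  constant times \<open>sqrt (p / L)\<close> as soon as \<open>p \<ge> ln n\<close> (\<open>expectation_op_norm_le\<close>), and the
  regimes differ only in the choice of parameters:

  \<^item> \<open>\<beta> < 1\<close>: p of order \<open>n powr (1 - \<beta>)\<close>, \<open>m = n powr (1 - \<beta>)\<close>, q = 1 and L = 1/2;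
  \<^item> \<open>\<beta> = 1\<close>: p of order ln n, \<open>m = sqrt p\<close>, \<open>q = 1 / sqrt p\<close> and \<open>L = ln p / 4\<close>;
  \<^item> \<open>1 < \<beta> \<le> 2\<close>: p of order ln n, m = 1, \<open>q = n powr (1 - \<beta>)\<close> and \<open>L = (\<beta> - 1) / 2 * ln n\<close>.

  For \<open>\<beta> > 2\<close> the norm is bounded by the number of nonzero entries, whose mean is
  \<open>n powr (2 - \<beta>)\<close>.

  \<^bold>\<open>Lower bounds.\<close> All come from one second moment estimate for a sum of independent
  indicators (\<open>second_moment_quadratic\<close>). For \<open>\<beta> < 1\<close> it is applied to the Frobenius norm, which
  is at most \<open>sqrt n\<close> times the operator norm; for \<open>\<beta> > 1\<close> to the event that some entry is nonzero. For
  \<open>\<beta> = 1\<close> the extremal object is a single column: the number of nonzero entries in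
  a column is nearly Poisson with mean 1, so that among n independent columns one typically has about
  \<open>ln n / ln (ln n)\<close> nonzero entries, and the norm of Y is at least the norm of that column.
\<close>

section \<open>The operator norm\<close>

definition mat_vec :: "nat \<Rightarrow> (nat \<Rightarrow> nat \<Rightarrow> real) \<Rightarrow> (nat \<Rightarrow> real) \<Rightarrow> nat \<Rightarrow> real" where
  "mat_vec n A x i = (\<Sum>j<n. A i j * x j)"

abbreviation vec_norm :: "nat \<Rightarrow> (nat \<Rightarrow> real) \<Rightarrow> real" where
  "vec_norm n x \<equiv> L2_set x {..<n}"

lemma op_norm_alt: "op_norm n A = (SUP x \<in> {x. vec_norm n x \<le> 1}. vec_norm n (mat_vec n A x))"
  by (simp add: op_norm_def mat_vec_def[abs_def])

lemma vec_norm_cong: "(\<And>i. i < n \<Longrightarrow> x i = y i) \<Longrightarrow> vec_norm n x = vec_norm n y"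
  by (rule L2_set_cong) auto

lemma vec_norm_scale: "vec_norm n (\<lambda>i. c * x i) = \<bar>c\<bar> * vec_norm n x"
  by (simp add: L2_set_def power_mult_distrib sum_distrib_left[symmetric] real_sqrt_mult)

lemma vec_norm_sq: "(vec_norm n x)\<^sup>2 = (\<Sum>i<n. (x i)\<^sup>2)"
  by (simp add: L2_set_def sum_nonneg)

lemma cauchy_schwarz_sum: "\<bar>\<Sum>i<n. x i * y i\<bar> \<le> vec_norm n x * vec_norm n y"
proof -
  have "\<bar>\<Sum>i<n. x i * y i\<bar> \<le> (\<Sum>i<n. \<bar>x i\<bar> * \<bar>y i\<bar>)"
    by (rule order_trans[OF sum_abs]) (simp add: abs_mult)
  also have "\<dots> \<le> vec_norm n x * vec_norm n y" by (rule L2_set_mult_ineq)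
  finally show ?thesis .
qed

lemma vec_norm_mat_vec_le_sum_abs:
  "vec_norm n (mat_vec n A x) \<le> (\<Sum>i<n. \<Sum>j<n. \<bar>A i j\<bar>) * vec_norm n x"
proof -
  have "vec_norm n (mat_vec n A x) \<le> (\<Sum>i<n. \<bar>mat_vec n A x i\<bar>)"
    by (rule L2_set_le_sum_abs)
  also have "\<dots> \<le> (\<Sum>i<n. \<Sum>j<n. \<bar>A i j\<bar> * vec_norm n x)"
  proof (intro sum_mono)
    fix i assume "i \<in> {..<n}"
    have "\<bar>mat_vec n A x i\<bar> \<le> (\<Sum>j<n. \<bar>A i j\<bar> * \<bar>x j\<bar>)"
      unfolding mat_vec_def by (rule order_trans[OF sum_abs]) (simp add: abs_mult)
    also have "\<dots> \<le> (\<Sum>j<n. \<bar>A i j\<bar> * vec_norm n x)"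
    proof (intro sum_mono mult_left_mono)
      fix j assume j: "j \<in> {..<n}"
      have "\<bar>x j\<bar> \<le> vec_norm n (\<lambda>j. \<bar>x j\<bar>)" by (rule member_le_L2_set) (use j in auto)
      then show "\<bar>x j\<bar> \<le> vec_norm n x" by (simp add: L2_set_def)
    qed simp
    finally show "\<bar>mat_vec n A x i\<bar> \<le> (\<Sum>j<n. \<bar>A i j\<bar> * vec_norm n x)" .
  qed
  also have "\<dots> = (\<Sum>i<n. \<Sum>j<n. \<bar>A i j\<bar>) * vec_norm n x"
    by (simp add: sum_distrib_right)
  finally show ?thesis .
qed

lemma bdd_above_op_norm:
  "bdd_above ((\<lambda>x. vec_norm n (mat_vec n A x)) ` {x. vec_norm n x \<le> 1})"
proof (rule bdd_aboveI2)
  fix x assume "x \<in> {x. vec_norm n x \<le> 1}"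
  then have "(\<Sum>i<n. \<Sum>j<n. \<bar>A i j\<bar>) * vec_norm n x \<le> (\<Sum>i<n. \<Sum>j<n. \<bar>A i j\<bar>) * 1"
    by (intro mult_left_mono sum_nonneg) auto
  with vec_norm_mat_vec_le_sum_abs[of n A x]
  show "vec_norm n (mat_vec n A x) \<le> (\<Sum>i<n. \<Sum>j<n. \<bar>A i j\<bar>)" by linarith
qed

lemma zero_in_unit_ball: "(\<lambda>_. 0) \<in> {x. vec_norm n x \<le> 1}"
  by (simp add: L2_set_def)

lemma op_norm_upper: "vec_norm n x \<le> 1 \<Longrightarrow> vec_norm n (mat_vec n A x) \<le> op_norm n A"
  unfolding op_norm_alt by (rule cSUP_upper) (auto intro: bdd_above_op_norm)

lemma op_norm_least:
  "(\<And>x. vec_norm n x \<le> 1 \<Longrightarrow> vec_norm n (mat_vec n A x) \<le> K) \<Longrightarrow> op_norm n A \<le> K"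
  unfolding op_norm_alt by (rule cSUP_least) (use zero_in_unit_ball in auto)

lemma op_norm_nonneg: "0 \<le> op_norm n A"
  by (rule order_trans[OF L2_set_nonneg op_norm_upper[of "\<lambda>_. 0"]]) (simp add: L2_set_def)

lemma mat_vec_scale: "mat_vec n A (\<lambda>j. c * x j) = (\<lambda>i. c * mat_vec n A x i)"
  by (simp add: mat_vec_def sum_distrib_left algebra_simps fun_eq_iff)

lemma vec_norm_mat_vec: "vec_norm n (mat_vec n A x) \<le> op_norm n A * vec_norm n x"
proof (cases "vec_norm n x = 0")
  case True
  then show ?thesis using vec_norm_mat_vec_le_sum_abs[of n A x] by simp
next
  case False
  then have pos: "vec_norm n x > 0" using L2_set_nonneg[of x "{..<n}"] by linarith
  have "vec_norm n (mat_vec n A (\<lambda>j. inverse (vec_norm n x) * x j)) \<le> op_norm n A"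
    by (rule op_norm_upper) (use pos in \<open>simp add: vec_norm_scale\<close>)
  then have "inverse (vec_norm n x) * vec_norm n (mat_vec n A x) \<le> op_norm n A"
    using pos unfolding mat_vec_scale vec_norm_scale by simp
  then show ?thesis using pos by (simp add: field_simps)
qed

lemma op_norm_cong: "(\<And>i j. i < n \<Longrightarrow> j < n \<Longrightarrow> A i j = A' i j) \<Longrightarrow> op_norm n A = op_norm n A'"
  unfolding op_norm_def by (intro SUP_cong refl L2_set_cong sum.cong) auto

lemma op_norm_scale:
  assumes "c \<ge> 0" shows "op_norm n (\<lambda>i j. c * A i j) = c * op_norm n A"
proof -
  have *: "mat_vec n (\<lambda>i j. c * A i j) x = (\<lambda>i. c * mat_vec n A x i)" for c A x
    by (simp add: mat_vec_def sum_distrib_left algebra_simps fun_eq_iff)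
  have le: "op_norm n (\<lambda>i j. c * A i j) \<le> c * op_norm n A" if "c \<ge> 0" for c and A :: "nat \<Rightarrow> nat \<Rightarrow> real"
  proof (rule op_norm_least)
    fix x assume "vec_norm n x \<le> 1"
    from mult_left_mono[OF op_norm_upper[OF this, of A] that]
    show "vec_norm n (mat_vec n (\<lambda>i j. c * A i j) x) \<le> c * op_norm n A"
      unfolding * vec_norm_scale using that by simp
  qed
  show ?thesis
  proof (cases "c = 0")
    case True
    then show ?thesis using le[of 0 A] op_norm_nonneg[of n "\<lambda>i j. 0 * A i j"] by simp
  next
    case False
    with assms have "c > 0" by simp
    with le[of "inverse c" "\<lambda>i j. c * A i j"] have "c * op_norm n A \<le> op_norm n (\<lambda>i j. c * A i j)"
      by (simp add: field_simps)
    with le[OF assms, of A] show ?thesis by simp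
  qed
qed

lemma op_norm_le_sum_abs: "op_norm n A \<le> (\<Sum>i<n. \<Sum>j<n. \<bar>A i j\<bar>)"
proof (rule op_norm_least)
  fix x assume "vec_norm n x \<le> 1"
  then have "(\<Sum>i<n. \<Sum>j<n. \<bar>A i j\<bar>) * vec_norm n x \<le> (\<Sum>i<n. \<Sum>j<n. \<bar>A i j\<bar>) * 1"
    by (intro mult_left_mono sum_nonneg) auto
  with vec_norm_mat_vec_le_sum_abs[of n A x]
  show "vec_norm n (mat_vec n A x) \<le> (\<Sum>i<n. \<Sum>j<n. \<bar>A i j\<bar>)" by linarith
qed

text \<open>
  The norm is Lipschitz in the entries. This is what makes it a measurable function of a random
  matrix, although it is defined as a supremum over an uncountable set.
\<close>
lemma op_norm_perturb: "op_norm n A \<le> op_norm n A' + (\<Sum>i<n. \<Sum>j<n. \<bar>A i j - A' i j\<bar>)"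
proof (rule op_norm_least)
  fix x assume x: "vec_norm n x \<le> 1"
  have "mat_vec n A x = (\<lambda>i. mat_vec n A' x i + mat_vec n (\<lambda>i j. A i j - A' i j) x i)"
    by (simp add: mat_vec_def fun_eq_iff algebra_simps sum.distrib sum_subtractf)
  then have "vec_norm n (mat_vec n A x)
      \<le> vec_norm n (mat_vec n A' x) + vec_norm n (mat_vec n (\<lambda>i j. A i j - A' i j) x)"
    using L2_set_triangle_ineq[of "mat_vec n A' x" "mat_vec n (\<lambda>i j. A i j - A' i j) x"] by simp
  also have "\<dots> \<le> op_norm n A' + op_norm n (\<lambda>i j. A i j - A' i j)"
    by (intro add_mono op_norm_upper x)
  also have "\<dots> \<le> op_norm n A' + (\<Sum>i<n. \<Sum>j<n. \<bar>A i j - A' i j\<bar>)"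
    by (intro add_left_mono op_norm_le_sum_abs)
  finally show "vec_norm n (mat_vec n A x) \<le> \<dots>" .
qed

lemma mat_vec_unit: "j < n \<Longrightarrow> mat_vec n A (\<lambda>k. of_bool (k = j)) i = A i j"
  by (simp add: mat_vec_def sum.delta)

lemma vec_norm_unit: "j < n \<Longrightarrow> vec_norm n (\<lambda>k. of_bool (k = j)) = 1"
  by (simp add: L2_set_def sum.delta if_distrib[of "\<lambda>x. x\<^sup>2"] of_bool_def cong: if_cong)

lemma column_le_op_norm: "j < n \<Longrightarrow> sqrt (\<Sum>i<n. (A i j)\<^sup>2) \<le> op_norm n A"
  using op_norm_upper[of "\<lambda>k. of_bool (k = j)" n A] vec_norm_unit[of j n]
  by (simp add: L2_set_def mat_vec_unit)

lemma entry_le_op_norm: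
  assumes "i < n" "j < n" shows "\<bar>A i j\<bar> \<le> op_norm n A"
proof -
  have "(A i j)\<^sup>2 \<le> (\<Sum>i<n. (A i j)\<^sup>2)"
    by (rule member_le_sum) (use assms in auto)
  then have "\<bar>A i j\<bar> \<le> sqrt (\<Sum>i<n. (A i j)\<^sup>2)" using real_sqrt_le_mono by fastforce
  with column_le_op_norm[OF assms(2), of A] show ?thesis by linarith
qed

lemma frobenius_le_op_norm: "sqrt (\<Sum>i<n. \<Sum>j<n. (A i j)\<^sup>2) \<le> sqrt (real n) * op_norm n A"
proof (rule real_le_lsqrt)
  have "(\<Sum>i<n. \<Sum>j<n. (A i j)\<^sup>2) = (\<Sum>j<n. \<Sum>i<n. (A i j)\<^sup>2)" by (rule sum.swap)
  also have "\<dots> \<le> (\<Sum>j<n. (op_norm n A)\<^sup>2)"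
  proof (rule sum_mono)
    fix j assume "j \<in> {..<n}"
    then show "(\<Sum>i<n. (A i j)\<^sup>2) \<le> (op_norm n A)\<^sup>2"
      using column_le_op_norm[of j n A] by (simp add: real_sqrt_le_iff sqrt_le_D)
  qed
  finally show "(\<Sum>i<n. \<Sum>j<n. (A i j)\<^sup>2) \<le> (sqrt (real n) * op_norm n A)\<^sup>2"
    by (simp add: power_mult_distrib)
qed (simp add: op_norm_nonneg)

text \<open>
  The norm is continuous for the product topology on matrices, and a random matrix is a Borel
  measurable map into that space because its coordinates are measurable. Replacing the entries outside
  the n by n block by 0 leaves the norm unchanged.
\<close>
lemma op_norm_measurable:
  fixes Y :: "nat \<Rightarrow> nat \<Rightarrow> 'a \<Rightarrow> real"
  assumes "\<And>i j. i < n \<Longrightarrow> j < n \<Longrightarrow> Y i j \<in> borel_measurable M"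
  shows "(\<lambda>\<omega>. op_norm n (\<lambda>i j. Y i j \<omega>)) \<in> borel_measurable M"
proof -
  define f where "f = (\<lambda>a :: nat \<times> nat \<Rightarrow> real. op_norm n (\<lambda>i j. a (i, j)))"
  define g where "g = (\<lambda>\<omega> (i, j). if i < n \<and> j < n then Y i j \<omega> else 0)"
  have "continuous_on UNIV f"
    unfolding continuous_on_def
  proof
    fix a :: "nat \<times> nat \<Rightarrow> real"
    define D where "D = (\<lambda>b :: nat \<times> nat \<Rightarrow> real. \<Sum>i<n. \<Sum>j<n. \<bar>b (i, j) - a (i, j)\<bar>)"
    have "continuous_on UNIV D"
      unfolding D_def by (intro continuous_intros continuous_on_product_coordinates)
    then have D: "(D \<longlongrightarrow> D a) (at a)" by (simp add: continuous_on_def)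
    have "\<bar>f b - f a\<bar> \<le> D b" for b
    proof -
      have "f b \<le> f a + D b" unfolding f_def D_def by (rule op_norm_perturb)
      moreover have "f a \<le> f b + D b"
        unfolding f_def D_def
        using op_norm_perturb[of n "\<lambda>i j. a (i, j)" "\<lambda>i j. b (i, j)"]
        by (simp add: abs_minus_commute)
      ultimately show ?thesis by linarith
    qed
    then have ev: "\<forall>\<^sub>F b in at a. norm (f b - f a) \<le> D b" by simp
    have "D a = 0" by (simp add: D_def)
    with D have D0: "(D \<longlongrightarrow> 0) (at a)" by simp
    have "((\<lambda>b. f b - f a) \<longlongrightarrow> 0) (at a)"
      by (rule Lim_null_comparison[OF ev D0])
    then show "(f \<longlongrightarrow> f a) (at a within UNIV)" by (simp add: LIM_zero_iff)
  qed
  then have f: "f \<in> borel_measurable borel" by (rule borel_measurable_continuous_onI)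
  have g: "g \<in> measurable M borel"
  proof (rule measurable_coordinatewise_then_product)
    fix c :: "nat \<times> nat"
    show "(\<lambda>\<omega>. g \<omega> c) \<in> borel_measurable M"
      using assms by (cases c; cases "fst c < n \<and> snd c < n") (auto simp: g_def)
  qed
  have "(\<lambda>\<omega>. op_norm n (\<lambda>i j. Y i j \<omega>)) = (\<lambda>\<omega>. f (g \<omega>))"
    by (auto simp: fun_eq_iff f_def g_def intro!: op_norm_cong)
  then show ?thesis using measurable_compose[OF g f] by simp
qed

section \<open>Traces of powers and closed walks\<close>
definition gram :: "nat \<Rightarrow> (nat \<Rightarrow> nat \<Rightarrow> real) \<Rightarrow> nat \<Rightarrow> nat \<Rightarrow> real" where
  "gram n A a b = (\<Sum>c<n. A c a * A c b)"

fun mat_pow :: "nat \<Rightarrow> (nat \<Rightarrow> nat \<Rightarrow> real) \<Rightarrow> nat \<Rightarrow> nat \<Rightarrow> nat \<Rightarrow> real" where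
  "mat_pow n G 0 a b = of_bool (a = b)"
| "mat_pow n G (Suc k) a b = (\<Sum>c<n. mat_pow n G k a c * G c b)"

definition trace_moment :: "nat \<Rightarrow> (nat \<Rightarrow> nat \<Rightarrow> real) \<Rightarrow> nat \<Rightarrow> real" where
  "trace_moment n A p = (\<Sum>a<n. mat_pow n (gram n A) p a a)"

lemma mat_pow_add:
  "b < n \<Longrightarrow> mat_pow n G (k + l) a b = (\<Sum>c<n. mat_pow n G k a c * mat_pow n G l c b)"
proof (induction l arbitrary: b)
  case 0
  then show ?case by (simp add: sum.delta of_bool_def if_distrib cong: if_cong)
next
  case (Suc l)
  have "mat_pow n G (k + Suc l) a b
      = (\<Sum>d<n. (\<Sum>c<n. mat_pow n G k a c * mat_pow n G l c d) * G d b)"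
    using Suc.IH by simp
  also have "\<dots> = (\<Sum>d<n. \<Sum>c<n. mat_pow n G k a c * (mat_pow n G l c d * G d b))"
    by (simp add: sum_distrib_right mult.assoc)
  also have "\<dots> = (\<Sum>c<n. \<Sum>d<n. mat_pow n G k a c * (mat_pow n G l c d * G d b))"
    by (rule sum.swap)
  also have "\<dots> = (\<Sum>c<n. mat_pow n G k a c * mat_pow n G (Suc l) c b)"
    by (simp add: sum_distrib_left)
  finally show ?case .
qed

lemma mat_pow_sym:
  assumes "\<And>a b. G a b = G b a"
  shows "a < n \<Longrightarrow> b < n \<Longrightarrow> mat_pow n G k a b = mat_pow n G k b a"
proof (induction k arbitrary: a b)
  case (Suc k)
  have one: "mat_pow n G (Suc 0) b c = G b c" if "c < n" "b < n" for b c
    using that by (simp add: sum.delta of_bool_def if_distrib[of "\<lambda>x. x * _"] cong: if_cong)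
  have "mat_pow n G (Suc k) a b = (\<Sum>c<n. G b c * mat_pow n G k c a)"
    using Suc assms by (auto intro!: sum.cong simp: mult.commute)
  also have "\<dots> = (\<Sum>c<n. mat_pow n G (Suc 0) b c * mat_pow n G k c a)"
    using Suc.prems one by (intro sum.cong refl) simp
  also have "\<dots> = mat_pow n G (Suc 0 + k) b a"
    using Suc.prems by (subst mat_pow_add) auto
  finally show ?case by simp
qed auto

lemma gram_sym: "gram n A a b = gram n A b a"
  by (simp add: gram_def mult.commute)

text \<open>
  Even powers of a symmetric matrix are squares: \<open>\<langle>x, G\<^sup>2\<^sup>k x\<rangle>\<close> is the squared length of
  \<open>G\<^sup>k x\<close>. The same identity for traces follows.
\<close>
lemma quadratic_form_even_pow:
  assumes sym: "\<And>a b. G a b = G b a"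
  shows "(\<Sum>a<n. x a * mat_vec n (mat_pow n G (k + k)) x a) = (vec_norm n (mat_vec n (mat_pow n G k) x))\<^sup>2"
proof -
  have "(vec_norm n (mat_vec n (mat_pow n G k) x))\<^sup>2
      = (\<Sum>c<n. \<Sum>a<n. \<Sum>b<n. (mat_pow n G k c a * x a) * (mat_pow n G k c b * x b))"
    unfolding vec_norm_sq by (simp add: mat_vec_def power2_eq_square sum_product)
  also have "\<dots> = (\<Sum>a<n. \<Sum>c<n. \<Sum>b<n. (mat_pow n G k c a * x a) * (mat_pow n G k c b * x b))"
    by (rule sum.swap)
  also have "\<dots> = (\<Sum>a<n. \<Sum>b<n. \<Sum>c<n. (mat_pow n G k c a * x a) * (mat_pow n G k c b * x b))"
    by (intro sum.cong refl sum.swap)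
  also have "\<dots> = (\<Sum>a<n. \<Sum>b<n. x a * x b * (\<Sum>c<n. mat_pow n G k a c * mat_pow n G k c b))"
  proof (intro sum.cong refl)
    fix a b assume "a \<in> {..<n}" "b \<in> {..<n}"
    then show "(\<Sum>c<n. (mat_pow n G k c a * x a) * (mat_pow n G k c b * x b))
        = x a * x b * (\<Sum>c<n. mat_pow n G k a c * mat_pow n G k c b)"
      unfolding sum_distrib_left
      by (intro sum.cong refl) (use mat_pow_sym[of G, OF sym] in auto)
  qed
  also have "\<dots> = (\<Sum>a<n. \<Sum>b<n. x a * (mat_pow n G (k + k) a b * x b))"
    by (intro sum.cong refl) (simp add: mat_pow_add)
  also have "\<dots> = (\<Sum>a<n. x a * mat_vec n (mat_pow n G (k + k)) x a)"
    by (simp add: mat_vec_def sum_distrib_left)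
  finally show ?thesis by simp
qed

lemma trace_even_pow:
  assumes sym: "\<And>a b. G a b = G b a"
  shows "(\<Sum>a<n. mat_pow n G (k + k) a a) = (\<Sum>a<n. \<Sum>c<n. (mat_pow n G k a c)\<^sup>2)"
proof (intro sum.cong refl)
  fix a assume "a \<in> {..<n}"
  then show "mat_pow n G (k + k) a a = (\<Sum>c<n. (mat_pow n G k a c)\<^sup>2)"
    by (simp add: mat_pow_add power2_eq_square)
       (intro sum.cong refl, use mat_pow_sym[of G, OF sym] in auto)
qed

lemma vec_norm_mat_vec_frobenius:
  "(vec_norm n (mat_vec n A x))\<^sup>2 \<le> (\<Sum>i<n. \<Sum>j<n. (A i j)\<^sup>2) * (vec_norm n x)\<^sup>2"
proof -
  have "(vec_norm n (mat_vec n A x))\<^sup>2 = (\<Sum>i<n. (mat_vec n A x i)\<^sup>2)" by (rule vec_norm_sq)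
  also have "\<dots> \<le> (\<Sum>i<n. (vec_norm n (A i) * vec_norm n x)\<^sup>2)"
    unfolding mat_vec_def
    by (intro sum_mono iffD1[OF abs_le_square_iff])
       (use cauchy_schwarz_sum in \<open>simp add: abs_mult\<close>)
  also have "\<dots> = (\<Sum>i<n. \<Sum>j<n. (A i j)\<^sup>2) * (vec_norm n x)\<^sup>2"
    by (simp add: power_mult_distrib vec_norm_sq sum_distrib_right)
  finally show ?thesis .
qed

lemma vec_norm_sq_eq_gram_form:
  "(vec_norm n (mat_vec n A x))\<^sup>2 = (\<Sum>a<n. x a * mat_vec n (gram n A) x a)"
proof -
  have "(vec_norm n (mat_vec n A x))\<^sup>2 = (\<Sum>c<n. \<Sum>a<n. \<Sum>b<n. (A c a * x a) * (A c b * x b))"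
    unfolding vec_norm_sq by (simp add: mat_vec_def power2_eq_square sum_product)
  also have "\<dots> = (\<Sum>a<n. \<Sum>c<n. \<Sum>b<n. (A c a * x a) * (A c b * x b))"
    by (rule sum.swap)
  also have "\<dots> = (\<Sum>a<n. \<Sum>b<n. \<Sum>c<n. (A c a * x a) * (A c b * x b))"
    by (intro sum.cong refl sum.swap)
  also have "\<dots> = (\<Sum>a<n. x a * mat_vec n (gram n A) x a)"
    by (simp add: mat_vec_def gram_def sum_distrib_left sum_distrib_right mult_ac)
  finally show ?thesis .
qed

text \<open>
  For a unit vector x and the positive semidefinite
  \<open>G = A\<^sup>T A\<close>, Cauchy-Schwarz gives \<open>\<langle>x, G\<^sup>l x\<rangle>\<^sup>2 \<le> \<langle>x, G\<^sup>2\<^sup>l x\<rangle>\<close>. Starting from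
  \<open>\<bar>A x\<bar>\<^sup>2 = \<langle>x, G x\<rangle>\<close> and doubling the exponent each time, one arrives at a power of two, and the last
  quadratic form is bounded by the Frobenius norm of half of that power, whose square is the trace.
\<close>
lemma op_norm_power_le_trace_moment:
  "op_norm n A ^ (2 * 2 ^ Suc k) \<le> trace_moment n A (2 ^ Suc k)"
proof -
  let ?G = "gram n A"
  let ?T = "trace_moment n A (2 ^ Suc k)"
  have T: "?T = (\<Sum>a<n. \<Sum>c<n. (mat_pow n ?G (2 ^ k) a c)\<^sup>2)"
    unfolding trace_moment_def using trace_even_pow[of ?G n "2 ^ k"] gram_sym by (simp add: mult_2)
  have T0: "?T \<ge> 0" unfolding T by (intro sum_nonneg) auto
  have bd: "vec_norm n (mat_vec n A x) ^ (2 * 2 ^ Suc k) \<le> ?T" if x: "vec_norm n x \<le> 1" for x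
  proof -
    have step: "vec_norm n (mat_vec n A x) ^ (2 * 2 ^ l)
        \<le> (\<Sum>a<n. x a * mat_vec n (mat_pow n ?G (2 ^ l)) x a)" for l
    proof (induction l)
      case 0
      have "mat_vec n ?G x a = mat_vec n (mat_pow n ?G (Suc 0)) x a" if "a < n" for a
        using that by (simp add: mat_vec_def sum.delta of_bool_def if_distrib[of "\<lambda>x. x * _"] cong: if_cong)
      then have "(\<Sum>a<n. x a * mat_vec n ?G x a) = (\<Sum>a<n. x a * mat_vec n (mat_pow n ?G 1) x a)"
        by (intro sum.cong refl) simp
      then show ?case using vec_norm_sq_eq_gram_form[of n A x] by (simp del: mat_pow.simps)
    next
      case (Suc l)
      let ?y = "mat_vec n (mat_pow n ?G (2 ^ l)) x"
      have "vec_norm n (mat_vec n A x) ^ (2 * 2 ^ Suc l) = (vec_norm n (mat_vec n A x) ^ (2 * 2 ^ l))\<^sup>2"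
        by (simp flip: power_mult add: mult.commute)
      also have "\<dots> \<le> (\<Sum>a<n. x a * ?y a)\<^sup>2"
        by (intro power_mono Suc.IH zero_le_power L2_set_nonneg)
      also have "\<dots> \<le> (vec_norm n x * vec_norm n ?y)\<^sup>2"
        using cauchy_schwarz_sum[of x ?y n]
        by (intro iffD1[OF abs_le_square_iff]) (simp add: abs_mult)
      also have "\<dots> \<le> (1 * vec_norm n ?y)\<^sup>2"
        using x by (intro power_mono mult_right_mono) auto
      also have "\<dots> = (\<Sum>a<n. x a * mat_vec n (mat_pow n ?G (2 ^ l + 2 ^ l)) x a)"
        using quadratic_form_even_pow[of ?G x n "2 ^ l"] gram_sym by simp
      finally show ?case by (simp add: mult_2)
    qed
    have "vec_norm n (mat_vec n A x) ^ (2 * 2 ^ Suc k)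
        \<le> (\<Sum>a<n. x a * mat_vec n (mat_pow n ?G (2 ^ k + 2 ^ k)) x a)"
      using step[of "Suc k"] by (simp add: mult_2)
    also have "\<dots> = (vec_norm n (mat_vec n (mat_pow n ?G (2 ^ k)) x))\<^sup>2"
      by (rule quadratic_form_even_pow) (rule gram_sym)
    also have "\<dots> \<le> ?T * (vec_norm n x)\<^sup>2"
      unfolding T by (rule vec_norm_mat_vec_frobenius)
    also have "\<dots> \<le> ?T * 1"
      using x T0 by (intro mult_left_mono power_le_one) auto
    finally show ?thesis by simp
  qed
  have pos: "(2::nat) * 2 ^ Suc k > 0" by simp
  have "op_norm n A \<le> root (2 * 2 ^ Suc k) ?T"
  proof (rule op_norm_least)
    fix x assume "vec_norm n x \<le> 1"
    from real_root_le_mono[OF pos bd[OF this]]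
    show "vec_norm n (mat_vec n A x) \<le> root (2 * 2 ^ Suc k) ?T"
      by (simp add: real_root_power_cancel)
  qed
  then have "op_norm n A ^ (2 * 2 ^ Suc k) \<le> root (2 * 2 ^ Suc k) ?T ^ (2 * 2 ^ Suc k)"
    by (rule power_mono) (rule op_norm_nonneg)
  also have "\<dots> = ?T" by (rule real_root_pow_pos2[OF pos T0])
  finally show ?thesis .
qed

lemma vec_norm_transpose_mat_vec: "vec_norm n (mat_vec n (\<lambda>i j. A j i) x) \<le> op_norm n A * vec_norm n x"
proof -
  let ?y = "mat_vec n (\<lambda>i j. A j i) x"
  have "(vec_norm n ?y)\<^sup>2 = (\<Sum>i<n. \<Sum>j<n. A j i * x j * ?y i)"
    unfolding vec_norm_sq by (simp add: power2_eq_square mat_vec_def flip: sum_distrib_right)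
  also have "\<dots> = (\<Sum>j<n. \<Sum>i<n. A j i * x j * ?y i)" by (rule sum.swap)
  also have "\<dots> = (\<Sum>j<n. x j * mat_vec n A ?y j)"
    by (simp add: mat_vec_def[of n A] sum_distrib_left mult_ac)
  also have "\<dots> \<le> vec_norm n x * vec_norm n (mat_vec n A ?y)"
    using cauchy_schwarz_sum[of x "mat_vec n A ?y" n] by simp
  also have "\<dots> \<le> vec_norm n x * (op_norm n A * vec_norm n ?y)"
    by (intro mult_left_mono vec_norm_mat_vec) auto
  finally have *: "vec_norm n ?y * vec_norm n ?y \<le> (op_norm n A * vec_norm n x) * vec_norm n ?y"
    by (simp add: power2_eq_square mult_ac)
  show ?thesis
  proof (cases "vec_norm n ?y = 0")
    case True
    then show ?thesis by (simp add: op_norm_nonneg)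
  next
    case False
    then have "vec_norm n ?y > 0" using L2_set_nonneg[of ?y "{..<n}"] by linarith
    with * show ?thesis by simp
  qed
qed

text \<open>
  Each of the n diagonal entries of \<open>(A\<^sup>T A)\<^sup>p\<close> is at most the norm of that matrix, and the
  norm is submultiplicative.
\<close>
lemma trace_moment_le_op_norm: "trace_moment n A p \<le> real n * op_norm n A ^ (2 * p)"
proof -
  let ?G = "gram n A"
  have G: "vec_norm n (mat_vec n ?G x) \<le> (op_norm n A)\<^sup>2 * vec_norm n x" for x
  proof -
    have eq: "mat_vec n ?G x = mat_vec n (\<lambda>i j. A j i) (mat_vec n A x)"
    proof
      fix a
      have "mat_vec n ?G x a = (\<Sum>b<n. \<Sum>c<n. A c a * (A c b * x b))"
        by (simp add: mat_vec_def gram_def sum_distrib_right mult.assoc)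
      also have "\<dots> = (\<Sum>c<n. \<Sum>b<n. A c a * (A c b * x b))" by (rule sum.swap)
      finally show "mat_vec n ?G x a = mat_vec n (\<lambda>i j. A j i) (mat_vec n A x) a"
        by (simp add: mat_vec_def sum_distrib_left)
    qed
    have "vec_norm n (mat_vec n ?G x) \<le> op_norm n A * vec_norm n (mat_vec n A x)"
      unfolding eq by (rule vec_norm_transpose_mat_vec)
    also have "\<dots> \<le> op_norm n A * (op_norm n A * vec_norm n x)"
      by (intro mult_left_mono vec_norm_mat_vec op_norm_nonneg)
    finally show ?thesis by (simp add: power2_eq_square mult.assoc)
  qed
  have pow: "vec_norm n (mat_vec n (mat_pow n ?G k) x) \<le> op_norm n A ^ (2 * k) * vec_norm n x" for k x
  proof (induction k arbitrary: x)
    case 0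
    have "vec_norm n (mat_vec n (mat_pow n ?G 0) x) = vec_norm n x"
      by (rule vec_norm_cong)
         (simp add: mat_vec_def sum.delta of_bool_def if_distrib[of "\<lambda>x. x * _"] cong: if_cong)
    then show ?case by (simp del: mat_pow.simps)
  next
    case (Suc k)
    have eq: "mat_vec n (mat_pow n ?G (Suc k)) x = mat_vec n (mat_pow n ?G k) (mat_vec n ?G x)"
    proof
      fix a
      have "mat_vec n (mat_pow n ?G (Suc k)) x a
          = (\<Sum>b<n. \<Sum>c<n. mat_pow n ?G k a c * (?G c b * x b))"
        by (simp add: mat_vec_def sum_distrib_right mult.assoc)
      also have "\<dots> = (\<Sum>c<n. \<Sum>b<n. mat_pow n ?G k a c * (?G c b * x b))" by (rule sum.swap)
      finally show "mat_vec n (mat_pow n ?G (Suc k)) x a = mat_vec n (mat_pow n ?G k) (mat_vec n ?G x) a"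
        by (simp add: mat_vec_def sum_distrib_left)
    qed
    have "vec_norm n (mat_vec n (mat_pow n ?G (Suc k)) x)
        \<le> op_norm n A ^ (2 * k) * vec_norm n (mat_vec n ?G x)"
      unfolding eq by (rule Suc.IH)
    also have "\<dots> \<le> op_norm n A ^ (2 * k) * ((op_norm n A)\<^sup>2 * vec_norm n x)"
      by (intro mult_left_mono G zero_le_power op_norm_nonneg)
    finally show ?case by (simp add: power2_eq_square mult_ac del: mat_pow.simps)
  qed
  have "mat_pow n ?G p a a \<le> op_norm n A ^ (2 * p)" if a: "a < n" for a
  proof -
    let ?y = "mat_vec n (mat_pow n ?G p) (\<lambda>k. of_bool (k = a))"
    have "mat_pow n ?G p a a = ?y a" using a by (simp add: mat_vec_unit)
    also have "\<dots> \<le> \<bar>?y a\<bar>" by simp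
    also have "\<dots> \<le> vec_norm n (\<lambda>a. \<bar>?y a\<bar>)"
      by (rule member_le_L2_set) (use a in auto)
    also have "\<dots> = vec_norm n ?y" by (simp add: L2_set_def)
    also have "\<dots> \<le> op_norm n A ^ (2 * p) * 1" using pow[of p "\<lambda>k. of_bool (k = a)"] a
      by (simp add: vec_norm_unit)
    finally show ?thesis by simp
  qed
  then have "trace_moment n A p \<le> (\<Sum>a<n. op_norm n A ^ (2 * p))"
    unfolding trace_moment_def by (intro sum_mono) auto
  then show ?thesis by simp
qed

text \<open>
  Entries of matrix powers are sums over paths. The weight \<open>\<phi>\<close> on the two end points makes the
  induction go through: the last edge of a longer path is absorbed into it.
\<close>
lemma sum_mat_pow_eq_paths:
  "(\<Sum>a<n. \<Sum>b<n. \<phi> a b * mat_pow n G k a b)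
     = (\<Sum>w\<in>{..<Suc k} \<rightarrow>\<^sub>E {..<n}. \<phi> (w 0) (w k) * (\<Prod>l<k. G (w l) (w (Suc l))))"
proof (induction k arbitrary: \<phi>)
  case 0
  have "(\<Sum>a<n. \<Sum>b<n. \<phi> a b * mat_pow n G 0 a b) = (\<Sum>a<n. \<phi> a a)"
    by (simp add: sum.delta' of_bool_def if_distrib[of "\<lambda>x. _ * x"] cong: if_cong)
  also have "\<dots> = (\<Sum>w\<in>{..<Suc 0} \<rightarrow>\<^sub>E {..<n}. \<phi> (w 0) (w 0))"
    by (rule sum.reindex_bij_witness[of _ "\<lambda>w. w 0" "\<lambda>a. (\<lambda>_\<in>{0}. a)"])
       (auto simp: PiE_def Pi_def extensional_def fun_eq_iff)
  finally show ?case by simp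
next
  case (Suc k)
  let ?W = "{..<Suc k} \<rightarrow>\<^sub>E {..<n}"
  let ?f = "\<lambda>w b. \<phi> (w 0) b * G (w k) b * (\<Prod>l<k. G (w l) (w (Suc l)))"
  have "(\<Sum>a<n. \<Sum>b<n. \<phi> a b * mat_pow n G (Suc k) a b)
      = (\<Sum>a<n. \<Sum>b<n. \<Sum>c<n. (\<phi> a b * G c b) * mat_pow n G k a c)"
    by (simp add: sum_distrib_left mult_ac)
  also have "\<dots> = (\<Sum>b<n. \<Sum>a<n. \<Sum>c<n. (\<phi> a b * G c b) * mat_pow n G k a c)"
    by (rule sum.swap)
  also have "\<dots> = (\<Sum>b<n. \<Sum>w\<in>?W. ?f w b)"
    by (intro sum.cong refl Suc.IH)
  also have "\<dots> = (\<Sum>(b, w)\<in>{..<n} \<times> ?W. ?f w b)"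
    by (rule sum.cartesian_product)
  also have "\<dots> = (\<Sum>w\<in>{..<Suc (Suc k)} \<rightarrow>\<^sub>E {..<n}.
      \<phi> (w 0) (w (Suc k)) * (\<Prod>l<Suc k. G (w l) (w (Suc l))))"
  proof -
    have ins: "{..<Suc (Suc k)} = insert (Suc k) {..<Suc k}" by auto
    have inj: "inj_on (\<lambda>(y, g). g(Suc k := y)) ({..<n} \<times> ?W)"
      using inj_combinator[of "Suc k" "{..<Suc k}" "\<lambda>_. {..<n}"] by simp
    have pr: "(\<Prod>l<k. G ((w(Suc k := b)) l) ((w(Suc k := b)) (Suc l))) = (\<Prod>l<k. G (w l) (w (Suc l)))"
      for w b by (rule prod.cong) auto
    show ?thesis
      unfolding ins PiE_insert_eq sum.reindex[OF inj]
    proof (intro sum.cong refl)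
      fix bw assume "bw \<in> {..<n} \<times> ?W"
      obtain b w where bw: "bw = (b, w)" by (cases bw)
      show "(case bw of (b, w) \<Rightarrow> ?f w b) = ((\<lambda>w. \<phi> (w 0) (w (Suc k)) * (\<Prod>l<Suc k. G (w l) (w (Suc l))))
          \<circ> (\<lambda>(y, g). g(Suc k := y))) bw"
        unfolding bw comp_def case_prod_conv prod.lessThan_Suc pr by (simp add: mult_ac)
    qed
  qed
  finally show ?case .
qed

text \<open>
  A closed walk alternates between the columns \<open>i 0, i 1, \<dots>\<close> and the rows \<open>j 0, j 1, \<dots>\<close>: its step l
  goes from column \<open>i l\<close> through row \<open>j l\<close> to the next column, cyclically.
\<close>
definition walk_product :: "(nat \<Rightarrow> nat \<Rightarrow> real) \<Rightarrow> nat \<Rightarrow> (nat \<Rightarrow> nat) \<Rightarrow> (nat \<Rightarrow> nat) \<Rightarrow> real" where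
  "walk_product A p i j = (\<Prod>l<p. A (j l) (i l) * A (j l) (i (Suc l mod p)))"

lemma trace_moment_eq_closed_walks:
  assumes "p > 0"
  shows "trace_moment n A p
    = (\<Sum>i\<in>{..<p} \<rightarrow>\<^sub>E {..<n}. \<Sum>j\<in>{..<p} \<rightarrow>\<^sub>E {..<n}. walk_product A p i j)"
proof -
  obtain k where p: "p = Suc k" using assms by (cases p) auto
  let ?G = "gram n A"
  have "trace_moment n A p = (\<Sum>a<n. \<Sum>c<n. ?G c a * mat_pow n ?G k a c)"
    by (simp add: trace_moment_def p mult.commute)
  also have "\<dots> = (\<Sum>w\<in>{..<p} \<rightarrow>\<^sub>E {..<n}. ?G (w k) (w 0) * (\<Prod>l<k. ?G (w l) (w (Suc l))))"
    using sum_mat_pow_eq_paths[of "\<lambda>a c. ?G c a" n ?G k] by (simp add: p)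
  also have "\<dots> = (\<Sum>w\<in>{..<p} \<rightarrow>\<^sub>E {..<n}. \<Prod>l<p. ?G (w l) (w (Suc l mod p)))"
    by (simp add: p mult.commute)
  also have "\<dots> = (\<Sum>i\<in>{..<p} \<rightarrow>\<^sub>E {..<n}. \<Sum>j\<in>{..<p} \<rightarrow>\<^sub>E {..<n}. walk_product A p i j)"
    unfolding gram_def walk_product_def
    by (intro sum.cong refl prod_sum_PiE) auto
  finally show ?thesis .
qed

section \<open>Comparing walk sums of different dimension and density\<close>
definition walk_steps :: "nat \<Rightarrow> (nat \<times> bool) set" where
  "walk_steps p = {..<p} \<times> UNIV"

text \<open>
  The two edges of step l are indexed by \<open>(l, False)\<close> (from \<open>i l\<close> to \<open>j l\<close>) and
  \<open>(l, True)\<close> (from \<open>j l\<close> to the next column). An edge is recorded as (row, column).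
\<close>
definition walk_edge :: "nat \<Rightarrow> (nat \<Rightarrow> nat) \<Rightarrow> (nat \<Rightarrow> nat) \<Rightarrow> nat \<times> bool \<Rightarrow> nat \<times> nat" where
  "walk_edge p i j t = (j (fst t), i (if snd t then Suc (fst t) mod p else fst t))"

definition even_walk :: "nat \<Rightarrow> (nat \<Rightarrow> nat) \<Rightarrow> (nat \<Rightarrow> nat) \<Rightarrow> bool" where
  "even_walk p i j \<longleftrightarrow>
     (\<forall>t\<in>walk_steps p. even (card {t'\<in>walk_steps p. walk_edge p i j t' = walk_edge p i j t}))"

definition walk_weight :: "real \<Rightarrow> nat \<Rightarrow> (nat \<Rightarrow> nat) \<Rightarrow> (nat \<Rightarrow> nat) \<Rightarrow> real" where
  "walk_weight \<rho> p i j = (if even_walk p i j then \<rho> ^ card (walk_edge p i j ` walk_steps p) else 0)"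

text \<open>
  This is the expected trace of the p-th power of \<open>Y\<^sup>T Y\<close> for an n by n matrix of symmetric signs of
  density \<open>\<rho>\<close>, written as a purely combinatorial quantity so that models with different
  parameters can be compared without putting them on one probability space.
\<close>
definition walk_sum :: "nat \<Rightarrow> real \<Rightarrow> nat \<Rightarrow> real" where
  "walk_sum n \<rho> p = (\<Sum>i\<in>{..<p} \<rightarrow>\<^sub>E {..<n}. \<Sum>j\<in>{..<p} \<rightarrow>\<^sub>E {..<n}. walk_weight \<rho> p i j)"

lemma finite_walk_steps [simp]: "finite (walk_steps p)"
  by (simp add: walk_steps_def)

text \<open>
  A connected graph has at most one vertex more than it has edges: along the path, each half step
  that visits a new vertex also uses a new edge.
\<close>
lemma card_path_vertices:
  fixes a b :: "nat \<Rightarrow> nat"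
  shows "card (a ` {..l}) + card (b ` {..<l})
    \<le> Suc (card ((\<lambda>t. (b t, a t)) ` {..<l} \<union> (\<lambda>t. (b t, a (Suc t))) ` {..<l}))"
proof (induction l)
  case 0
  have "{..0::nat} = {0}" by auto
  then show ?case by simp
next
  case (Suc l)
  let ?E = "(\<lambda>t. (b t, a t)) ` {..<l} \<union> (\<lambda>t. (b t, a (Suc t))) ` {..<l}"
  let ?E1 = "insert (b l, a l) ?E"
  have E: "(\<lambda>t. (b t, a t)) ` {..<Suc l} \<union> (\<lambda>t. (b t, a (Suc t))) ` {..<Suc l}
      = insert (b l, a (Suc l)) ?E1"
    by (auto simp: lessThan_Suc)
  have fin: "finite ?E" by simp
  have b: "card (b ` {..<Suc l}) = card (b ` {..<l}) + of_bool (b l \<notin> b ` {..<l})"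
    by (auto simp: lessThan_Suc card_insert_if)
  have a: "card (a ` {..Suc l}) = card (a ` {..l}) + of_bool (a (Suc l) \<notin> a ` {..l})"
    by (auto simp: atMost_Suc card_insert_if)
  have 1: "card ?E + of_bool (b l \<notin> b ` {..<l}) \<le> card ?E1"
    using fin by (auto simp: card_insert_if)
  \<comment> \<open>A column met for the first time cannot occur in an earlier edge, nor in the edge \<open>(b l, a l)\<close>
    that was just added.\<close>
  have notin: "(b l, a (Suc l)) \<notin> ?E1" if "a (Suc l) \<notin> a ` {..l}"
    using that by (auto simp: image_iff)
  have 2: "card ?E1 + of_bool (a (Suc l) \<notin> a ` {..l}) \<le> card (insert (b l, a (Suc l)) ?E1)"
  proof (cases "a (Suc l) \<in> a ` {..l}")
    case True
    then show ?thesis using fin by (simp add: card_mono subset_insertI)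
  next
    case False
    then show ?thesis using notin[OF False] fin by (simp only: card_insert_disjoint finite_insert) simp
  qed
  show ?case unfolding E using Suc.IH a b 1 2 by linarith
qed

lemma card_walk_vertices:
  assumes "p > 0"
  shows "card (i ` {..<p}) + card (j ` {..<p}) \<le> Suc (card (walk_edge p i j ` walk_steps p))"
proof -
  let ?a = "\<lambda>t. i (t mod p)"
  have "i ` {..<p} \<subseteq> ?a ` {..p}"
  proof safe
    fix x assume "x < p"
    then have "i x = i (x mod p)" "x \<in> {..p}" by auto
    then show "i x \<in> ?a ` {..p}" by blast
  qed
  then have 1: "card (i ` {..<p}) \<le> card (?a ` {..p})" by (intro card_mono) auto
  have "(\<lambda>t. (j t, ?a t)) ` {..<p} \<union> (\<lambda>t. (j t, ?a (Suc t))) ` {..<p} \<subseteq> walk_edge p i j ` walk_steps p"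
  proof safe
    fix t assume t: "t < p"
    have "(j t, ?a t) = walk_edge p i j (t, False)" "(j t, ?a (Suc t)) = walk_edge p i j (t, True)"
      using t by (auto simp: walk_edge_def)
    moreover have "(t, s) \<in> walk_steps p" for s using t by (simp add: walk_steps_def)
    ultimately show "(j t, ?a t) \<in> walk_edge p i j ` walk_steps p"
      "(j t, ?a (Suc t)) \<in> walk_edge p i j ` walk_steps p" by blast+
  qed
  from card_mono[OF _ this] card_path_vertices[of ?a p j] 1
  show ?thesis by simp
qed

text \<open>
  Two labellings have the same kernel if they identify the same positions. Walks with the same
  kernels in rows and columns have the same shape, hence the same weight.
\<close>
definition same_kernel :: "'a set \<Rightarrow> ('a \<Rightarrow> 'b) \<Rightarrow> ('a \<Rightarrow> 'c) \<Rightarrow> bool" where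
  "same_kernel S f g \<longleftrightarrow> (\<forall>x\<in>S. \<forall>y\<in>S. f x = f y \<longleftrightarrow> g x = g y)"

lemma same_kernel_sym: "same_kernel S f g \<longleftrightarrow> same_kernel S g f"
  by (auto simp: same_kernel_def)

text \<open>
  The map \<open>f x \<mapsto> g x\<close> is a well-defined bijection between the images.
\<close>
lemma same_kernel_card_image:
  assumes "same_kernel S f g" shows "card (f ` S) = card (g ` S)"
proof (rule bij_betw_same_card)
  let ?h = "\<lambda>y. g (inv_into S f y)"
  have h: "?h (f x) = g x" if "x \<in> S" for x
    using assms that inv_into_into[of "f x" f S] f_inv_into_f[of "f x" f S]
    by (auto simp: same_kernel_def)
  show "bij_betw ?h (f ` S) (g ` S)"
  proof (rule bij_betwI')
    fix x y assume "x \<in> f ` S" "y \<in> f ` S"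
    then show "(?h x = ?h y) = (x = y)" using assms h by (auto simp: same_kernel_def)
  next
    fix x assume "x \<in> f ` S" then show "?h x \<in> g ` S" using h by auto
  next
    fix y assume "y \<in> g ` S"
    then obtain x where "x \<in> S" "y = g x" by auto
    then show "\<exists>z\<in>f ` S. y = ?h z" using h by auto
  qed
qed

lemma same_kernel_walk_edge:
  assumes "same_kernel {..<p} i i'" "same_kernel {..<p} j j'"
  shows "same_kernel (walk_steps p) (walk_edge p i j) (walk_edge p i' j')"
  unfolding same_kernel_def
proof safe
  fix l s l' s' assume t: "(l, s) \<in> walk_steps p" "(l', s') \<in> walk_steps p"
  let ?u = "\<lambda>l s. if s then Suc l mod p else l"
  have l: "l < p" "l' < p" and "?u l s < p" "?u l' s' < p" using t by (auto simp: walk_steps_def)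
  then have "(i (?u l s) = i (?u l' s')) = (i' (?u l s) = i' (?u l' s'))" "(j l = j l') = (j' l = j' l')"
    using assms unfolding same_kernel_def by blast+
  then have "(walk_edge p i j (l, s) = walk_edge p i j (l', s'))
      = (walk_edge p i' j' (l, s) = walk_edge p i' j' (l', s'))"
    by (simp only: walk_edge_def prod.inject fst_conv snd_conv)
  then show "walk_edge p i j (l, s) = walk_edge p i j (l', s') \<Longrightarrow>
      walk_edge p i' j' (l, s) = walk_edge p i' j' (l', s')"
    "walk_edge p i' j' (l, s) = walk_edge p i' j' (l', s') \<Longrightarrow>
      walk_edge p i j (l, s) = walk_edge p i j (l', s')" by auto
qed

lemma same_kernel_walk_weight:
  assumes "same_kernel {..<p} i i'" "same_kernel {..<p} j j'"
  shows "walk_weight \<rho> p i j = walk_weight \<rho> p i' j'"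
proof -
  note K = same_kernel_walk_edge[OF assms]
  have "{t'\<in>walk_steps p. walk_edge p i j t' = walk_edge p i j t}
      = {t'\<in>walk_steps p. walk_edge p i' j' t' = walk_edge p i' j' t}" if "t \<in> walk_steps p" for t
    using K that unfolding same_kernel_def by blast
  then have "even_walk p i j = even_walk p i' j'" by (simp add: even_walk_def)
  then show ?thesis by (simp add: walk_weight_def same_kernel_card_image[OF K])
qed

text \<open>
  A labelling with a prescribed kernel is determined by one value per class.
\<close>
lemma card_same_kernel_le:
  assumes "finite S"
  shows "card {g \<in> S \<rightarrow>\<^sub>E {..<n::nat}. same_kernel S f g} \<le> n ^ card (f ` S)"
proof -
  let ?F = "\<lambda>g. \<lambda>y\<in>f ` S. g (inv_into S f y)"
  let ?K = "{g \<in> S \<rightarrow>\<^sub>E {..<n}. same_kernel S f g}"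
  have val: "?F g (f x) = g x" if "x \<in> S" "g \<in> ?K" for x g
    using that inv_into_into[of "f x" f S] f_inv_into_f[of "f x" f S]
    by (auto simp: same_kernel_def)
  have "card ?K \<le> card (f ` S \<rightarrow>\<^sub>E {..<n})"
  proof (rule card_inj_on_le)
    show "inj_on ?F ?K"
    proof (rule inj_onI)
      fix g h assume gh: "g \<in> ?K" "h \<in> ?K" and eq: "?F g = ?F h"
      have "g x = h x" if "x \<in> S" for x using val[OF that gh(1)] val[OF that gh(2)] eq by metis
      with gh show "g = h" by (intro PiE_ext[of g S _ h]) auto
    qed
    show "?F ` ?K \<subseteq> f ` S \<rightarrow>\<^sub>E {..<n}"
    proof safe
      fix g y assume "g \<in> S \<rightarrow>\<^sub>E {..<n}" "y \<in> S"
      then show "?F g (f y) < n" using inv_into_into[of "f y" f S] by (auto simp: PiE_iff)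
    qed auto
    show "finite (f ` S \<rightarrow>\<^sub>E {..<n})" using assms by (intro finite_PiE) auto
  qed
  also have "\<dots> = n ^ card (f ` S)" using assms by (subst card_funcsetE) auto
  finally show ?thesis .
qed

text \<open>
  Injective relabellings of the classes keep the kernel. Since there are at most \<open>card S\<close>
  classes and twice as many labels, each class in turn has at least \<open>card S\<close> labels to choose from.
\<close>
lemma card_same_kernel_ge:
  assumes "finite S"
  shows "card S ^ card (f ` S) \<le> card {g \<in> S \<rightarrow>\<^sub>E {..<2 * card S}. same_kernel S f g}"
proof -
  let ?I = "{h \<in> f ` S \<rightarrow>\<^sub>E {..<2 * card S}. inj_on h (f ` S)}"
  let ?K = "{g \<in> S \<rightarrow>\<^sub>E {..<2 * card S}. same_kernel S f g}"
  let ?F = "\<lambda>h. \<lambda>x\<in>S. h (f x)"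
  have v: "card (f ` S) \<le> card S" by (rule card_image_le) fact
  have "card S ^ card (f ` S) = (\<Prod>i = 0..<card (f ` S). card S)" by simp
  also have "\<dots> \<le> (\<Prod>i = 0..<card (f ` S). 2 * card S - i)"
    by (intro prod_mono) (use v in auto)
  also have "\<dots> = card ?I"
    using card_inj_on_subset_funcset[of "f ` S" "{..<2 * card S}" "f ` S"] v assms by simp
  also have "\<dots> \<le> card ?K"
  proof (rule card_inj_on_le)
    show "inj_on ?F ?I"
    proof (rule inj_onI)
      fix g h assume gh: "g \<in> ?I" "h \<in> ?I" and eq: "?F g = ?F h"
      have "g (f x) = h (f x)" if "x \<in> S" for x using fun_cong[OF eq, of x] that by simp
      with gh show "g = h" by (intro PiE_ext[of g "f ` S" _ h]) auto
    qed
    show "?F ` ?I \<subseteq> ?K" by (auto simp: same_kernel_def inj_on_def PiE_iff)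
    show "finite ?K" using assms by (simp add: finite_PiE)
  qed
  finally show ?thesis .
qed

text \<open>
  Double counting of the pairs of walks of equal shape, one in dimension n and one in dimension 2p. A
  shape with v vertices is realised by at most \<open>n ^ v\<close> walks of the first kind and by at least
  \<open>p ^ v\<close> of the second, so it suffices that \<open>n ^ v * \<rho> ^ e \<le> n * (p ^ v * q ^ e)\<close>. As
  \<open>\<rho> \<le> m * q / n\<close>, this reduces to \<open>n ^ (v - 1) * m ^ e \<le> n ^ e * p ^ v\<close>, which holds because
  \<open>v - 1 \<le> e\<close> and \<open>1 \<le> m \<le> min n p\<close>.
\<close>
lemma walk_sum_comparison:
  fixes m \<rho> q :: real
  assumes p: "p > 0" and m: "1 \<le> m" "m \<le> n" "m \<le> p"
    and \<rho>: "0 \<le> \<rho>" and q: "0 \<le> q" and le: "n * \<rho> \<le> m * q"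
  shows "walk_sum n \<rho> p \<le> n * walk_sum (2 * p) q p"
proof -
  define W where "W n = ({..<p} \<rightarrow>\<^sub>E {..<n::nat}) \<times> ({..<p} \<rightarrow>\<^sub>E {..<n})" for n
  define R where "R w w' \<longleftrightarrow> same_kernel {..<p} (fst w) (fst w') \<and> same_kernel {..<p} (snd w) (snd w')"
    for w w' :: "(nat \<Rightarrow> nat) \<times> (nat \<Rightarrow> nat)"
  define v where "v w = card (fst w ` {..<p}) + card (snd w ` {..<p})" for w :: "(nat \<Rightarrow> nat) \<times> (nat \<Rightarrow> nat)"
  define a where "a \<rho> w = walk_weight \<rho> p (fst w) (snd w)" for \<rho> w
  have finW: "finite (W n)" for n by (auto simp: W_def intro!: finite_PiE)
  have sum_W: "walk_sum n \<rho> p = (\<Sum>w\<in>W n. a \<rho> w)" for n \<rho>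
    unfolding walk_sum_def W_def a_def by (simp add: sum.cartesian_product split_def)
  have a0: "0 \<le> a \<rho> w" if "0 \<le> \<rho>" for \<rho> w using that by (simp add: a_def walk_weight_def)
  have fib: "{w' \<in> W n. R w w'} = {g \<in> {..<p} \<rightarrow>\<^sub>E {..<n}. same_kernel {..<p} (fst w) g}
      \<times> {g \<in> {..<p} \<rightarrow>\<^sub>E {..<n}. same_kernel {..<p} (snd w) g}" for n w
    unfolding W_def R_def by (simp add: set_eq_iff) blast
  have ge: "p ^ v w \<le> card {w' \<in> W (2 * p). R w w'}" for w
    unfolding fib card_cartesian_product v_def power_add
    using card_same_kernel_ge[of "{..<p}"] by (intro mult_mono) auto
  have le': "card {w' \<in> W n. R w w'} \<le> n ^ v w" for w
    unfolding fib card_cartesian_product v_def power_add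
    by (intro mult_mono card_same_kernel_le) auto
  have Ra: "a \<rho> w = a \<rho> w'" "v w = v w'" if "R w w'" for w w'
    using that same_kernel_walk_weight[of p "fst w" "fst w'" "snd w" "snd w'"]
      same_kernel_card_image[of "{..<p}" "fst w" "fst w'"]
      same_kernel_card_image[of "{..<p}" "snd w" "snd w'"]
    by (auto simp: R_def a_def v_def)
  have Rsym: "R w w' = R w' w" for w w' unfolding R_def by (auto intro: same_kernel_sym[THEN iffD1])
  have "walk_sum n \<rho> p = (\<Sum>w\<in>W n. a \<rho> w)" by (rule sum_W)
  also have "\<dots> \<le> (\<Sum>w\<in>W n. card {w' \<in> W (2 * p). R w w'} * (a \<rho> w / p ^ v w))"
  proof (rule sum_mono)
    fix w
    have "a \<rho> w = real (p ^ v w) * (a \<rho> w / p ^ v w)" using p by simp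
    also have "\<dots> \<le> card {w' \<in> W (2 * p). R w w'} * (a \<rho> w / p ^ v w)"
      using ge[of w] a0[OF \<rho>] by (intro mult_right_mono) (auto simp flip: of_nat_power)
    finally show "a \<rho> w \<le> \<dots>" .
  qed
  also have "\<dots> = (\<Sum>w\<in>W n. \<Sum>w'\<in>{w' \<in> W (2 * p). R w w'}. a \<rho> w / p ^ v w)" by simp
  also have "\<dots> = (\<Sum>w'\<in>W (2 * p). \<Sum>w\<in>{w \<in> W n. R w w'}. a \<rho> w / p ^ v w)"
    by (rule sum.swap_restrict) (auto simp: finW)
  also have "\<dots> = (\<Sum>w'\<in>W (2 * p). card {w \<in> W n. R w' w} * (a \<rho> w' / p ^ v w'))"
  proof (intro sum.cong refl)
    fix w'
    have "(\<Sum>w\<in>{w \<in> W n. R w w'}. a \<rho> w / p ^ v w) = (\<Sum>w\<in>{w \<in> W n. R w w'}. a \<rho> w' / p ^ v w')"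
    proof (rule sum.cong[OF refl])
      fix w assume "w \<in> {w \<in> W n. R w w'}"
      then have "R w w'" by blast
      then show "a \<rho> w / p ^ v w = a \<rho> w' / p ^ v w'" using Ra[of w w'] by simp
    qed
    then show "(\<Sum>w\<in>{w \<in> W n. R w w'}. a \<rho> w / p ^ v w) = card {w \<in> W n. R w' w} * (a \<rho> w' / p ^ v w')"
      by (simp add: Rsym)
  qed
  also have "\<dots> \<le> (\<Sum>w'\<in>W (2 * p). n * a q w')"
  proof (rule sum_mono)
    fix w
    let ?e = "card (walk_edge p (fst w) (snd w) ` walk_steps p)"
    have n0: "0 < real n" using m by linarith
    have v1: "1 \<le> v w"
    proof -
      have "fst w ` {..<p} \<noteq> {}" using p by auto
      then have "card (fst w ` {..<p}) > 0" by (simp add: card_gt_0_iff)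
      then show ?thesis by (simp add: v_def)
    qed
    have "v w \<le> Suc ?e" unfolding v_def by (rule card_walk_vertices[OF p])
    \<comment> \<open>k is the number of independent cycles of the graph traced out by the walk.\<close>
    with v1 obtain k where e: "?e = (v w - 1) + k" and vw: "v w = Suc (v w - 1)"
      by (metis Suc_le_D add_diff_cancel_left' diff_Suc_1 le_Suc_ex not_less_eq_eq One_nat_def)
    have key: "real n ^ v w * \<rho> ^ ?e \<le> n * (p ^ v w * q ^ ?e)"
    proof -
      have "\<rho> \<le> m * q / n" using le n0 by (simp add: field_simps)
      then have "\<rho> ^ ?e \<le> (m * q / n) ^ ?e" using \<rho> by (rule power_mono)
      then have "real n ^ v w * \<rho> ^ ?e \<le> real n ^ v w * (m * q / n) ^ ?e"
        using n0 by (intro mult_left_mono) auto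
      also have "\<dots> = n * (m ^ (v w - 1) * (m / n) ^ k * q ^ ?e)"
        using n0 unfolding e by (subst vw) (simp add: power_add power_mult_distrib power_divide)
      also have "\<dots> \<le> n * (p ^ v w * 1 * q ^ ?e)"
      proof -
        have "m ^ (v w - 1) \<le> m ^ v w" using m by (intro power_increasing) auto
        also have "\<dots> \<le> real (p ^ v w)" using m unfolding of_nat_power by (intro power_mono) auto
        finally have 1: "m ^ (v w - 1) \<le> p ^ v w" .
        have 2: "(m / n) ^ k \<le> 1" using m n0 by (intro power_le_one) auto
        have "m ^ (v w - 1) * (m / n) ^ k \<le> real (p ^ v w) * 1"
          by (rule mult_mono[OF 1 2]) (use m n0 in auto)
        then have "m ^ (v w - 1) * (m / n) ^ k * q ^ ?e \<le> real (p ^ v w) * 1 * q ^ ?e"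
          using q by (intro mult_right_mono) auto
        then show ?thesis using n0 by (intro mult_left_mono) auto
      qed
      finally show ?thesis by simp
    qed
    have "card {w' \<in> W n. R w w'} * (a \<rho> w / p ^ v w) \<le> real (n ^ v w) * (a \<rho> w / p ^ v w)"
      using le'[of w] a0[OF \<rho>] by (intro mult_right_mono) (auto simp flip: of_nat_power)
    also have "\<dots> \<le> n * a q w"
      using key p by (auto simp: a_def walk_weight_def field_simps)
    finally show "card {w' \<in> W n. R w w'} * (a \<rho> w / p ^ v w) \<le> n * a q w" .
  qed
  also have "\<dots> = n * walk_sum (2 * p) q p" by (simp add: sum_W sum_distrib_left)
  finally show ?thesis .
qed

section \<open>A lattice net and the norm of a matrix\<close>
text \<open>
  After scaling by \<open>1 / sqrt r\<close> this is a 1/2-net of the unit ball of \<open>\<real>\<^sup>r\<close>. A lattice is used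
  because its points can be counted by a generating function; the box of side 6r, which contains all
  integer points of the ball, makes the set visibly finite.
\<close>
definition lattice_net :: "nat \<Rightarrow> (nat \<Rightarrow> int) set" where
  "lattice_net r = {z \<in> {..<r} \<rightarrow>\<^sub>E {- 3 * int r..3 * int r}. (\<Sum>i<r. (z i)\<^sup>2) \<le> 3 * int r}"

lemma finite_lattice_net: "finite (lattice_net r)"
  unfolding lattice_net_def by (rule finite_subset[of _ "{..<r} \<rightarrow>\<^sub>E {- 3 * int r..3 * int r}"])
    (auto intro!: finite_PiE)

lemma sum_half_powers_int: "(\<Sum>k\<in>{- int M..int M}. (1 / 2 :: real) ^ nat \<bar>k\<bar>) = 3 - 2 * (1 / 2) ^ M"
proof (induction M)
  case (Suc M)
  have "{- int (Suc M)..int (Suc M)} = insert (int (Suc M)) (insert (- int (Suc M)) {- int M..int M})"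
    by auto
  then show ?case using Suc by (simp add: nat_add_distrib)
qed simp

text \<open>
  Each point z of the net satisfies \<open>\<Sum>\<bar>z i\<bar> \<le> \<Sum>(z i)\<^sup>2 \<le> 3 r\<close>, so
  \<open>1 \<le> 8 ^ r * \<Prod>(1/2) ^ \<bar>z i\<bar>\<close>. Summing this over all lattice points of the box factorises, and each factor is at
  most 3.
\<close>
lemma card_lattice_net: "card (lattice_net r) \<le> 24 ^ r"
proof -
  let ?B = "{..<r} \<rightarrow>\<^sub>E {- 3 * int r..3 * int r}"
  let ?h = "\<lambda>k. (1 / 2 :: real) ^ nat \<bar>k\<bar>"
  have fin: "finite ?B" by (auto intro!: finite_PiE)
  have "real (card (lattice_net r)) = (\<Sum>z\<in>lattice_net r. 1)" by simp
  also have "\<dots> \<le> (\<Sum>z\<in>lattice_net r. 8 ^ r * (\<Prod>i<r. ?h (z i)))"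
  proof (rule sum_mono)
    fix z assume z: "z \<in> lattice_net r"
    have "(\<Sum>i<r. \<bar>z i\<bar>) \<le> (\<Sum>i<r. (z i)\<^sup>2)"
    proof (rule sum_mono)
      fix i
      show "\<bar>z i\<bar> \<le> (z i)\<^sup>2"
        using self_le_power[of "\<bar>z i\<bar>" 2] by (cases "z i = 0") auto
    qed
    also have "\<dots> \<le> 3 * int r" using z by (simp add: lattice_net_def)
    finally have le: "(\<Sum>i<r. nat \<bar>z i\<bar>) \<le> 3 * r"
      by (simp flip: of_nat_le_iff[where ?'a = int])
    have "(1 / 2 :: real) ^ (3 * r) \<le> (1 / 2) ^ (\<Sum>i<r. nat \<bar>z i\<bar>)"
      using le by (rule power_decreasing) auto
    also have "\<dots> = (\<Prod>i<r. ?h (z i))" by (rule power_sum)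
    finally have "8 ^ r * (1 / 2 :: real) ^ (3 * r) \<le> 8 ^ r * (\<Prod>i<r. ?h (z i))"
      by (intro mult_left_mono) auto
    moreover have "8 ^ r * (1 / 2 :: real) ^ (3 * r) = 1"
      by (simp add: power_mult power3_eq_cube flip: power_mult_distrib)
    ultimately show "1 \<le> 8 ^ r * (\<Prod>i<r. ?h (z i))" by simp
  qed
  also have "\<dots> \<le> (\<Sum>z\<in>?B. 8 ^ r * (\<Prod>i<r. ?h (z i)))"
  proof (rule sum_mono2[OF fin])
    show "lattice_net r \<subseteq> ?B" unfolding lattice_net_def by blast
    show "0 \<le> 8 ^ r * (\<Prod>i<r. ?h (z i))" for z by (intro mult_nonneg_nonneg prod_nonneg) simp_all
  qed
  also have "\<dots> = 8 ^ r * (\<Prod>i<r. \<Sum>k\<in>{- int (3 * r)..int (3 * r)}. ?h k)"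
    by (subst prod_sum_PiE) (simp_all add: sum_distrib_left)
  also have "\<dots> \<le> 8 ^ r * (\<Prod>i<r. 3)"
  proof (intro mult_left_mono prod_mono conjI)
    show "0 \<le> (\<Sum>k\<in>{- int (3 * r)..int (3 * r)}. ?h k)" by (intro sum_nonneg) simp
    show "(\<Sum>k\<in>{- int (3 * r)..int (3 * r)}. ?h k) \<le> 3" unfolding sum_half_powers_int by simp
  qed simp
  also have "\<dots> = real (24 ^ r)" by (simp add: power_mult_distrib[symmetric])
  finally show ?thesis by (simp only: of_nat_le_iff)
qed

lemma lattice_net_norm_sq:
  "z \<in> lattice_net r \<Longrightarrow> (\<Sum>i<r. (real_of_int (z i))\<^sup>2) \<le> 3 * real r"
  unfolding lattice_net_def
  by (simp flip: of_int_power of_int_sum)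

text \<open>
  Rounding each coordinate moves a vector of norm at most \<open>sqrt r\<close> by at most \<open>sqrt r / 2\<close>, so the
  result has squared norm at most \<open>9 / 4 * r \<le> 3 * r\<close>.
\<close>
lemma lattice_net_approx:
  assumes u: "vec_norm r u \<le> sqrt r"
  obtains z where "z \<in> lattice_net r" "vec_norm r (\<lambda>i. u i - real_of_int (z i)) \<le> sqrt r / 2"
proof
  define z where "z = (\<lambda>i\<in>{..<r}. round (u i))"
  have z: "z i = round (u i)" if "i < r" for i using that by (simp add: z_def)
  have close: "\<bar>u i - real_of_int (z i)\<bar> \<le> 1 / 2" if "i < r" for i
    using of_int_round_abs_le[of "u i"] that by (simp add: z abs_minus_commute)
  have "(vec_norm r (\<lambda>i. u i - real_of_int (z i)))\<^sup>2 \<le> (\<Sum>i<r. (1 / 2)\<^sup>2)"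
    unfolding vec_norm_sq using close
    by (intro sum_mono) (metis abs_le_square_iff abs_of_nonneg half_gt_zero_iff lessThan_iff less_eq_real_def zero_less_one)
  also have "\<dots> = (sqrt r / 2)\<^sup>2" by (simp add: power_divide)
  finally show 1: "vec_norm r (\<lambda>i. u i - real_of_int (z i)) \<le> sqrt r / 2"
    by (rule power2_le_imp_le) simp
  have "vec_norm r (\<lambda>i. real_of_int (z i)) = vec_norm r (\<lambda>i. u i + (- 1) * (u i - real_of_int (z i)))"
    by simp
  also have "\<dots> \<le> vec_norm r u + vec_norm r (\<lambda>i. (- 1) * (u i - real_of_int (z i)))"
    by (rule L2_set_triangle_ineq)
  also have "\<dots> \<le> sqrt r + sqrt r / 2"
    using u 1 unfolding vec_norm_scale by simp
  finally have "(vec_norm r (\<lambda>i. real_of_int (z i)))\<^sup>2 \<le> (3 / 2 * sqrt r)\<^sup>2"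
    by (intro power_mono) auto
  then have "(\<Sum>i<r. (real_of_int (z i))\<^sup>2) \<le> 9 / 4 * real r"
    unfolding vec_norm_sq by (simp add: power_mult_distrib power_divide)
  also have "\<dots> \<le> 3 * real r" by simp
  finally have sq: "(\<Sum>i<r. (z i)\<^sup>2) \<le> 3 * int r"
    by (simp flip: of_int_power of_int_sum)
  have "\<bar>z i\<bar> \<le> 3 * int r" if "i < r" for i
  proof -
    have "\<bar>z i\<bar> \<le> (z i)\<^sup>2" using self_le_power[of "\<bar>z i\<bar>" 2] by (cases "z i = 0") auto
    also have "\<dots> \<le> (\<Sum>i<r. (z i)\<^sup>2)" by (rule member_le_sum) (use that in auto)
    finally show ?thesis using sq by simp
  qed
  then show "z \<in> lattice_net r"
    using sq by (force simp: lattice_net_def PiE_iff abs_le_iff z_def)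
qed

text \<open>
  Test v against the net point next to \<open>sqrt r * v / \<bar>v\<bar>\<close>: the rounding error costs at most half of
  \<open>sqrt r * \<bar>v\<bar>\<close>.
\<close>
lemma vec_norm_le_lattice_net:
  assumes K: "\<And>z. z \<in> lattice_net r \<Longrightarrow> (\<Sum>i<r. real_of_int (z i) * v i) \<le> K"
  shows "sqrt r * vec_norm r v \<le> 2 * K"
proof (cases "vec_norm r v = 0")
  case True
  have "(\<lambda>i\<in>{..<r}. 0) \<in> lattice_net r" by (auto simp: lattice_net_def)
  from K[OF this] True show ?thesis by simp
next
  case False
  then have pos: "vec_norm r v > 0" using L2_set_nonneg[of v "{..<r}"] by linarith
  define c where "c = sqrt r / vec_norm r v"
  have c: "c \<ge> 0" using pos by (simp add: c_def)
  have "vec_norm r (\<lambda>i. c * v i) \<le> sqrt r" unfolding vec_norm_scale using pos by (simp add: c_def)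
  then obtain z where z: "z \<in> lattice_net r" "vec_norm r (\<lambda>i. c * v i - real_of_int (z i)) \<le> sqrt r / 2"
    by (rule lattice_net_approx)
  have "(\<Sum>i<r. c * v i * v i) = c * (vec_norm r v)\<^sup>2"
    unfolding vec_norm_sq by (simp add: power2_eq_square sum_distrib_left mult.assoc)
  also have "\<dots> = sqrt r * vec_norm r v" using pos by (simp add: c_def power2_eq_square)
  finally have 1: "(\<Sum>i<r. c * v i * v i) = sqrt r * vec_norm r v" .
  have "(\<Sum>i<r. (c * v i - real_of_int (z i)) * v i) \<le> vec_norm r (\<lambda>i. c * v i - real_of_int (z i)) * vec_norm r v"
    using cauchy_schwarz_sum[of "\<lambda>i. c * v i - real_of_int (z i)" v r] by linarith
  also have "\<dots> \<le> sqrt r / 2 * vec_norm r v" using z(2) by (intro mult_right_mono) auto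
  finally have "(\<Sum>i<r. c * v i * v i) - (\<Sum>i<r. real_of_int (z i) * v i) \<le> sqrt r / 2 * vec_norm r v"
    by (simp add: left_diff_distrib sum_subtractf)
  with 1 K[OF z(1)] show ?thesis by simp
qed

definition bilin :: "nat \<Rightarrow> (nat \<Rightarrow> nat \<Rightarrow> real) \<Rightarrow> (nat \<Rightarrow> int) \<Rightarrow> (nat \<Rightarrow> int) \<Rightarrow> real" where
  "bilin r A z z' = (\<Sum>i<r. \<Sum>j<r. z i * z' j * A i j)"

text \<open>
  Restricting the left and the right vector to the net costs a factor 2 each; on the right the
  error term \<open>op_norm r A / 2\<close> is absorbed into the left-hand side.
\<close>
lemma op_norm_le_lattice_net:
  assumes r: "r > 0"
    and K: "\<And>z z'. z \<in> lattice_net r \<Longrightarrow> z' \<in> lattice_net r \<Longrightarrow> bilin r A z z' \<le> K"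
  shows "op_norm r A \<le> 4 * K / r"
proof -
  have sr: "sqrt r > 0" "sqrt r * sqrt r = r" using r by auto
  have step: "sqrt r * vec_norm r (mat_vec r A (\<lambda>i. real_of_int (z' i))) \<le> 2 * K"
    if z': "z' \<in> lattice_net r" for z'
  proof (rule vec_norm_le_lattice_net)
    fix z assume "z \<in> lattice_net r"
    from K[OF this z'] show "(\<Sum>i<r. real_of_int (z i) * mat_vec r A (\<lambda>i. real_of_int (z' i)) i) \<le> K"
      by (simp add: bilin_def mat_vec_def sum_distrib_left mult_ac)
  qed
  have "op_norm r A \<le> 2 * K / r + op_norm r A / 2"
  proof (rule op_norm_least)
    fix x assume x: "vec_norm r x \<le> 1"
    have "vec_norm r (\<lambda>i. sqrt r * x i) \<le> sqrt r"
      unfolding vec_norm_scale using x mult_left_mono[OF x, of "sqrt r"] by simp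
    then obtain z where z: "z \<in> lattice_net r" "vec_norm r (\<lambda>i. sqrt r * x i - real_of_int (z i)) \<le> sqrt r / 2"
      by (rule lattice_net_approx)
    let ?d = "\<lambda>i. sqrt r * x i - real_of_int (z i)"
    have "sqrt r * vec_norm r (mat_vec r A x) = vec_norm r (mat_vec r A (\<lambda>i. sqrt r * x i))"
      unfolding mat_vec_scale vec_norm_scale by simp
    also have "mat_vec r A (\<lambda>i. sqrt r * x i)
        = (\<lambda>i. mat_vec r A (\<lambda>i. real_of_int (z i)) i + mat_vec r A ?d i)"
      by (simp add: mat_vec_def fun_eq_iff algebra_simps flip: sum.distrib)
    also have "vec_norm r \<dots> \<le> vec_norm r (mat_vec r A (\<lambda>i. real_of_int (z i))) + vec_norm r (mat_vec r A ?d)"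
      by (rule L2_set_triangle_ineq)
    also have "\<dots> \<le> 2 * K / sqrt r + op_norm r A * (sqrt r / 2)"
    proof (intro add_mono)
      show "vec_norm r (mat_vec r A (\<lambda>i. real_of_int (z i))) \<le> 2 * K / sqrt r"
        using step[OF z(1)] sr by (simp add: field_simps)
      have "vec_norm r (mat_vec r A ?d) \<le> op_norm r A * vec_norm r ?d" by (rule vec_norm_mat_vec)
      also have "\<dots> \<le> op_norm r A * (sqrt r / 2)" using z(2) by (intro mult_left_mono op_norm_nonneg)
      finally show "vec_norm r (mat_vec r A ?d) \<le> op_norm r A * (sqrt r / 2)" .
    qed
    also have "2 * K / sqrt r = sqrt r * (2 * K / r)"
    proof -
      have "2 * K / s = s * (2 * K / t)" if "s * s = t" "s > 0" for s t :: real
        using that by (auto simp: field_simps)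
      from this[OF sr(2,1)] show ?thesis .
    qed
    also have "\<dots> + op_norm r A * (sqrt r / 2) = sqrt r * (2 * K / r + op_norm r A / 2)"
      by (simp add: algebra_simps)
    finally show "vec_norm r (mat_vec r A x) \<le> 2 * K / r + op_norm r A / 2"
      using sr by simp
  qed
  then show ?thesis by simp
qed

text \<open>
  The union bound for moments: the maximum over pairs of net points is replaced by the sum.
\<close>
lemma op_norm_power_le_lattice_net_sum:
  assumes r: "r > 0"
  shows "op_norm r A ^ (2 * p)
    \<le> (\<Sum>(z, z')\<in>lattice_net r \<times> lattice_net r. (4 / r * bilin r A z z') ^ (2 * p))"
proof -
  let ?N = "lattice_net r \<times> lattice_net r"
  let ?b = "\<lambda>(z, z'). \<bar>bilin r A z z'\<bar>"
  have zero: "(\<lambda>i\<in>{..<r}. 0) \<in> lattice_net r" by (auto simp: lattice_net_def)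
  have fin: "finite (?b ` ?N)" and ne: "?b ` ?N \<noteq> {}" using finite_lattice_net zero by auto
  from Max_in[OF this] obtain y y' where y: "y \<in> lattice_net r" "y' \<in> lattice_net r"
    "Max (?b ` ?N) = \<bar>bilin r A y y'\<bar>" by auto
  have "op_norm r A \<le> 4 * \<bar>bilin r A y y'\<bar> / r"
  proof (rule op_norm_le_lattice_net[OF r])
    fix z z' assume "z \<in> lattice_net r" "z' \<in> lattice_net r"
    then have "\<bar>bilin r A z z'\<bar> \<le> Max (?b ` ?N)" by (intro Max_ge[OF fin]) force
    then show "bilin r A z z' \<le> \<bar>bilin r A y y'\<bar>" by (simp add: y)
  qed
  then have "op_norm r A ^ (2 * p) \<le> (4 * \<bar>bilin r A y y'\<bar> / r) ^ (2 * p)"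
    by (rule power_mono) (rule op_norm_nonneg)
  also have "\<dots> = (4 / r * bilin r A y y') ^ (2 * p)"
    by (simp add: power_mult_distrib power_divide power_even_abs)
  also have "\<dots> \<le> (\<Sum>(z, z')\<in>?N. (4 / r * bilin r A z z') ^ (2 * p))"
    using member_le_sum[of "(y, y')" ?N "\<lambda>(z, z'). (4 / r * bilin r A z z') ^ (2 * p)"]
    by (simp add: y finite_lattice_net split_def)
  finally show ?thesis .
qed

section \<open>Exponential moments of a sparse sign\<close>
lemma power_le_fact_exp:
  fixes x :: real assumes "x \<ge> 0" shows "x ^ k \<le> fact k * exp x"
proof -
  have "inverse (fact k) * x ^ k = (\<Sum>n\<in>{k}. inverse (fact n) * x ^ n)" by simp
  also have "\<dots> \<le> (\<Sum>n. inverse (fact n) * x ^ n)"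
    by (rule sum_le_suminf[OF summable_exp]) (use assms in auto)
  also have "\<dots> = exp x" by (simp add: exp_def)
  finally show ?thesis by (simp add: field_simps)
qed

lemma even_power_le_exp:
  fixes x :: real shows "x ^ (2 * k) \<le> fact (2 * k) * (exp x + exp (- x))"
proof -
  have "x ^ (2 * k) = \<bar>x\<bar> ^ (2 * k)" by (simp add: power_even_abs)
  also have "\<dots> \<le> fact (2 * k) * exp \<bar>x\<bar>" by (rule power_le_fact_exp) simp
  also have "\<dots> \<le> fact (2 * k) * (exp x + exp (- x))"
    by (intro mult_left_mono) (auto simp: abs_if)
  finally show ?thesis .
qed

text \<open>
  With s = u / 2 one has \<open>cosh u - 1 = 2 * (sinh s)\<^sup>2\<close>, and \<open>sinh s \<le> s * exp s\<close>
  because \<open>exp (- 2 * s) \<ge> 1 - 2 * s\<close>.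
\<close>
lemma cosh_minus_one_le:
  fixes u :: real assumes "u \<ge> 0" shows "cosh u - 1 \<le> u\<^sup>2 / 2 * exp u"
proof -
  have "exp (u / 2) * (1 + (- u)) \<le> exp (u / 2) * exp (- u)"
    by (intro mult_left_mono exp_ge_add_one_self) auto
  also have "\<dots> = exp (- (u / 2))" by (simp flip: exp_add)
  finally have "sinh (u / 2) \<le> u / 2 * exp (u / 2)"
    by (simp add: sinh_def algebra_simps)
  then have "(sinh (u / 2))\<^sup>2 \<le> (u / 2 * exp (u / 2))\<^sup>2"
    using assms by (intro power_mono) auto
  also have "\<dots> = u\<^sup>2 / 4 * exp u"
    using exp_double[of "u / 2"] by (simp add: power_mult_distrib power_divide)
  finally have "(sinh (u / 2))\<^sup>2 \<le> u\<^sup>2 / 4 * exp u" .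
  moreover have "cosh u = 1 + 2 * (sinh (u / 2))\<^sup>2"
    using cosh_double[of "u / 2"] cosh_square_eq[of "u / 2"] by simp
  ultimately show ?thesis by simp
qed

text \<open>
  The left-hand side is the moment generating function of a symmetric sign that is nonzero with
  probability q. For \<open>\<bar>u\<bar> \<ge> L\<close> the trivial bound \<open>exp \<bar>u\<bar>\<close> is good enough, and for
  \<open>\<bar>u\<bar> < L\<close> the factor q compensates the growth of \<open>cosh\<close>. So L may be taken of order
  \<open>ln (1 / q)\<close>, which is where sparsity improves on the bound for ordinary signs.
\<close>
lemma sparse_sign_mgf_le:
  fixes u q L :: real
  assumes L: "L > 0" and q: "0 \<le> q" "q \<le> 1" and qL: "q * L * exp L \<le> 2"
  shows "1 + q * (cosh u - 1) \<le> exp (u\<^sup>2 / L)"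
proof (cases "\<bar>u\<bar> \<ge> L")
  case True
  have "1 + q * (cosh u - 1) \<le> 1 + 1 * (cosh u - 1)"
    using q cosh_real_ge_1[of u] by (intro add_left_mono mult_right_mono) auto
  also have "\<dots> = cosh \<bar>u\<bar>" by simp
  also have "\<dots> \<le> exp \<bar>u\<bar>" by (simp add: cosh_def)
  also have "\<dots> \<le> exp (u\<^sup>2 / L)"
    using mult_right_mono[OF True, of "\<bar>u\<bar>"] L by (simp add: field_simps power2_eq_square)
  finally show ?thesis .
next
  case False
  have "cosh u - 1 = cosh \<bar>u\<bar> - 1" by simp
  also have "\<dots> \<le> u\<^sup>2 / 2 * exp \<bar>u\<bar>" using cosh_minus_one_le[of "\<bar>u\<bar>"] by simp
  also have "\<dots> \<le> u\<^sup>2 / 2 * exp L" using False by (intro mult_left_mono) auto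
  finally have "q * (cosh u - 1) \<le> q * (u\<^sup>2 / 2 * exp L)" using q by (intro mult_left_mono)
  also have "\<dots> = u\<^sup>2 / (2 * L) * (q * L * exp L)" using L by simp
  also have "\<dots> \<le> u\<^sup>2 / (2 * L) * 2" using qL L by (intro mult_left_mono) auto
  also have "\<dots> = u\<^sup>2 / L" by simp
  finally show ?thesis using exp_ge_add_one_self[of "u\<^sup>2 / L"] by linarith
qed

section \<open>Moments of a sparse sign matrix\<close>
lemma walk_edge_range:
  assumes i: "i \<in> {..<p} \<rightarrow>\<^sub>E {..<N}" and j: "j \<in> {..<p} \<rightarrow>\<^sub>E {..<N}" and t: "t \<in> walk_steps p"
  shows "walk_edge p i j t \<in> {..<N} \<times> {..<N}"
proof -
  have "fst t \<in> {..<p}" "(if snd t then Suc (fst t) mod p else fst t) \<in> {..<p}"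
    using t by (auto simp: walk_steps_def)
  from PiE_mem[OF j this(1)] PiE_mem[OF i this(2)] show ?thesis
    unfolding walk_edge_def by (rule SigmaI)
qed

text \<open>
  The matrix enters only through independence of its entries and their first two moments: for a variable
  with values in \<open>{-1, 0, 1}\<close> these determine the law. The locale is used both for the given matrix and for
  the auxiliary one of dimension 2p.
\<close>
locale sparse_sign_matrix = prob_space M for M :: "'a measure" +
  fixes N :: nat and \<rho> :: real and Y :: "nat \<Rightarrow> nat \<Rightarrow> 'a \<Rightarrow> real"
  assumes indep: "indep_vars (\<lambda>_. borel) (\<lambda>(a, b). Y a b) ({..<N} \<times> {..<N})"
    and entry_values: "a < N \<Longrightarrow> b < N \<Longrightarrow> AE \<omega> in M. Y a b \<omega> \<in> {-1, 0, 1}"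
    and entry_mean: "a < N \<Longrightarrow> b < N \<Longrightarrow> expectation (Y a b) = 0"
    and entry_second_moment: "a < N \<Longrightarrow> b < N \<Longrightarrow> expectation (\<lambda>\<omega>. (Y a b \<omega>)\<^sup>2) = \<rho>"
begin

abbreviation realised :: "'a \<Rightarrow> nat \<Rightarrow> nat \<Rightarrow> real" where
  "realised \<omega> a b \<equiv> Y a b \<omega>"

lemma entry_measurable: "a < N \<Longrightarrow> b < N \<Longrightarrow> Y a b \<in> borel_measurable M"
  using indep unfolding indep_vars_def by (auto dest!: bspec[of _ _ "(a, b)"])

lemma all_entry_values: "AE \<omega> in M. \<forall>a<N. \<forall>b<N. Y a b \<omega> \<in> {-1, 0, 1}"
proof -
  have "AE \<omega> in M. \<forall>ab\<in>{..<N} \<times> {..<N}. Y (fst ab) (snd ab) \<omega> \<in> {-1, 0, 1}"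
    by (rule AE_finite_allI) (use entry_values in auto)
  then show ?thesis by (rule AE_mp) (auto intro!: AE_I2)
qed

lemma integrable_entry:
  assumes "a < N" "b < N"
  shows "integrable M (Y a b)" "integrable M (\<lambda>\<omega>. (Y a b \<omega>)\<^sup>2)"
proof -
  note [measurable] = entry_measurable[OF assms]
  show "integrable M (Y a b)"
    by (rule integrable_const_bound[of _ 1]) (use entry_values[OF assms] in \<open>auto elim: AE_mp\<close>)
  show "integrable M (\<lambda>\<omega>. (Y a b \<omega>)\<^sup>2)"
    by (rule integrable_const_bound[of _ 1]) (use entry_values[OF assms] in \<open>auto elim: AE_mp\<close>)
qed

text \<open>
  On \<open>{-1, 0, 1}\<close> every function agrees with a polynomial of degree at most 2.
\<close>
lemma expectation_entry_function:
  assumes ab: "a < N" "b < N" and g[measurable]: "g \<in> borel_measurable borel"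
  shows "integrable M (\<lambda>\<omega>. g (Y a b \<omega>))"
    "expectation (\<lambda>\<omega>. g (Y a b \<omega>)) = (1 - \<rho>) * g 0 + \<rho> * ((g 1 + g (-1)) / 2)"
proof -
  note [measurable] = entry_measurable[OF ab]
  let ?h = "\<lambda>\<omega>. g 0 + (g 1 - g (-1)) / 2 * Y a b \<omega> + ((g 1 + g (-1)) / 2 - g 0) * (Y a b \<omega>)\<^sup>2"
  have eq: "AE \<omega> in M. g (Y a b \<omega>) = ?h \<omega>"
    using entry_values[OF ab] by (rule AE_mp) (auto intro!: AE_I2 simp: field_simps)
  have h: "integrable M ?h" by (intro Bochner_Integration.integrable_add integrable_mult_right integrable_entry ab) simp
  show "integrable M (\<lambda>\<omega>. g (Y a b \<omega>))"
    by (subst integrable_cong_AE[OF _ _ eq]) (use h in auto)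
  have "expectation (\<lambda>\<omega>. g (Y a b \<omega>)) = expectation ?h"
    by (rule integral_cong_AE[OF _ _ eq]) auto
  also have "\<dots> = (1 - \<rho>) * g 0 + \<rho> * ((g 1 + g (-1)) / 2)"
    using integrable_entry[OF ab] entry_mean[OF ab] entry_second_moment[OF ab]
    by (simp add: prob_space algebra_simps)
  finally show "expectation (\<lambda>\<omega>. g (Y a b \<omega>)) = \<dots>" .
qed

lemma density_range: "N > 0 \<Longrightarrow> 0 \<le> \<rho> \<and> \<rho> \<le> 1"
proof -
  assume N: "N > 0"
  have "\<rho> = expectation (\<lambda>\<omega>. (Y 0 0 \<omega>)\<^sup>2)" using entry_second_moment N by simp
  moreover have "\<dots> \<ge> 0" by simp
  moreover have "expectation (\<lambda>\<omega>. (Y 0 0 \<omega>)\<^sup>2) \<le> expectation (\<lambda>\<omega>. 1)"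
    using entry_values[OF N N] by (intro integral_mono_AE integrable_entry N) (auto elim: AE_mp)
  ultimately show ?thesis by (simp add: prob_space)
qed

lemma expectation_prod_entries:
  assumes g: "\<And>e. g e \<in> borel_measurable borel"
  shows "integrable M (\<lambda>\<omega>. \<Prod>e\<in>{..<N} \<times> {..<N}. g e (Y (fst e) (snd e) \<omega>))"
    "expectation (\<lambda>\<omega>. \<Prod>e\<in>{..<N} \<times> {..<N}. g e (Y (fst e) (snd e) \<omega>))
      = (\<Prod>e\<in>{..<N} \<times> {..<N}. (1 - \<rho>) * g e 0 + \<rho> * ((g e 1 + g e (-1)) / 2))"
proof -
  have ind: "indep_vars (\<lambda>_. borel) (\<lambda>e \<omega>. g e (Y (fst e) (snd e) \<omega>)) ({..<N} \<times> {..<N})"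
    using indep_vars_compose2[OF indep, of g "\<lambda>_. borel"] g by (simp add: split_def)
  have int: "integrable M (\<lambda>\<omega>. g e (Y (fst e) (snd e) \<omega>))" if "e \<in> {..<N} \<times> {..<N}" for e
    using that by (intro expectation_entry_function g) auto
  show "integrable M (\<lambda>\<omega>. \<Prod>e\<in>{..<N} \<times> {..<N}. g e (Y (fst e) (snd e) \<omega>))"
    by (rule indep_vars_integrable[OF _ ind int]) simp
  have "expectation (\<lambda>\<omega>. \<Prod>e\<in>{..<N} \<times> {..<N}. g e (Y (fst e) (snd e) \<omega>))
      = (\<Prod>e\<in>{..<N} \<times> {..<N}. expectation (\<lambda>\<omega>. g e (Y (fst e) (snd e) \<omega>)))"
    by (rule indep_vars_lebesgue_integral[OF _ ind int]) simp
  also have "\<dots> = (\<Prod>e\<in>{..<N} \<times> {..<N}. (1 - \<rho>) * g e 0 + \<rho> * ((g e 1 + g e (-1)) / 2))"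
    by (intro prod.cong refl expectation_entry_function g) auto
  finally show "expectation (\<lambda>\<omega>. \<Prod>e\<in>{..<N} \<times> {..<N}. g e (Y (fst e) (snd e) \<omega>)) = \<dots>" .
qed

lemma walk_product_eq_edge_powers:
  assumes i: "i \<in> {..<p} \<rightarrow>\<^sub>E {..<N}" and j: "j \<in> {..<p} \<rightarrow>\<^sub>E {..<N}"
  shows "walk_product A p i j
    = (\<Prod>e\<in>{..<N} \<times> {..<N}. A (fst e) (snd e) ^ card {t \<in> walk_steps p. walk_edge p i j t = e})"
proof -
  let ?A = "\<lambda>t. A (fst (walk_edge p i j t)) (snd (walk_edge p i j t))"
  have "walk_product A p i j = (\<Prod>l<p. \<Prod>s\<in>UNIV. ?A (l, s))"
    by (simp add: walk_product_def walk_edge_def UNIV_bool mult.commute)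
  also have "\<dots> = prod ?A (walk_steps p)"
    by (simp add: walk_steps_def prod.cartesian_product split_def)
  also have "\<dots> = (\<Prod>e\<in>{..<N} \<times> {..<N}. prod ?A {t \<in> walk_steps p. walk_edge p i j t = e})"
  proof (rule prod.group[symmetric])
    show "walk_edge p i j ` walk_steps p \<subseteq> {..<N} \<times> {..<N}"
      using walk_edge_range[OF i j] by blast
  qed auto
  also have "\<dots> = (\<Prod>e\<in>{..<N} \<times> {..<N}. A (fst e) (snd e) ^ card {t \<in> walk_steps p. walk_edge p i j t = e})"
  proof (intro prod.cong refl)
    fix e
    have "prod ?A {t \<in> walk_steps p. walk_edge p i j t = e}
        = (\<Prod>t\<in>{t \<in> walk_steps p. walk_edge p i j t = e}. A (fst e) (snd e))"
      by (rule prod.cong) auto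
    then show "prod ?A {t \<in> walk_steps p. walk_edge p i j t = e}
        = A (fst e) (snd e) ^ card {t \<in> walk_steps p. walk_edge p i j t = e}" by simp
  qed
  finally show ?thesis .
qed

text \<open>
  By independence the expectation factorises over the edges. An edge used an odd
  number of times contributes 0 by symmetry, an edge used an even positive number of times
  contributes \<open>\<rho>\<close>.
\<close>
lemma expectation_walk_product:
  assumes i: "i \<in> {..<p} \<rightarrow>\<^sub>E {..<N}" and j: "j \<in> {..<p} \<rightarrow>\<^sub>E {..<N}"
  shows "integrable M (\<lambda>\<omega>. walk_product (realised \<omega>) p i j)"
    "expectation (\<lambda>\<omega>. walk_product (realised \<omega>) p i j) = walk_weight \<rho> p i j"
proof -
  let ?V = "{..<N} \<times> {..<N}"
  let ?E = "walk_edge p i j ` walk_steps p"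
  define c where "c e = card {t \<in> walk_steps p. walk_edge p i j t = e}" for e
  have eq: "walk_product (realised \<omega>) p i j = (\<Prod>e\<in>?V. Y (fst e) (snd e) \<omega> ^ c e)" for \<omega>
    using walk_product_eq_edge_powers[OF i j, of "realised \<omega>"] by (simp add: c_def)
  have sub: "?E \<subseteq> ?V" using walk_edge_range[OF i j] by blast
  show "integrable M (\<lambda>\<omega>. walk_product (realised \<omega>) p i j)"
    unfolding eq using expectation_prod_entries(1)[of "\<lambda>e x. x ^ c e"] by simp
  have "expectation (\<lambda>\<omega>. walk_product (realised \<omega>) p i j)
      = (\<Prod>e\<in>?V. (1 - \<rho>) * 0 ^ c e + \<rho> * ((1 ^ c e + (-1) ^ c e) / 2))"
    unfolding eq using expectation_prod_entries(2)[of "\<lambda>e x. x ^ c e"] by simp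
  also have "\<dots> = walk_weight \<rho> p i j"
  proof (cases "even_walk p i j")
    case False
    then obtain t where t: "t \<in> walk_steps p" "odd (c (walk_edge p i j t))"
      by (auto simp: even_walk_def c_def)
    then have "c (walk_edge p i j t) \<noteq> 0" by (metis even_zero)
    with t sub have "\<exists>e\<in>?V. (1 - \<rho>) * 0 ^ c e + \<rho> * ((1 ^ c e + (-1) ^ c e) / 2) = 0"
      by (intro bexI[of _ "walk_edge p i j t"]) auto
    then have "(\<Prod>e\<in>?V. (1 - \<rho>) * 0 ^ c e + \<rho> * ((1 ^ c e + (-1) ^ c e) / 2)) = 0"
      by (intro prod_zero) auto
    with False show ?thesis by (simp add: walk_weight_def)
  next
    case True
    have c0: "c e = 0 \<longleftrightarrow> e \<notin> ?E" for e
      by (auto simp: c_def card_eq_0_iff)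
    have even: "even (c e)" if "e \<in> ?E" for e using True that by (auto simp: even_walk_def c_def)
    have "(\<Prod>e\<in>?V. (1 - \<rho>) * 0 ^ c e + \<rho> * ((1 ^ c e + (-1) ^ c e) / 2))
        = (\<Prod>e\<in>?V. if e \<in> ?E then \<rho> else 1)"
    proof (intro prod.cong refl)
      fix e
      show "(1 - \<rho>) * 0 ^ c e + \<rho> * ((1 ^ c e + (-1) ^ c e) / 2) = (if e \<in> ?E then \<rho> else 1)"
      proof (cases "e \<in> ?E")
        case True
        then have "c e \<noteq> 0" "even (c e)" using c0 even by auto
        then show ?thesis using True by simp
      next
        case False
        then have "c e = 0" using c0 by auto
        then show ?thesis using False by simp
      qed
    qed
    also have "\<dots> = (\<Prod>e\<in>?V \<inter> ?E. \<rho>)" by (subst prod.inter_restrict) auto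
    also have "\<dots> = \<rho> ^ card ?E" using sub by (simp add: Int_absorb1)
    finally show ?thesis using True by (simp add: walk_weight_def)
  qed
  finally show "expectation (\<lambda>\<omega>. walk_product (realised \<omega>) p i j) = walk_weight \<rho> p i j" .
qed

lemma expectation_trace_moment:
  assumes "p > 0"
  shows "integrable M (\<lambda>\<omega>. trace_moment N (realised \<omega>) p)"
    "expectation (\<lambda>\<omega>. trace_moment N (realised \<omega>) p) = walk_sum N \<rho> p"
  unfolding trace_moment_eq_closed_walks[OF assms] walk_sum_def
  by (auto simp: Bochner_Integration.integral_sum expectation_walk_product
      intro!: Bochner_Integration.integrable_sum sum.cong)

lemma op_norm_measurable_realised [measurable]: "(\<lambda>\<omega>. op_norm N (realised \<omega>)) \<in> borel_measurable M"
  by (rule op_norm_measurable) (rule entry_measurable)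

lemma op_norm_bounded: "AE \<omega> in M. op_norm N (realised \<omega>) \<le> (real N)\<^sup>2"
  using all_entry_values
proof (rule AE_mp, intro AE_I2 impI)
  fix \<omega> assume v: "\<forall>a<N. \<forall>b<N. Y a b \<omega> \<in> {-1, 0, 1}"
  have "op_norm N (realised \<omega>) \<le> (\<Sum>a<N. \<Sum>b<N. \<bar>Y a b \<omega>\<bar>)" by (rule op_norm_le_sum_abs)
  also have "\<dots> \<le> (\<Sum>a<N. \<Sum>b<N. 1)"
    by (intro sum_mono) (use v in fastforce)
  finally show "op_norm N (realised \<omega>) \<le> (real N)\<^sup>2" by (simp add: power2_eq_square)
qed

lemma integrable_op_norm_power: "integrable M (\<lambda>\<omega>. op_norm N (realised \<omega>) ^ k)"
proof (rule integrable_const_bound)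
  show "AE \<omega> in M. norm (op_norm N (realised \<omega>) ^ k) \<le> ((real N)\<^sup>2) ^ k"
    using op_norm_bounded
    by (rule AE_mp) (auto intro!: AE_I2 power_mono simp: op_norm_nonneg)
qed simp

lemma integrable_op_norm: "integrable M (\<lambda>\<omega>. op_norm N (realised \<omega>))"
  using integrable_op_norm_power[of 1] by simp

lemma expectation_op_norm_power_le_walk_sum:
  "expectation (\<lambda>\<omega>. op_norm N (realised \<omega>) ^ (2 * 2 ^ Suc k)) \<le> walk_sum N \<rho> (2 ^ Suc k)"
proof -
  have "expectation (\<lambda>\<omega>. op_norm N (realised \<omega>) ^ (2 * 2 ^ Suc k))
      \<le> expectation (\<lambda>\<omega>. trace_moment N (realised \<omega>) (2 ^ Suc k))"
    by (intro integral_mono integrable_op_norm_power expectation_trace_moment op_norm_power_le_trace_moment) simp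
  then show ?thesis by (subst (asm) expectation_trace_moment) auto
qed

lemma walk_sum_le_expectation_op_norm_power:
  assumes "p > 0"
  shows "walk_sum N \<rho> p \<le> N * expectation (\<lambda>\<omega>. op_norm N (realised \<omega>) ^ (2 * p))"
proof -
  have "expectation (\<lambda>\<omega>. trace_moment N (realised \<omega>) p)
      \<le> expectation (\<lambda>\<omega>. N * op_norm N (realised \<omega>) ^ (2 * p))"
    by (intro integral_mono integrable_mult_right integrable_op_norm_power expectation_trace_moment
        trace_moment_le_op_norm assms)
  then show ?thesis by (simp add: expectation_trace_moment assms)
qed

text \<open>
  The coefficients \<open>\<theta> * z a * z' b / N\<close> of the entries have sum of squares at most \<open>9 * \<theta>\<^sup>2\<close>,
  since both net points have squared norm at most 3N.
\<close>
lemma bilin_mgf_le: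
  assumes N: "N > 0" and L: "L > 0" "\<rho> * L * exp L \<le> 2"
    and z: "z \<in> lattice_net N" "z' \<in> lattice_net N"
  shows "integrable M (\<lambda>\<omega>. exp (\<theta> / N * bilin N (realised \<omega>) z z'))"
    "expectation (\<lambda>\<omega>. exp (\<theta> / N * bilin N (realised \<omega>) z z')) \<le> exp (9 * \<theta>\<^sup>2 / L)"
proof -
  let ?V = "{..<N} \<times> {..<N}"
  define c where "c e = \<theta> / N * (z (fst e) * z' (snd e))" for e
  have eq: "exp (\<theta> / N * bilin N (realised \<omega>) z z') = (\<Prod>e\<in>?V. exp (c e * Y (fst e) (snd e) \<omega>))" for \<omega>
  proof -
    have "\<theta> / N * bilin N (realised \<omega>) z z' = (\<Sum>e\<in>?V. c e * Y (fst e) (snd e) \<omega>)"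
      by (simp add: bilin_def c_def sum.cartesian_product split_def sum_distrib_left mult.assoc)
    then show ?thesis by (simp add: exp_sum)
  qed
  show "integrable M (\<lambda>\<omega>. exp (\<theta> / N * bilin N (realised \<omega>) z z'))"
    unfolding eq using expectation_prod_entries(1)[of "\<lambda>e x. exp (c e * x)"] by simp
  have "expectation (\<lambda>\<omega>. exp (\<theta> / N * bilin N (realised \<omega>) z z'))
      = (\<Prod>e\<in>?V. (1 - \<rho>) * exp (c e * 0) + \<rho> * ((exp (c e * 1) + exp (c e * (-1))) / 2))"
    unfolding eq by (rule expectation_prod_entries(2)[of "\<lambda>e x. exp (c e * x)"]) simp
  also have "\<dots> = (\<Prod>e\<in>?V. 1 + \<rho> * (cosh (c e) - 1))"
    by (intro prod.cong refl) (simp add: cosh_def algebra_simps add_divide_distrib)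
  also have "\<dots> \<le> (\<Prod>e\<in>?V. exp ((c e)\<^sup>2 / L))"
  proof (intro prod_mono conjI)
    fix e
    show "1 + \<rho> * (cosh (c e) - 1) \<le> exp ((c e)\<^sup>2 / L)"
      by (rule sparse_sign_mgf_le) (use L density_range[OF N] in auto)
    show "0 \<le> 1 + \<rho> * (cosh (c e) - 1)"
      using density_range[OF N] cosh_real_ge_1[of "c e"] by (intro add_nonneg_nonneg mult_nonneg_nonneg) auto
  qed
  also have "\<dots> = exp ((\<Sum>e\<in>?V. (c e)\<^sup>2) / L)"
    by (simp add: exp_sum sum_divide_distrib)
  also have "(\<Sum>e\<in>?V. (c e)\<^sup>2) = \<theta>\<^sup>2 / N\<^sup>2 * ((\<Sum>a<N. (real_of_int (z a))\<^sup>2) * (\<Sum>b<N. (real_of_int (z' b))\<^sup>2))"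
    unfolding sum_product
    by (simp add: c_def sum.cartesian_product split_def sum_distrib_left power_mult_distrib power_divide)
  also have "exp (\<dots> / L) \<le> exp (9 * \<theta>\<^sup>2 / L)"
  proof -
    have "(\<Sum>a<N. (real_of_int (z a))\<^sup>2) * (\<Sum>b<N. (real_of_int (z' b))\<^sup>2) \<le> (3 * real N) * (3 * real N)"
      using lattice_net_norm_sq z by (intro mult_mono sum_nonneg) auto
    then have "\<theta>\<^sup>2 / N\<^sup>2 * ((\<Sum>a<N. (real_of_int (z a))\<^sup>2) * (\<Sum>b<N. (real_of_int (z' b))\<^sup>2))
        \<le> \<theta>\<^sup>2 / N\<^sup>2 * ((3 * real N) * (3 * real N))"
      by (intro mult_left_mono) auto
    also have "\<dots> = 9 * \<theta>\<^sup>2" using N by (simp add: power2_eq_square)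
    finally show ?thesis unfolding exp_le_cancel_iff by (rule divide_right_mono) (use L in simp)
  qed
  finally show "expectation (\<lambda>\<omega>. exp (\<theta> / N * bilin N (realised \<omega>) z z')) \<le> exp (9 * \<theta>\<^sup>2 / L)" .
qed

lemma bilin_measurable [measurable]: "(\<lambda>\<omega>. bilin N (realised \<omega>) z z') \<in> borel_measurable M"
  unfolding bilin_def by (intro borel_measurable_sum borel_measurable_times entry_measurable) auto

text \<open>
  Chernoff's method for moments: \<open>x ^ (2 * p) \<le> fact (2 * p) * (exp x + exp (- x))\<close>, applied to the
  multiple of the bilinear form with parameter \<open>\<theta>\<close>, which is left free here.
\<close>
lemma bilin_moment_le:
  assumes N: "N > 0" and L: "L > 0" "\<rho> * L * exp L \<le> 2" and l: "\<theta> > 0"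
    and z: "z \<in> lattice_net N" "z' \<in> lattice_net N"
  shows "integrable M (\<lambda>\<omega>. (4 / N * bilin N (realised \<omega>) z z') ^ (2 * p))"
    "expectation (\<lambda>\<omega>. (4 / N * bilin N (realised \<omega>) z z') ^ (2 * p))
      \<le> (4 / \<theta>) ^ (2 * p) * (fact (2 * p) * (2 * exp (9 * \<theta>\<^sup>2 / L)))"
proof -
  let ?e = "\<lambda>s \<omega>. exp (s / N * bilin N (realised \<omega>) z z')"
  let ?h = "\<lambda>\<omega>. (4 / \<theta>) ^ (2 * p) * (fact (2 * p) * (?e \<theta> \<omega> + ?e (- \<theta>) \<omega>))"
  have le: "(4 / N * bilin N (realised \<omega>) z z') ^ (2 * p) \<le> ?h \<omega>" for \<omega>
  proof -
    let ?x = "\<theta> / N * bilin N (realised \<omega>) z z'"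
    have "4 / N * bilin N (realised \<omega>) z z' = 4 / \<theta> * ?x" using l by simp
    then have "(4 / N * bilin N (realised \<omega>) z z') ^ (2 * p) = (4 / \<theta>) ^ (2 * p) * ?x ^ (2 * p)"
      by (simp only: power_mult_distrib)
    also have "\<dots> \<le> (4 / \<theta>) ^ (2 * p) * (fact (2 * p) * (exp ?x + exp (- ?x)))"
      using l by (intro mult_left_mono even_power_le_exp) auto
    finally show ?thesis by simp
  qed
  have h: "integrable M ?h"
    by (intro integrable_mult_right Bochner_Integration.integrable_add bilin_mgf_le[OF N L z])
  show int: "integrable M (\<lambda>\<omega>. (4 / N * bilin N (realised \<omega>) z z') ^ (2 * p))"
  proof (rule Bochner_Integration.integrable_bound[OF h])
    show "AE \<omega> in M. norm ((4 / N * bilin N (realised \<omega>) z z') ^ (2 * p)) \<le> norm (?h \<omega>)"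
    proof (rule AE_I2)
      fix \<omega>
      have "0 \<le> (4 / N * bilin N (realised \<omega>) z z') ^ (2 * p)" by (rule zero_le_even_power) simp
      with le[of \<omega>] show "norm ((4 / N * bilin N (realised \<omega>) z z') ^ (2 * p)) \<le> norm (?h \<omega>)"
        unfolding real_norm_def by linarith
    qed
  qed measurable
  have "expectation (\<lambda>\<omega>. (4 / N * bilin N (realised \<omega>) z z') ^ (2 * p)) \<le> expectation ?h"
    by (intro integral_mono int h le)
  also have "\<dots> = (4 / \<theta>) ^ (2 * p) * (fact (2 * p) * (expectation (?e \<theta>) + expectation (?e (- \<theta>))))"
    by (simp only: integral_mult_right_zero Bochner_Integration.integral_add[OF bilin_mgf_le(1)[OF N L z] bilin_mgf_le(1)[OF N L z]])
  also have "\<dots> \<le> (4 / \<theta>) ^ (2 * p) * (fact (2 * p) * (exp (9 * \<theta>\<^sup>2 / L) + exp (9 * (- \<theta>)\<^sup>2 / L)))"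
    using l by (intro mult_left_mono add_mono bilin_mgf_le(2)[OF N L z]) auto
  finally show "expectation (\<lambda>\<omega>. (4 / N * bilin N (realised \<omega>) z z') ^ (2 * p))
      \<le> (4 / \<theta>) ^ (2 * p) * (fact (2 * p) * (2 * exp (9 * \<theta>\<^sup>2 / L)))" by simp
qed

lemma expectation_op_norm_power_le_net:
  assumes N: "N > 0" and L: "L > 0" "\<rho> * L * exp L \<le> 2" and l: "\<theta> > 0"
  shows "expectation (\<lambda>\<omega>. op_norm N (realised \<omega>) ^ (2 * p))
      \<le> (24 ^ N)\<^sup>2 * ((4 / \<theta>) ^ (2 * p) * (fact (2 * p) * (2 * exp (9 * \<theta>\<^sup>2 / L))))"
    (is "_ \<le> _ * ?b")
proof -
  let ?N = "lattice_net N \<times> lattice_net N"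
  let ?f = "\<lambda>zz \<omega>. (4 / N * bilin N (realised \<omega>) (fst zz) (snd zz)) ^ (2 * p)"
  have int: "integrable M (?f zz)" if "zz \<in> ?N" for zz
    using that by (intro bilin_moment_le[OF N L l]) auto
  have "expectation (\<lambda>\<omega>. op_norm N (realised \<omega>) ^ (2 * p)) \<le> expectation (\<lambda>\<omega>. \<Sum>zz\<in>?N. ?f zz \<omega>)"
    using op_norm_power_le_lattice_net_sum[OF N]
    by (intro integral_mono integrable_op_norm_power Bochner_Integration.integrable_sum int) (auto simp: split_def)
  also have "\<dots> = (\<Sum>zz\<in>?N. expectation (?f zz))"
    by (rule Bochner_Integration.integral_sum) (rule int)
  also have "\<dots> \<le> (\<Sum>zz\<in>?N. ?b)"
    by (intro sum_mono bilin_moment_le[OF N L l]) auto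
  also have "\<dots> = real (card (lattice_net N) * card (lattice_net N)) * ?b"
    by (simp add: card_cartesian_product)
  also have "\<dots> \<le> real ((24 ^ N) * (24 ^ N)) * ?b"
  proof (rule mult_right_mono)
    show "real (card (lattice_net N) * card (lattice_net N)) \<le> real ((24 ^ N) * (24 ^ N))"
      by (intro of_nat_mono mult_mono card_lattice_net) auto
    show "0 \<le> ?b" using l by simp
  qed
  finally show ?thesis by (simp add: power2_eq_square)
qed

end

section \<open>Instances of sparse sign matrices\<close>
definition sparse_sign_pmf :: "real \<Rightarrow> real pmf" where
  "sparse_sign_pmf q = bernoulli_pmf q \<bind> (\<lambda>b. if b then pmf_of_set {-1, 1} else return_pmf 0)"

lemma expectation_sparse_sign_pmf:
  fixes h :: "real \<Rightarrow> real"
  assumes "0 \<le> q" "q \<le> 1"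
  shows "measure_pmf.expectation (sparse_sign_pmf q) h = q * ((h 1 + h (-1)) / 2) + (1 - q) * h 0"
  unfolding sparse_sign_pmf_def using assms
  by (subst pmf_expectation_bind[of UNIV]) (auto simp: UNIV_bool integral_pmf_of_set)

lemma set_sparse_sign_pmf: "set_pmf (sparse_sign_pmf q) \<subseteq> {-1, 0, 1}"
  unfolding sparse_sign_pmf_def by (auto split: if_splits)

text \<open>
  The auxiliary model needs an actual random matrix, because its walk sum is bounded through
  the norm of that matrix.
\<close>
lemma sparse_sign_matrix_exists:
  assumes q: "0 \<le> q" "q \<le> 1"
  shows "sparse_sign_matrix (measure_pmf (Pi_pmf ({..<N} \<times> {..<N}) 0 (\<lambda>_. sparse_sign_pmf q))) N q
    (\<lambda>a b f. f (a, b))"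
    (is "sparse_sign_matrix (measure_pmf ?P) N q ?Y")
proof -
  have E: "measure_pmf.expectation ?P (\<lambda>f. h (f (a, b))) = q * ((h 1 + h (-1)) / 2) + (1 - q) * h 0"
    if "a < N" "b < N" for h :: "real \<Rightarrow> real" and a b
  proof -
    have "measure_pmf.expectation ?P (\<lambda>f. h (f (a, b))) = measure_pmf.expectation (map_pmf (\<lambda>f. f (a, b)) ?P) h" by simp
    also have "map_pmf (\<lambda>f. f (a, b)) ?P = sparse_sign_pmf q"
      using that by (subst Pi_pmf_component) auto
    finally show ?thesis by (simp add: expectation_sparse_sign_pmf q)
  qed
  show ?thesis
  proof
    have "prob_space.indep_vars (measure_pmf ?P) (\<lambda>_. borel) (\<lambda>x f. id (f x)) ({..<N} \<times> {..<N})"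
      by (rule prob_space.indep_vars_compose2[OF measure_pmf.prob_space_axioms indep_vars_Pi_pmf]) auto
    then show "prob_space.indep_vars (measure_pmf ?P) (\<lambda>_. borel) (\<lambda>(a, b). ?Y a b) ({..<N} \<times> {..<N})"
      by (simp add: split_def)
    fix a b assume ab: "a < N" "b < N"
    have "f (a, b) \<in> set_pmf (sparse_sign_pmf q)" if "f \<in> set_pmf ?P" for f
      using that ab by (auto simp: set_Pi_pmf PiE_dflt_def)
    then show "AE f in measure_pmf ?P. f (a, b) \<in> {-1, 0, 1}"
      using set_sparse_sign_pmf by (auto simp: AE_measure_pmf_iff)
    show "measure_pmf.expectation ?P (\<lambda>f. f (a, b)) = 0" using E[OF ab, of "\<lambda>x. x"] by simp
    show "measure_pmf.expectation ?P (\<lambda>f. (f (a, b))\<^sup>2) = q" using E[OF ab, of "\<lambda>x. x\<^sup>2"] by simp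
  qed
qed

text \<open>
  Independence of the products comes from grouping the variables into the pairs that belong to one
  entry; the moments come from the laws of signs and selectors.
\<close>
lemma signs_and_selectors_sparse_sign_matrix:
  assumes S: "signs_and_selectors M n \<rho> \<epsilon> B" and \<rho>: "0 \<le> \<rho>" "\<rho> \<le> 1"
  shows "sparse_sign_matrix M n \<rho> (\<lambda>i j \<omega>. \<epsilon> i j \<omega> * B i j \<omega>)"
proof -
  interpret prob_space M using S by (simp add: signs_and_selectors_def)
  let ?V = "{..<n} \<times> {..<n}"
  let ?X = "case_sum (\<lambda>(i, j). \<epsilon> i j) (\<lambda>(i, j). B i j)"
  have ind: "indep_vars (\<lambda>_. borel) ?X (?V <+> ?V)"
    and law\<epsilon>: "\<And>i j. i < n \<Longrightarrow> j < n \<Longrightarrow>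
      distr M borel (\<epsilon> i j) = distr (measure_pmf (pmf_of_set {-1, 1 :: real})) borel (\<lambda>x. x)"
    and lawB: "\<And>i j. i < n \<Longrightarrow> j < n \<Longrightarrow>
      distr M borel (B i j) = distr (measure_pmf (bernoulli_pmf \<rho>)) borel of_bool"
    using S by (auto simp: signs_and_selectors_def)
  have rv: "random_variable borel (?X x)" if "x \<in> ?V <+> ?V" for x
    using ind that unfolding indep_vars_def by blast
  have meas: "\<epsilon> i j \<in> borel_measurable M" "B i j \<in> borel_measurable M" if "i < n" "j < n" for i j
    using rv[of "Inl (i, j)"] rv[of "Inr (i, j)"] that by auto
  have \<epsilon>_values: "AE \<omega> in M. \<epsilon> i j \<omega> \<in> {-1, 1}" if ij: "i < n" "j < n" for i j
  proof -
    have "AE x in distr (measure_pmf (pmf_of_set {-1, 1 :: real})) borel (\<lambda>x. x). x \<in> {-1, 1 :: real}"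
      by (subst AE_distr_iff) (auto simp: AE_measure_pmf_iff)
    then have "AE x in distr M borel (\<epsilon> i j). x \<in> {-1, 1}" by (simp only: law\<epsilon>[OF ij])
    then show ?thesis by (subst (asm) AE_distr_iff) (use meas[OF ij] in auto)
  qed
  have B_values: "AE \<omega> in M. B i j \<omega> \<in> {0, 1}" if ij: "i < n" "j < n" for i j
  proof -
    have "AE x in distr (measure_pmf (bernoulli_pmf \<rho>)) borel of_bool. x \<in> {0, 1 :: real}"
      by (subst AE_distr_iff) (auto simp: AE_measure_pmf_iff)
    then have "AE x in distr M borel (B i j). x \<in> {0, 1}" by (simp only: lawB[OF ij])
    then show ?thesis by (subst (asm) AE_distr_iff) (use meas[OF ij] in auto)
  qed
  have \<epsilon>_mean: "expectation (\<epsilon> i j) = 0" if ij: "i < n" "j < n" for i j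
  proof -
    have "expectation (\<epsilon> i j) = (\<integral>x. x \<partial>distr M borel (\<epsilon> i j))"
      using meas[OF ij] by (subst integral_distr) auto
    also have "\<dots> = measure_pmf.expectation (pmf_of_set {-1, 1}) (\<lambda>x. x)"
      unfolding law\<epsilon>[OF ij] by (subst integral_distr) auto
    finally show ?thesis by (simp add: integral_pmf_of_set)
  qed
  have B_second: "expectation (\<lambda>\<omega>. (B i j \<omega>)\<^sup>2) = \<rho>" if ij: "i < n" "j < n" for i j
  proof -
    have "expectation (\<lambda>\<omega>. (B i j \<omega>)\<^sup>2) = (\<integral>x. x\<^sup>2 \<partial>distr M borel (B i j))"
      using meas[OF ij] by (subst integral_distr) auto
    also have "\<dots> = measure_pmf.expectation (bernoulli_pmf \<rho>) (\<lambda>b. (of_bool b)\<^sup>2)"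
      unfolding lawB[OF ij] by (subst integral_distr) auto
    finally show ?thesis using \<rho> by simp
  qed
  show ?thesis
  proof
    define K where "K ij = {Inl ij, Inr ij}" for ij :: "nat \<times> nat"
    have "indep_vars (\<lambda>ij. PiM (K ij) (\<lambda>_. borel)) (\<lambda>ij \<omega>. restrict (\<lambda>x. ?X x \<omega>) (K ij)) ?V"
      by (rule indep_vars_restrict[OF ind]) (auto simp: K_def disjoint_family_on_def)
    then have "indep_vars (\<lambda>_. borel)
        (\<lambda>ij \<omega>. (\<lambda>f. f (Inl ij) * f (Inr ij)) (restrict (\<lambda>x. ?X x \<omega>) (K ij))) ?V"
    proof (rule indep_vars_compose2)
      fix ij :: "nat \<times> nat"
      have [measurable]: "Inl ij \<in> K ij" "Inr ij \<in> K ij" by (auto simp: K_def)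
      show "(\<lambda>f. f (Inl ij) * f (Inr ij)) \<in> borel_measurable (PiM (K ij) (\<lambda>_. borel :: real measure))"
        by (intro borel_measurable_times measurable_component_singleton) (auto simp: K_def)
    qed
    then show "indep_vars (\<lambda>_. borel) (\<lambda>(i, j) \<omega>. \<epsilon> i j \<omega> * B i j \<omega>) ?V"
      by (simp add: K_def split_def)
    fix i j assume ij: "i < n" "j < n"
    note [measurable] = meas[OF ij]
    show "AE \<omega> in M. \<epsilon> i j \<omega> * B i j \<omega> \<in> {-1, 0, 1}"
      using \<epsilon>_values[OF ij] B_values[OF ij] by eventually_elim auto
    have int\<epsilon>: "integrable M (\<epsilon> i j)"
      by (rule integrable_const_bound[of _ 1]) (use \<epsilon>_values[OF ij] in \<open>auto elim: AE_mp\<close>)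
    have intB: "integrable M (B i j)"
      by (rule integrable_const_bound[of _ 1]) (use B_values[OF ij] in \<open>auto elim: AE_mp\<close>)
    let ?I = "{Inl (i, j), Inr (i, j)}"
    have "indep_vars (\<lambda>_. borel) ?X ?I" by (rule indep_vars_subset[OF ind]) (use ij in auto)
    then have "expectation (\<lambda>\<omega>. \<Prod>x\<in>?I. ?X x \<omega>) = (\<Prod>x\<in>?I. expectation (?X x))"
      by (rule indep_vars_lebesgue_integral[rotated]) (use int\<epsilon> intB in auto)
    then show "expectation (\<lambda>\<omega>. \<epsilon> i j \<omega> * B i j \<omega>) = 0"
      by (simp add: \<epsilon>_mean[OF ij])
    have "expectation (\<lambda>\<omega>. (\<epsilon> i j \<omega> * B i j \<omega>)\<^sup>2) = expectation (\<lambda>\<omega>. (B i j \<omega>)\<^sup>2)"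
    proof (rule integral_cong_AE)
      show "AE \<omega> in M. (\<epsilon> i j \<omega> * B i j \<omega>)\<^sup>2 = (B i j \<omega>)\<^sup>2"
        using \<epsilon>_values[OF ij] by eventually_elim auto
    qed measurable
    then show "expectation (\<lambda>\<omega>. (\<epsilon> i j \<omega> * B i j \<omega>)\<^sup>2) = \<rho>" by (simp add: B_second[OF ij])
  qed
qed

section \<open>Upper bounds for the expected norm\<close>
text \<open>
  In dimension 2p the net has at most \<open>24 ^ (2 * p)\<close> points, so the union bound costs only a factor
  exponential in p, like the passage from the norm to its 2p-th moment. The choice
  \<open>\<theta>\<^sup>2 = p * L\<close> makes the exponent of the moment generating function equal to 9p while the
  factorial contributes \<open>(4 * p\<^sup>2) ^ p / (p * L) ^ p = (4 * p / L) ^ p\<close>.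
\<close>
lemma walk_sum_sparse_le:
  assumes p: "p > 0" and q: "0 \<le> q" "q \<le> 1" and L: "L > 0" "q * L * exp L \<le> 2"
  shows "walk_sum (2 * p) q p \<le> 4 * real p * (24 ^ 4 * 64 * exp 9 * p / L) ^ p"
proof -
  interpret Z: sparse_sign_matrix "measure_pmf (Pi_pmf ({..<2 * p} \<times> {..<2 * p}) 0 (\<lambda>_. sparse_sign_pmf q))"
    "2 * p" q "\<lambda>a b f. f (a, b)"
    by (rule sparse_sign_matrix_exists[OF q])
  define \<theta> where "\<theta> = sqrt (p * L)"
  have \<theta>: "\<theta> > 0" "\<theta>\<^sup>2 = p * L" using p L by (auto simp: \<theta>_def)
  have "fact (2 * p) \<le> real (2 * p) ^ (2 * p)"
    using fact_le_power[of "2 * p", where ?'a = real] by (simp only: of_nat_power)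
  also have "\<dots> = (4 * (real p)\<^sup>2) ^ p" by (simp add: power_mult power2_eq_square)
  finally have fact: "fact (2 * p) \<le> (4 * (real p)\<^sup>2) ^ p" .
  have "walk_sum (2 * p) q p \<le> real (2 * p) * ((24 ^ (2 * p))\<^sup>2
      * ((4 / \<theta>) ^ (2 * p) * (fact (2 * p) * (2 * exp (9 * \<theta>\<^sup>2 / L)))))"
    using p order_trans[OF Z.walk_sum_le_expectation_op_norm_power[OF p]
      mult_left_mono[OF Z.expectation_op_norm_power_le_net[OF _ L \<theta>(1)]]] by simp
  also have "\<dots> \<le> real (2 * p) * ((24 ^ (2 * p))\<^sup>2
      * ((4 / \<theta>) ^ (2 * p) * ((4 * (real p)\<^sup>2) ^ p * (2 * exp (9 * \<theta>\<^sup>2 / L)))))"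
    using fact \<theta> by (intro mult_left_mono mult_right_mono) auto
  also have "\<dots> = 4 * real p * (24 ^ 4 * 64 * exp 9 * p / L) ^ p"
  proof -
    have 1: "((24::real) ^ (2 * p))\<^sup>2 = (24 ^ 4) ^ p" 
      by (simp only: power_mult[symmetric] mult.commute mult.left_commute) simp
    have 2: "(4 / \<theta>) ^ (2 * p) = (16 / (p * L)) ^ p"
      by (simp add: power_mult power_divide \<theta>(2))
    have 3: "exp (9 * \<theta>\<^sup>2 / L) = exp 9 ^ p" using L by (simp add: \<theta>(2) mult_ac flip: exp_of_nat_mult)
    have "(24 ^ 4) ^ p * ((16 / (p * L)) ^ p * ((4 * (real p)\<^sup>2) ^ p * exp 9 ^ p))
        = (24 ^ 4 * ((16 / (p * L)) * ((4 * (real p)\<^sup>2) * exp 9))) ^ p"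
      by (simp only: power_mult_distrib)
    also have "24 ^ 4 * ((16 / (p * L)) * ((4 * (real p)\<^sup>2) * exp 9)) = 24 ^ 4 * 64 * exp 9 * p / L"
      using p L by (simp add: power2_eq_square field_simps)
    finally show ?thesis unfolding 1 2 3 by (simp add: mult_ac)
  qed
  finally show ?thesis .
qed

text \<open>
  The factor \<open>4 * exp 1\<close> accounts for the two dimensions n and 2p, through \<open>n \<le> exp p\<close> and
  \<open>4 * p \<le> 4 ^ p\<close>; the rest is the numerical factor inside the power in the preceding lemma.
\<close>
definition upper_const :: real where
  "upper_const = 4 * exp 1 * (24 ^ 4 * 64 * exp 9)"

text \<open>
  The comparison of walk sums costs a factor n, which is harmless after taking 2p-th roots because
  \<open>n \<le> exp p\<close>. The moment bound is turned into a bound for the mean by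
  \<open>x \<le> t + t * (x / t) ^ (2 * p)\<close> with t the bound for the 2p-th root of the moment.
\<close>
lemma (in sparse_sign_matrix) expectation_op_norm_le:
  fixes m q L :: real and p k :: nat
  assumes p: "p = 2 ^ Suc k" "ln N \<le> p" and m: "1 \<le> m" "m \<le> N" "m \<le> p"
    and q: "0 \<le> q" "q \<le> 1" and le: "N * \<rho> \<le> m * q"
    and L: "L > 0" "q * L * exp L \<le> 2"
  shows "expectation (\<lambda>\<omega>. op_norm N (realised \<omega>)) \<le> 2 * sqrt (upper_const * (p / L))"
proof -
  let ?K = "24 ^ 4 * 64 * exp 9 :: real"
  have N: "N > 0" using m by (cases N) auto
  have p0: "p > 0" "p \<ge> 2" using p(1) by auto
  have ut: "upper_const > 0" by (simp add: upper_const_def)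
  define t where "t = sqrt (upper_const * (p / L))"
  have t: "t > 0" "t\<^sup>2 = upper_const * (p / L)" using ut p0 L by (auto simp: t_def)
  have "4 * p \<le> 4 ^ p"
    using p0(2) by (induction p rule: nat_induct_at_least) auto
  then have 1: "4 * real p \<le> 4 ^ p" by (metis of_nat_le_iff of_nat_mult of_nat_numeral of_nat_power)
  have "real N \<le> exp (real p)" using p(2) N by (metis exp_le_cancel_iff exp_ln of_nat_0_less_iff)
  also have "\<dots> = exp 1 ^ p" by (simp flip: exp_of_nat_mult)
  finally have 2: "real N \<le> exp 1 ^ p" .
  have "expectation (\<lambda>\<omega>. op_norm N (realised \<omega>) ^ (2 * p)) \<le> walk_sum N \<rho> p"
    unfolding p(1) by (rule expectation_op_norm_power_le_walk_sum)
  also have "\<dots> \<le> N * walk_sum (2 * p) q p"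
    by (rule walk_sum_comparison[OF p0(1) m _ q(1) le]) (use density_range[OF N] in auto)
  also have "\<dots> \<le> N * (4 * real p * (?K * p / L) ^ p)"
    by (intro mult_left_mono walk_sum_sparse_le p0 q L) simp
  also have "\<dots> \<le> exp 1 ^ p * (4 ^ p * (?K * p / L) ^ p)"
    using 1 2 L by (intro mult_mono mult_right_mono) auto
  also have "\<dots> = (upper_const * (p / L)) ^ p"
    by (simp add: upper_const_def mult_ac flip: power_mult_distrib)
  also have "\<dots> = t ^ (2 * p)" by (simp add: power_mult t)
  finally have mom: "expectation (\<lambda>\<omega>. op_norm N (realised \<omega>) ^ (2 * p)) \<le> t ^ (2 * p)" .
  have pt: "x \<le> t + t * (x ^ (2 * p) / t ^ (2 * p))" if "x \<ge> 0" for x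
  proof (cases "x \<le> t")
    case True
    have "0 \<le> t * (x ^ (2 * p) / t ^ (2 * p))" using t that by simp
    with True show ?thesis by linarith
  next
    case False
    then have "(x / t) ^ 1 \<le> (x / t) ^ (2 * p)" using t p0 by (intro power_increasing) auto
    then have "t * (x / t) \<le> t * (x ^ (2 * p) / t ^ (2 * p))"
      using t by (intro mult_left_mono) (auto simp: power_divide)
    then show ?thesis using t by simp
  qed
  have "expectation (\<lambda>\<omega>. op_norm N (realised \<omega>))
      \<le> expectation (\<lambda>\<omega>. t + t * (op_norm N (realised \<omega>) ^ (2 * p) / t ^ (2 * p)))"
    by (intro integral_mono integrable_op_norm Bochner_Integration.integrable_add integrable_mult_right
        integrable_divide integrable_op_norm_power pt op_norm_nonneg) simp
  also have "\<dots> = t + t * (expectation (\<lambda>\<omega>. op_norm N (realised \<omega>) ^ (2 * p)) / t ^ (2 * p))"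
    using integrable_op_norm_power[of "2 * p"] by (subst Bochner_Integration.integral_add) (auto simp: prob_space)
  also have "\<dots> \<le> t + t * 1"
    using mom t by (intro add_left_mono mult_left_mono) auto
  finally show ?thesis by (simp add: t_def)
qed

lemma (in sparse_sign_matrix) expectation_op_norm_le_sum:
  "expectation (\<lambda>\<omega>. op_norm N (realised \<omega>)) \<le> (real N)\<^sup>2 * \<rho>"
proof -
  have "expectation (\<lambda>\<omega>. op_norm N (realised \<omega>)) \<le> expectation (\<lambda>\<omega>. \<Sum>a<N. \<Sum>b<N. (Y a b \<omega>)\<^sup>2)"
  proof (rule integral_mono_AE)
    show "integrable M (\<lambda>\<omega>. \<Sum>a<N. \<Sum>b<N. (Y a b \<omega>)\<^sup>2)"
      by (intro Bochner_Integration.integrable_sum integrable_entry) auto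
    show "AE \<omega> in M. op_norm N (realised \<omega>) \<le> (\<Sum>a<N. \<Sum>b<N. (Y a b \<omega>)\<^sup>2)"
      using all_entry_values
    proof (rule AE_mp, intro AE_I2 impI)
      fix \<omega> assume v: "\<forall>a<N. \<forall>b<N. Y a b \<omega> \<in> {-1, 0, 1}"
      have "op_norm N (realised \<omega>) \<le> (\<Sum>a<N. \<Sum>b<N. \<bar>Y a b \<omega>\<bar>)" by (rule op_norm_le_sum_abs)
      also have "\<dots> \<le> (\<Sum>a<N. \<Sum>b<N. (Y a b \<omega>)\<^sup>2)"
        by (intro sum_mono) (use v in fastforce)
      finally show "op_norm N (realised \<omega>) \<le> (\<Sum>a<N. \<Sum>b<N. (Y a b \<omega>)\<^sup>2)" .
    qed
  qed (rule integrable_op_norm)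
  also have "\<dots> = (\<Sum>a<N. expectation (\<lambda>\<omega>. \<Sum>b<N. (Y a b \<omega>)\<^sup>2))"
    by (rule Bochner_Integration.integral_sum) (auto intro!: Bochner_Integration.integrable_sum integrable_entry)
  also have "\<dots> = (\<Sum>a<N. \<Sum>b<N. expectation (\<lambda>\<omega>. (Y a b \<omega>)\<^sup>2))"
    by (intro sum.cong refl Bochner_Integration.integral_sum integrable_entry) auto
  also have "\<dots> = (\<Sum>a<N. \<Sum>b<N. \<rho>)"
    by (intro sum.cong refl entry_second_moment) auto
  finally show ?thesis by (simp add: power2_eq_square)
qed

section \<open>The second moment method\<close>
context prob_space
begin

text \<open>
  With T the sum of the indicators and \<open>\<mu>\<close> its mean, pairwise independence gives
  \<open>E T\<^sup>2 \<le> \<mu> + \<mu>\<^sup>2\<close>. The quadratic \<open>2 u - u\<^sup>2\<close> of \<open>u = T / (\<mu> + 1)\<close> is a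
  convenient lower bound for other functions of T: it vanishes at 0, is at most 1, and is at
  most \<open>2 * sqrt u\<close>. The denominator \<open>\<mu> + 1\<close> maximises the resulting
  lower bound for its mean.
\<close>
lemma second_moment_quadratic:
  fixes Z :: "'i \<Rightarrow> 'a \<Rightarrow> real"
  assumes I: "finite I" and ind: "indep_vars (\<lambda>_. borel) Z I"
    and val: "\<And>i. i \<in> I \<Longrightarrow> AE \<omega> in M. Z i \<omega> \<in> {0, 1}"
    and \<mu>: "\<mu> = (\<Sum>i\<in>I. expectation (Z i))"
  defines "T \<equiv> \<lambda>\<omega>. \<Sum>i\<in>I. Z i \<omega>"
  shows "integrable M (\<lambda>\<omega>. 2 * (T \<omega> / (\<mu> + 1)) - (T \<omega> / (\<mu> + 1))\<^sup>2)"
    "\<mu> / (\<mu> + 1) \<le> expectation (\<lambda>\<omega>. 2 * (T \<omega> / (\<mu> + 1)) - (T \<omega> / (\<mu> + 1))\<^sup>2)"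
proof -
  have meas [measurable]: "Z i \<in> borel_measurable M" if "i \<in> I" for i
    using ind that by (auto simp: indep_vars_def)
  have int: "integrable M (Z i)" if "i \<in> I" for i
    by (rule integrable_const_bound[of _ 1]) (use val[OF that] meas[OF that] in \<open>auto elim: AE_mp\<close>)
  have int2: "integrable M (\<lambda>\<omega>. Z i \<omega> * Z j \<omega>)" if "i \<in> I" "j \<in> I" for i j
  proof (rule integrable_const_bound[of _ 1])
    show "AE \<omega> in M. norm (Z i \<omega> * Z j \<omega>) \<le> 1"
      using val[OF that(1)] val[OF that(2)] by eventually_elim auto
  qed (use meas that in measurable)
  have pos: "0 \<le> expectation (Z i)" if "i \<in> I" for i
    using val[OF that] by (intro integral_nonneg_AE) (auto elim: AE_mp)
  have \<mu>0: "\<mu> \<ge> 0" unfolding \<mu> by (intro sum_nonneg pos)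
  have prod: "expectation (\<lambda>\<omega>. Z i \<omega> * Z j \<omega>)
      \<le> expectation (Z i) * expectation (Z j) + (if i = j then expectation (Z i) else 0)"
    if ij: "i \<in> I" "j \<in> I" for i j
  proof (cases "i = j")
    case True
    have "expectation (\<lambda>\<omega>. Z i \<omega> * Z j \<omega>) = expectation (Z i)"
    proof (rule integral_cong_AE)
      show "AE \<omega> in M. Z i \<omega> * Z j \<omega> = Z i \<omega>"
        using val[OF ij(1)] by eventually_elim (auto simp: True)
    qed (use meas ij in measurable)
    then show ?thesis using True pos ij by simp
  next
    case False
    have "indep_vars (\<lambda>_. borel) Z {i, j}" by (rule indep_vars_subset[OF ind]) (use ij in auto)
    then have "expectation (\<lambda>\<omega>. \<Prod>x\<in>{i, j}. Z x \<omega>) = (\<Prod>x\<in>{i, j}. expectation (Z x))"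
      by (rule indep_vars_lebesgue_integral[rotated]) (use int ij in auto)
    then show ?thesis using False by simp
  qed
  have T2: "(T \<omega>)\<^sup>2 = (\<Sum>i\<in>I. \<Sum>j\<in>I. Z i \<omega> * Z j \<omega>)" for \<omega>
    by (simp add: T_def power2_eq_square sum_product)
  have intT: "integrable M T" unfolding T_def by (intro Bochner_Integration.integrable_sum int)
  have intT2: "integrable M (\<lambda>\<omega>. (T \<omega>)\<^sup>2)"
    unfolding T2 by (intro Bochner_Integration.integrable_sum int2)
  have ET: "expectation T = \<mu>"
    unfolding T_def \<mu> by (rule Bochner_Integration.integral_sum) (rule int)
  have "expectation (\<lambda>\<omega>. (T \<omega>)\<^sup>2) = (\<Sum>i\<in>I. expectation (\<lambda>\<omega>. \<Sum>j\<in>I. Z i \<omega> * Z j \<omega>))"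
    unfolding T2 by (rule Bochner_Integration.integral_sum) (intro Bochner_Integration.integrable_sum int2)
  also have "\<dots> = (\<Sum>i\<in>I. \<Sum>j\<in>I. expectation (\<lambda>\<omega>. Z i \<omega> * Z j \<omega>))"
    by (intro sum.cong refl Bochner_Integration.integral_sum int2)
  also have "\<dots> \<le> (\<Sum>i\<in>I. \<Sum>j\<in>I. expectation (Z i) * expectation (Z j) + (if i = j then expectation (Z i) else 0))"
    by (intro sum_mono prod)
  also have "\<dots> = \<mu> * \<mu> + \<mu>"
    using I by (simp add: sum.distrib \<mu> sum_product sum.delta)
  finally have ET2: "expectation (\<lambda>\<omega>. (T \<omega>)\<^sup>2) \<le> \<mu> * \<mu> + \<mu>" .
  show int': "integrable M (\<lambda>\<omega>. 2 * (T \<omega> / (\<mu> + 1)) - (T \<omega> / (\<mu> + 1))\<^sup>2)"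
    unfolding power_divide
    by (intro Bochner_Integration.integrable_diff integrable_mult_right integrable_divide intT intT2)
  have "\<mu> / (\<mu> + 1) = 2 * (\<mu> / (\<mu> + 1)) - (\<mu> * \<mu> + \<mu>) / (\<mu> + 1)\<^sup>2"
    using \<mu>0 by (simp add: power2_eq_square divide_simps) algebra
  also have "\<dots> \<le> 2 * (\<mu> / (\<mu> + 1)) - expectation (\<lambda>\<omega>. (T \<omega>)\<^sup>2) / (\<mu> + 1)\<^sup>2"
    using ET2 by (intro diff_left_mono divide_right_mono) auto
  also have "\<dots> = expectation (\<lambda>\<omega>. 2 * (T \<omega> / (\<mu> + 1)) - (T \<omega>)\<^sup>2 / (\<mu> + 1)\<^sup>2)"
    by (subst Bochner_Integration.integral_diff) (use intT intT2 in \<open>simp_all add: ET\<close>)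
  finally show "\<mu> / (\<mu> + 1) \<le> expectation (\<lambda>\<omega>. 2 * (T \<omega> / (\<mu> + 1)) - (T \<omega> / (\<mu> + 1))\<^sup>2)"
    by (simp add: power_divide)
qed

lemma expectation_ge_if_some_indicator:
  fixes Z :: "'i \<Rightarrow> 'a \<Rightarrow> real"
  assumes I: "finite I" and ind: "indep_vars (\<lambda>_. borel) Z I"
    and val: "\<And>i. i \<in> I \<Longrightarrow> AE \<omega> in M. Z i \<omega> \<in> {0, 1}"
    and \<mu>: "\<mu> = (\<Sum>i\<in>I. expectation (Z i))"
    and F: "integrable M F" "\<And>\<omega>. 0 \<le> F \<omega>" and c: "c \<ge> 0"
    and ge: "AE \<omega> in M. (\<exists>i\<in>I. Z i \<omega> \<noteq> 0) \<longrightarrow> c \<le> F \<omega>"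
  shows "c * (\<mu> / (\<mu> + 1)) \<le> expectation F"
proof -
  let ?g = "\<lambda>\<omega>. 2 * ((\<Sum>i\<in>I. Z i \<omega>) / (\<mu> + 1)) - ((\<Sum>i\<in>I. Z i \<omega>) / (\<mu> + 1))\<^sup>2"
  note S = second_moment_quadratic[OF I ind val \<mu>]
  have "c * (\<mu> / (\<mu> + 1)) \<le> c * expectation ?g"
    using S(2) c by (rule mult_left_mono)
  also have "\<dots> = expectation (\<lambda>\<omega>. c * ?g \<omega>)" by simp
  also have "\<dots> \<le> expectation F"
  proof (rule integral_mono_AE)
    show "integrable M (\<lambda>\<omega>. c * ?g \<omega>)" by (rule integrable_mult_right) (rule S(1))
    show "AE \<omega> in M. c * ?g \<omega> \<le> F \<omega>"
      using ge
    proof eventually_elim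
      case (elim \<omega>)
      show ?case
      proof (cases "\<exists>i\<in>I. Z i \<omega> \<noteq> 0")
        case True
        have "?g \<omega> \<le> 1"
          using zero_le_power2[of "1 - (\<Sum>i\<in>I. Z i \<omega>) / (\<mu> + 1)"] by (simp add: power2_diff)
        then have "c * ?g \<omega> \<le> c * 1" using c by (rule mult_left_mono)
        with True elim show ?thesis by simp
      next
        case False
        then have "(\<Sum>i\<in>I. Z i \<omega>) = 0" by (intro sum.neutral) auto
        then show ?thesis using F by simp
      qed
    qed
  qed (rule F(1))
  finally show ?thesis .
qed

lemma expectation_ge_sqrt_count:
  fixes Z :: "'i \<Rightarrow> 'a \<Rightarrow> real"
  assumes I: "finite I" and ind: "indep_vars (\<lambda>_. borel) Z I"
    and val: "\<And>i. i \<in> I \<Longrightarrow> AE \<omega> in M. Z i \<omega> \<in> {0, 1}"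
    and \<mu>: "\<mu> = (\<Sum>i\<in>I. expectation (Z i))" "\<mu> \<ge> 0"
    and F: "integrable M F" and pos: "\<And>i \<omega>. 0 \<le> Z i \<omega>"
    and ge: "\<And>\<omega>. sqrt (\<Sum>i\<in>I. Z i \<omega>) \<le> F \<omega>"
  shows "sqrt (\<mu> + 1) / 2 * (\<mu> / (\<mu> + 1)) \<le> expectation F"
proof -
  let ?g = "\<lambda>\<omega>. 2 * ((\<Sum>i\<in>I. Z i \<omega>) / (\<mu> + 1)) - ((\<Sum>i\<in>I. Z i \<omega>) / (\<mu> + 1))\<^sup>2"
  note S = second_moment_quadratic[OF I ind val \<mu>(1)]
  have "sqrt (\<mu> + 1) / 2 * (\<mu> / (\<mu> + 1)) \<le> sqrt (\<mu> + 1) / 2 * expectation ?g"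
    using S(2) real_sqrt_ge_zero[of "\<mu> + 1"] \<mu>(2) by (intro mult_left_mono) linarith+
  also have "\<dots> = expectation (\<lambda>\<omega>. sqrt (\<mu> + 1) / 2 * ?g \<omega>)" by simp
  also have "\<dots> \<le> expectation F"
  proof (rule integral_mono)
    fix \<omega>
    define s where "s = sqrt ((\<Sum>i\<in>I. Z i \<omega>) / (\<mu> + 1))"
    have T0: "0 \<le> (\<Sum>i\<in>I. Z i \<omega>)" by (intro sum_nonneg pos)
    then have s: "s \<ge> 0" "s\<^sup>2 = (\<Sum>i\<in>I. Z i \<omega>) / (\<mu> + 1)" using \<mu> by (auto simp: s_def)
    \<comment> \<open>The claim \<open>2 * s\<^sup>2 - s ^ 4 \<le> 2 * s\<close> follows from \<open>s ^ 3 - 2 * s + 2 \<ge> 0\<close>, which is written as a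
      sum of nonnegative terms.\<close>
    have "0 \<le> s * (s - 1)\<^sup>2 + 2 * (s - 3 / 4)\<^sup>2 + 7 / 8" using s by (intro add_nonneg_nonneg) auto
    then have "2 * s - s ^ 3 \<le> 2" by (simp add: power2_eq_square power3_eq_cube algebra_simps)
    from mult_left_mono[OF this s(1)] have "2 * s\<^sup>2 - (s\<^sup>2)\<^sup>2 \<le> 2 * s"
      by (simp add: power2_eq_square power3_eq_cube algebra_simps)
    then have "?g \<omega> \<le> 2 * s" unfolding s(2) .
    then have "sqrt (\<mu> + 1) / 2 * ?g \<omega> \<le> sqrt (\<mu> + 1) / 2 * (2 * s)"
      by (rule mult_left_mono) (use \<mu>(2) in simp)
    also have "\<dots> = sqrt (\<Sum>i\<in>I. Z i \<omega>)" using \<mu> by (simp add: s_def real_sqrt_divide)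
    also have "\<dots> \<le> F \<omega>" by (rule ge)
    finally show "sqrt (\<mu> + 1) / 2 * ?g \<omega> \<le> F \<omega>" .
  next
    show "integrable M (\<lambda>\<omega>. sqrt (\<mu> + 1) / 2 * ?g \<omega>)" by (rule integrable_mult_right) (rule S(1))
  qed (rule F)
  finally show ?thesis .
qed

end

section \<open>Lower bounds for the expected norm\<close>
context sparse_sign_matrix
begin

lemma
  defines "Z \<equiv> \<lambda>e \<omega>. (Y (fst e) (snd e) \<omega>)\<^sup>2"
  shows indep_squared_entries: "indep_vars (\<lambda>_. borel) Z ({..<N} \<times> {..<N})"
    and squared_entries_values: "e \<in> {..<N} \<times> {..<N} \<Longrightarrow> AE \<omega> in M. Z e \<omega> \<in> {0, 1}"
    and sum_expectation_squared_entries: "(\<Sum>e\<in>{..<N} \<times> {..<N}. expectation (Z e)) = (real N)\<^sup>2 * \<rho>"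
proof -
  show "indep_vars (\<lambda>_. borel) Z ({..<N} \<times> {..<N})"
    unfolding Z_def using indep_vars_compose2[OF indep, of "\<lambda>_ x. x\<^sup>2" "\<lambda>_. borel"] by (simp add: split_def)
  show "AE \<omega> in M. Z e \<omega> \<in> {0, 1}" if "e \<in> {..<N} \<times> {..<N}"
  proof -
    have "AE \<omega> in M. Y (fst e) (snd e) \<omega> \<in> {-1, 0, 1}" using entry_values that by auto
    then show ?thesis unfolding Z_def by eventually_elim auto
  qed
  have "(\<Sum>e\<in>{..<N} \<times> {..<N}. expectation (Z e)) = (\<Sum>e\<in>{..<N} \<times> {..<N}. \<rho>)"
    unfolding Z_def by (intro sum.cong refl entry_second_moment) auto
  then show "(\<Sum>e\<in>{..<N} \<times> {..<N}. expectation (Z e)) = (real N)\<^sup>2 * \<rho>"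
    by (simp add: power2_eq_square)
qed

lemma expectation_op_norm_ge_entry:
  defines "\<mu> \<equiv> (real N)\<^sup>2 * \<rho>"
  shows "\<mu> / (\<mu> + 1) \<le> expectation (\<lambda>\<omega>. op_norm N (realised \<omega>))"
proof -
  have "1 * (\<mu> / (\<mu> + 1)) \<le> expectation (\<lambda>\<omega>. op_norm N (realised \<omega>))"
  proof (rule expectation_ge_if_some_indicator[OF _ indep_squared_entries squared_entries_values])
    show "AE \<omega> in M. (\<exists>e\<in>{..<N} \<times> {..<N}. (Y (fst e) (snd e) \<omega>)\<^sup>2 \<noteq> 0) \<longrightarrow> 1 \<le> op_norm N (realised \<omega>)"
      using all_entry_values
    proof eventually_elim
      case (elim \<omega>)
      show ?case
      proof
        assume "\<exists>e\<in>{..<N} \<times> {..<N}. (Y (fst e) (snd e) \<omega>)\<^sup>2 \<noteq> 0"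
        then obtain a b where ab: "a < N" "b < N" "Y a b \<omega> \<noteq> 0" by auto
        then have "\<bar>Y a b \<omega>\<bar> = 1" using elim by fastforce
        with entry_le_op_norm[OF ab(1,2), of "realised \<omega>"] show "1 \<le> op_norm N (realised \<omega>)" by simp
      qed
    qed
  qed (auto simp: sum_expectation_squared_entries \<mu>_def op_norm_nonneg intro: integrable_op_norm)
  then show ?thesis by simp
qed

lemma expectation_op_norm_ge_frobenius:
  assumes N: "N > 0"
  defines "\<mu> \<equiv> (real N)\<^sup>2 * \<rho>"
  shows "sqrt (\<mu> + 1) / 2 * (\<mu> / (\<mu> + 1)) \<le> sqrt N * expectation (\<lambda>\<omega>. op_norm N (realised \<omega>))"
proof -
  have "sqrt (\<mu> + 1) / 2 * (\<mu> / (\<mu> + 1)) \<le> expectation (\<lambda>\<omega>. sqrt N * op_norm N (realised \<omega>))"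
  proof (rule expectation_ge_sqrt_count[OF _ indep_squared_entries squared_entries_values])
    show "sqrt (\<Sum>e\<in>{..<N} \<times> {..<N}. (Y (fst e) (snd e) \<omega>)\<^sup>2) \<le> sqrt N * op_norm N (realised \<omega>)" for \<omega>
      using frobenius_le_op_norm[where ?A = "realised \<omega>" and ?n = N] by (simp add: sum.cartesian_product split_def)
    show "\<mu> \<ge> 0" using density_range[OF N] by (simp add: \<mu>_def)
  qed (auto simp: sum_expectation_squared_entries \<mu>_def intro: integrable_mult_right integrable_op_norm)
  then show ?thesis by simp
qed

definition column_count :: "nat \<Rightarrow> 'a \<Rightarrow> real" where
  "column_count b \<omega> = (\<Sum>a<N. (Y a b \<omega>)\<^sup>2)"

text \<open>
  Indicators of different columns depend on disjoint sets of entries.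
\<close>
lemma indep_column_indicators:
  "indep_vars (\<lambda>_. borel) (\<lambda>b \<omega>. of_bool (k \<le> column_count b \<omega>) :: real) {..<N}"
proof -
  define K where "K b = {..<N} \<times> {b}" for b :: nat
  let ?X = "\<lambda>(a, b). Y a b"
  have "indep_vars (\<lambda>b. PiM (K b) (\<lambda>_. borel)) (\<lambda>b \<omega>. restrict (\<lambda>x. ?X x \<omega>) (K b)) {..<N}"
    by (rule indep_vars_restrict[OF indep]) (auto simp: K_def disjoint_family_on_def)
  then have "indep_vars (\<lambda>_. borel)
      (\<lambda>b \<omega>. (\<lambda>f. of_bool (k \<le> (\<Sum>a<N. (f (a, b))\<^sup>2)) :: real) (restrict (\<lambda>x. ?X x \<omega>) (K b))) {..<N}"
  proof (rule indep_vars_compose2)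
    fix b
    have [measurable]: "(\<lambda>f. \<Sum>a<N. (f (a, b))\<^sup>2) \<in> borel_measurable (PiM (K b) (\<lambda>_. borel :: real measure))"
      by (intro borel_measurable_sum borel_measurable_power measurable_component_singleton) (auto simp: K_def)
    show "(\<lambda>f. of_bool (k \<le> (\<Sum>a<N. (f (a, b))\<^sup>2)) :: real) \<in> borel_measurable (PiM (K b) (\<lambda>_. borel :: real measure))"
      unfolding of_bool_def by measurable
  qed
  then show ?thesis
    by (rule indep_vars_cong[THEN iffD1, rotated -1]) (auto simp: K_def column_count_def fun_eq_iff intro!: arg_cong[of _ _ of_bool] sum.cong)
qed

text \<open>
  The event that a column has exactly k nonzero entries is the disjoint union, over the
  k-element sets S of rows, of the events that S is its support. The indicator of such an event is a product
  over the entries, and there are at least \<open>(N / k) ^ k\<close> sets S.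
\<close>
lemma column_indicator_expectation_ge:
  assumes k: "1 \<le> k" "k \<le> N" and b: "b < N"
  shows "(real N / k) ^ k * (\<rho> ^ k * (1 - \<rho>) ^ (N - k)) \<le> expectation (\<lambda>\<omega>. of_bool (real k \<le> column_count b \<omega>))"
proof -
  let ?V = "{..<N} \<times> {..<N}"
  define g where "g S e x = (if snd e = b then (if fst e \<in> S then x\<^sup>2 else 1 - x\<^sup>2) else 1)"
    for S :: "nat set" and e :: "nat \<times> nat" and x :: real
  let ?P = "\<lambda>S \<omega>. \<Prod>e\<in>?V. g S e (Y (fst e) (snd e) \<omega>)"
  let ?\<S> = "{S. S \<subseteq> {..<N} \<and> card S = k}"
  have fin: "finite ?\<S>" by (rule finite_subset[of _ "Pow {..<N}"]) auto
  have gm: "g S e \<in> borel_measurable borel" for S e unfolding g_def by measurable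
  have column: "(\<Prod>e\<in>?V. if snd e = b then h (fst e) else 1) = (\<Prod>a<N. h a)" for h :: "nat \<Rightarrow> real"
  proof -
    have "(\<Prod>e\<in>?V. if snd e = b then h (fst e) else 1) = (\<Prod>a<N. \<Prod>b'<N. if b' = b then h a else 1)"
      unfolding prod.cartesian_product by (simp add: split_def)
    also have "\<dots> = (\<Prod>a<N. h a)" by (intro prod.cong refl) (use b in \<open>simp add: prod.delta\<close>)
    finally show ?thesis .
  qed
  have E: "expectation (?P S) = \<rho> ^ k * (1 - \<rho>) ^ (N - k)" if S: "S \<in> ?\<S>" for S
  proof -
    have "expectation (?P S) = (\<Prod>e\<in>?V. (1 - \<rho>) * g S e 0 + \<rho> * ((g S e 1 + g S e (-1)) / 2))"
      by (rule expectation_prod_entries(2)) (rule gm)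
    also have "\<dots> = (\<Prod>e\<in>?V. if snd e = b then (if fst e \<in> S then \<rho> else 1 - \<rho>) else 1)"
      by (intro prod.cong refl) (simp add: g_def)
    also have "\<dots> = (\<Prod>a<N. if a \<in> S then \<rho> else 1 - \<rho>)" by (rule column)
    also have "\<dots> = \<rho> ^ card ({..<N} \<inter> S) * (1 - \<rho>) ^ card ({..<N} - S)"
      by (subst prod.If_cases) (auto simp: Diff_eq)
    also have "{..<N} \<inter> S = S" using S by auto
    also have "card ({..<N} - S) = N - k" using S by (subst card_Diff_subset) (auto intro: finite_subset)
    finally show ?thesis using S by simp
  qed
  have int: "integrable M (?P S)" for S by (rule expectation_prod_entries(1)) (rule gm)
  have choose: "(real N / k) ^ k \<le> real (card ?\<S>)"
    using binomial_ge_n_over_k_pow_k[OF k(2)] n_subsets[of "{..<N}" k] by simp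
  have "(real N / k) ^ k * (\<rho> ^ k * (1 - \<rho>) ^ (N - k)) \<le> real (card ?\<S>) * (\<rho> ^ k * (1 - \<rho>) ^ (N - k))"
    using density_range b by (intro mult_right_mono choose) auto
  also have "\<dots> = (\<Sum>S\<in>?\<S>. expectation (?P S))" using E by simp
  also have "\<dots> = expectation (\<lambda>\<omega>. \<Sum>S\<in>?\<S>. ?P S \<omega>)"
    by (rule Bochner_Integration.integral_sum[symmetric]) (rule int)
  also have "\<dots> \<le> expectation (\<lambda>\<omega>. of_bool (real k \<le> column_count b \<omega>))"
  proof (rule integral_mono_AE)
    show "integrable M (\<lambda>\<omega>. \<Sum>S\<in>?\<S>. ?P S \<omega>)" by (intro Bochner_Integration.integrable_sum int)
    have "(\<lambda>\<omega>. of_bool (real k \<le> column_count b \<omega>) :: real) \<in> borel_measurable M"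
      using indep_column_indicators b by (auto simp: indep_vars_def)
    then show "integrable M (\<lambda>\<omega>. of_bool (real k \<le> column_count b \<omega>) :: real)"
      by (intro integrable_const_bound[of _ 1]) auto
    show "AE \<omega> in M. (\<Sum>S\<in>?\<S>. ?P S \<omega>) \<le> of_bool (real k \<le> column_count b \<omega>)"
      using all_entry_values
    proof eventually_elim
      case (elim \<omega>)
      define A where "A = {a. a < N \<and> Y a b \<omega> \<noteq> 0}"
      have A: "A \<subseteq> {..<N}" by (auto simp: A_def)
      have sq: "(Y a b \<omega>)\<^sup>2 = of_bool (a \<in> A)" if "a < N" for a
        using elim b that by (fastforce simp: A_def)
      have count: "column_count b \<omega> = real (card A)"
        unfolding column_count_def using A by (simp add: sq sum.If_cases of_bool_def Int_absorb1)
      have P: "?P S \<omega> = of_bool (S = A)" if S: "S \<in> ?\<S>" for S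
      proof -
        have "?P S \<omega> = (\<Prod>e\<in>?V. if snd e = b then of_bool (fst e \<in> S \<longleftrightarrow> fst e \<in> A) else 1)"
        proof (intro prod.cong refl)
          fix e assume "e \<in> ?V"
          then have "(Y (fst e) b \<omega>)\<^sup>2 = of_bool (fst e \<in> A)" by (intro sq) auto
          then show "g S e (Y (fst e) (snd e) \<omega>)
              = (if snd e = b then of_bool (fst e \<in> S \<longleftrightarrow> fst e \<in> A) else 1)"
            unfolding g_def by (cases "fst e \<in> A") auto
        qed
        also have "\<dots> = (\<Prod>a<N. of_bool (a \<in> S \<longleftrightarrow> a \<in> A))" by (rule column)
        also have "\<dots> = of_bool (S = A)"
        proof (cases "S = A")
          case False
          then obtain a where "a < N" "(a \<in> S) \<noteq> (a \<in> A)" using S A by blast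
          then have "(\<Prod>a<N. of_bool (a \<in> S \<longleftrightarrow> a \<in> A) :: real) = 0" by (intro prod_zero) auto
          with False show ?thesis by simp
        qed simp
        finally show ?thesis .
      qed
      have "(\<Sum>S\<in>?\<S>. ?P S \<omega>) = (\<Sum>S\<in>?\<S>. of_bool (S = A))" by (intro sum.cong refl P)
      also have "\<dots> = of_bool (A \<in> ?\<S>)" using fin by (simp add: of_bool_def sum.delta)
      also have "\<dots> \<le> of_bool (real k \<le> column_count b \<omega>)" by (auto simp: count)
      finally show ?case .
    qed
  qed
  finally show ?thesis .
qed

text \<open>
  For \<open>\<rho> = 1 / N\<close> a column has at least k nonzero entries with probability at least
  \<open>exp (- 2) / k ^ k\<close>, so the hypothesis on k says that at least one such column is expected.
\<close>
lemma expectation_op_norm_ge_column: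
  assumes N: "N \<ge> 2" and \<rho>: "\<rho> = 1 / N" and k: "1 \<le> k" "k \<le> N" "real k ^ k * exp 2 \<le> N"
  shows "sqrt k / 2 \<le> expectation (\<lambda>\<omega>. op_norm N (realised \<omega>))"
proof -
  define \<mu> :: real where "\<mu> = (\<Sum>b<N. expectation (\<lambda>\<omega>. of_bool (real k \<le> column_count b \<omega>)))"
  have "exp (-2) \<le> (1 - \<rho>) ^ N"
  proof -
    have pos: "0 < 1 - \<rho>" using N by (simp add: \<rho>)
    have "inverse (1 - \<rho>) = 1 + 1 / (real N - 1)" using N by (simp add: \<rho> field_simps)
    also have "\<dots> \<le> exp (1 / (real N - 1))" by (rule exp_ge_add_one_self)
    finally have "inverse (1 - \<rho>) ^ N \<le> exp (1 / (real N - 1)) ^ N" using pos by (intro power_mono) auto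
    also have "\<dots> = exp (N / (real N - 1))" by (simp flip: exp_of_nat_mult)
    also have "\<dots> \<le> exp 2" using N by (simp add: field_simps)
    finally have "inverse (exp 2) \<le> inverse (inverse (1 - \<rho>) ^ N)" using pos by (intro le_imp_inverse_le) auto
    then show ?thesis by (simp add: power_inverse exp_minus)
  qed
  also have "(1 - \<rho>) ^ N \<le> (1 - \<rho>) ^ (N - k)"
    using density_range N by (intro power_decreasing) auto
  finally have e: "exp (-2) \<le> (1 - \<rho>) ^ (N - k)" .
  have "1 \<le> real N * (exp (-2) / real k ^ k)" using k by (simp add: exp_minus field_simps)
  also have "\<dots> = (\<Sum>b<N. exp (-2) / real k ^ k)" by simp
  also have "\<dots> \<le> \<mu>"
    unfolding \<mu>_def
  proof (rule sum_mono)
    fix b assume "b \<in> {..<N}"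
    then have b: "b < N" by simp
    have "exp (-2) / real k ^ k = (real N / k) ^ k * (\<rho> ^ k * exp (-2))"
      using N k by (simp add: \<rho> power_divide)
    also have "\<dots> \<le> (real N / k) ^ k * (\<rho> ^ k * (1 - \<rho>) ^ (N - k))"
      using e \<rho> by (intro mult_left_mono) auto
    also have "\<dots> \<le> expectation (\<lambda>\<omega>. of_bool (real k \<le> column_count b \<omega>))"
      by (rule column_indicator_expectation_ge[OF k(1,2) b])
    finally show "exp (-2) / real k ^ k \<le> \<dots>" .
  qed
  finally have \<mu>: "1 \<le> \<mu>" .
  have "sqrt k / 2 = sqrt k * (1 / 2)" by simp
  also have "\<dots> \<le> sqrt k * (\<mu> / (\<mu> + 1))"
    using \<mu> by (intro mult_left_mono) (auto simp: field_simps)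
  also have "\<dots> \<le> expectation (\<lambda>\<omega>. op_norm N (realised \<omega>))"
  proof (rule expectation_ge_if_some_indicator[OF _ indep_column_indicators[of "real k"]])
    show "AE \<omega> in M. (\<exists>b\<in>{..<N}. of_bool (real k \<le> column_count b \<omega>) \<noteq> (0::real))
        \<longrightarrow> sqrt k \<le> op_norm N (realised \<omega>)"
    proof (intro AE_I2 impI)
      fix \<omega> assume "\<exists>b\<in>{..<N}. of_bool (real k \<le> column_count b \<omega>) \<noteq> (0::real)"
      then obtain b where b: "b < N" "real k \<le> column_count b \<omega>" by (auto split: if_splits)
      from b(2) have "sqrt k \<le> sqrt (column_count b \<omega>)" by simp
      also have "\<dots> \<le> op_norm N (realised \<omega>)"
        unfolding column_count_def by (rule column_le_op_norm[OF b(1), of "realised \<omega>"])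
      finally show "sqrt k \<le> op_norm N (realised \<omega>)" .
    qed
  qed (auto simp: \<mu>_def op_norm_nonneg intro: integrable_op_norm)
  finally show ?thesis .
qed

end

section \<open>The four regimes\<close>
lemma power_of_two_between:
  fixes x :: real assumes "x \<ge> 1"
  obtains k where "x \<le> real (2 ^ Suc k)" "real (2 ^ Suc k) \<le> 2 * x"
proof -
  have "1 \<le> nat \<lfloor>x\<rfloor>" using assms by linarith
  from ex_power_ivl1[OF _ this, of 2] obtain k where k: "2 ^ k \<le> nat \<lfloor>x\<rfloor>" "nat \<lfloor>x\<rfloor> < 2 ^ (k + 1)" by auto
  show thesis
  proof
    have "Suc (nat \<lfloor>x\<rfloor>) \<le> 2 ^ Suc k" using k(2) by simp
    then have "real (Suc (nat \<lfloor>x\<rfloor>)) \<le> real (2 ^ Suc k)" by (rule of_nat_mono)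
    then show "x \<le> real (2 ^ Suc k)" using assms by linarith
    have "real (2 ^ k) \<le> real (nat \<lfloor>x\<rfloor>)" using k(1) by (rule of_nat_mono)
    also have "\<dots> \<le> x" using assms by (intro of_nat_floor) simp
    finally show "real (2 ^ Suc k) \<le> 2 * x" by simp
  qed
qed

text \<open>
  Here \<open>d = N * \<rho>\<close> is the mean number of nonzero entries in a row or column, and both bounds are
  multiples of \<open>sqrt d\<close>. Sparsity brings no gain, so the auxiliary matrix has full density.
\<close>
lemma (in sparse_sign_matrix) expectation_dense_bounds:
  fixes \<beta> :: real
  assumes \<beta>: "0 \<le> \<beta>" "\<beta> < 1" and \<rho>: "\<rho> = N powr - \<beta>" and N: "N \<ge> 1" "ln N \<le> N powr (1 - \<beta>)"
  shows "1 / 4 * N powr ((1 - \<beta>) / 2) \<le> expectation (\<lambda>\<omega>. op_norm N (realised \<omega>))"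
    "expectation (\<lambda>\<omega>. op_norm N (realised \<omega>)) \<le> 4 * sqrt upper_const * N powr ((1 - \<beta>) / 2)"
proof -
  let ?E = "expectation (\<lambda>\<omega>. op_norm N (realised \<omega>))"
  define d where "d = N powr (1 - \<beta>)"
  have N0: "real N > 0" using N by simp
  have sd: "sqrt d = N powr ((1 - \<beta>) / 2)" by (simp add: d_def powr_half_sqrt[symmetric] powr_powr)
  have d1: "d \<ge> 1" using N \<beta> by (simp add: d_def ge_one_powr_ge_zero)
  have dN: "d \<le> N" using powr_mono[of "1 - \<beta>" 1 N] N \<beta> by (simp add: d_def)
  have d\<rho>: "N * \<rho> = d" using N0 by (simp add: \<rho> d_def powr_diff powr_minus divide_inverse)
  obtain k where k: "d \<le> real (2 ^ Suc k)" "real (2 ^ Suc k) \<le> 2 * d" using power_of_two_between[OF d1] .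
  have "exp (1 / 2 :: real) \<le> exp 1" by simp
  also have "\<dots> \<le> 3" by (rule exp_le)
  finally have e: "1 * (1 / 2) * exp (1 / 2 :: real) \<le> 2" by simp
  have "ln N \<le> real (2 ^ Suc k)" using N k(1) by (simp add: d_def)
  from expectation_op_norm_le[OF refl this d1 dN k(1) _ _ _ _ e]
  have "?E \<le> 2 * sqrt (upper_const * (real (2 ^ Suc k) / (1 / 2)))" using d\<rho> by simp
  also have "\<dots> \<le> 2 * sqrt (upper_const * (2 * d / (1 / 2)))"
    using k(2) by (intro mult_left_mono real_sqrt_le_mono divide_right_mono) (auto simp: upper_const_def)
  also have "\<dots> = 4 * sqrt upper_const * sqrt d"
    by (simp add: real_sqrt_mult)
  finally show "?E \<le> 4 * sqrt upper_const * N powr ((1 - \<beta>) / 2)" by (simp add: sd)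
  define \<mu> where "\<mu> = (real N)\<^sup>2 * \<rho>"
  have \<mu>: "\<mu> = N * d" using d\<rho> by (simp add: \<mu>_def power2_eq_square)
  have \<mu>1: "\<mu> \<ge> 1" unfolding \<mu> using N d1 mult_mono[of 1 "real N" 1 d] by simp
  have "sqrt N * (1 / 4 * sqrt d) = sqrt \<mu> / 2 * (1 / 2)" by (simp add: \<mu> real_sqrt_mult)
  also have "\<dots> \<le> sqrt (\<mu> + 1) / 2 * (\<mu> / (\<mu> + 1))"
    using \<mu>1 by (intro mult_mono) (auto simp: field_simps)
  also have "\<dots> \<le> sqrt N * ?E"
    unfolding \<mu>_def by (rule expectation_op_norm_ge_frobenius) (use N in simp)
  finally show "1 / 4 * N powr ((1 - \<beta>) / 2) \<le> ?E" using N0 by (simp add: sd)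
qed

text \<open>
  For the upper bound, p is of order \<open>ln N\<close>; the auxiliary density \<open>1 / sqrt p\<close> is a
  negative power of p, so L can be of order \<open>ln p\<close>, that is of order \<open>ln (ln N)\<close>. For the lower bound, j of
  order \<open>ln N / ln (ln N)\<close> satisfies \<open>j ^ j \<le> sqrt N\<close>, and a column with j nonzero entries exists with
  probability bounded below.
\<close>
lemma (in sparse_sign_matrix) expectation_critical_bounds:
  assumes \<rho>: "\<rho> = N powr - 1" and N: "4 \<le> ln N" "2 * ln N \<le> N" "1 \<le> ln (ln N)" "2 * ln (ln N) \<le> ln N"
  shows "1 / 4 * (ln N / ln (ln N)) powr (1 / 2) \<le> expectation (\<lambda>\<omega>. op_norm N (realised \<omega>))"
    "expectation (\<lambda>\<omega>. op_norm N (realised \<omega>)) \<le> 2 * sqrt (8 * upper_const) * (ln N / ln (ln N)) powr (1 / 2)"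
proof -
  let ?E = "expectation (\<lambda>\<omega>. op_norm N (realised \<omega>))"
  define x where "x = ln (real N)"
  have x: "4 \<le> x" "1 \<le> ln x" "2 * ln x \<le> x" "2 * x \<le> N" using N by (auto simp: x_def)
  have N0: "N \<ge> 2" "real N > 0" using x by linarith+
  have sq: "(ln N / ln (ln N)) powr (1 / 2) = sqrt (x / ln x)"
    using x by (simp add: powr_half_sqrt x_def)
  obtain k where k: "x \<le> real (2 ^ Suc k)" "real (2 ^ Suc k) \<le> 2 * x"
    using power_of_two_between[of x] x by auto
  define p where "p = real (2 ^ Suc k)"
  have p: "x \<le> p" "p \<le> 2 * x" using k by (auto simp: p_def)
  have p1: "1 \<le> p" using p x by linarith
  have lnp: "ln x \<le> ln p" using p x by simp
  have sp: "1 \<le> sqrt p" "sqrt p \<le> p" using p1 by (auto intro: real_le_lsqrt simp: power2_eq_square)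
  have L: "ln p / 4 > 0" using lnp x by linarith
  have qL: "1 / sqrt p * (ln p / 4) * exp (ln p / 4) \<le> 2"
  proof -
    define y where "y = exp (ln p / 4)"
    have y: "y > 0" "ln y = ln p / 4" by (auto simp: y_def)
    have "sqrt p = exp (ln p / 2)" using p1 by (simp add: powr_half_sqrt[symmetric] powr_def)
    also have "\<dots> = y * y" by (simp add: y_def flip: exp_add)
    finally have "1 / sqrt p * (ln p / 4) * exp (ln p / 4) = ln y / y" using y by (simp add: y_def)
    also have "\<dots> \<le> 1" using ln_le_minus_one[OF y(1)] y by (simp add: divide_le_eq)
    finally show ?thesis by simp
  qed
  have "?E \<le> 2 * sqrt (upper_const * (p / (ln p / 4)))"
    unfolding p_def
  proof (rule expectation_op_norm_le[OF refl _ _ _ _ _ _ _ L[unfolded p_def] qL[unfolded p_def]])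
    show "N * \<rho> \<le> sqrt (real (2 ^ Suc k)) * (1 / sqrt (real (2 ^ Suc k)))"
      using N0 by (simp add: \<rho> powr_minus)
  qed (use sp p x p1 k in \<open>simp_all add: p_def x_def\<close>)
  also have "\<dots> \<le> 2 * sqrt (8 * upper_const * (x / ln x))"
  proof -
    have "p / ln p \<le> 2 * x / ln x" using p lnp x by (intro frac_le) auto
    then have "upper_const * (p / (ln p / 4)) \<le> 8 * upper_const * (x / ln x)"
      using mult_left_mono[of "p / ln p" "2 * x / ln x" "4 * upper_const"]
      by (simp add: upper_const_def)
    then show ?thesis by simp
  qed
  also have "\<dots> = 2 * (sqrt (8 * upper_const) * sqrt (x / ln x))"
    by (simp only: real_sqrt_mult[of "8 * upper_const"])
  finally show "?E \<le> 2 * sqrt (8 * upper_const) * (ln N / ln (ln N)) powr (1 / 2)"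
    unfolding sq by (simp only: mult.assoc)
  define u where "u = x / (2 * ln x)"
  have u: "1 \<le> u" "u \<le> x / 2" using x by (auto simp: u_def field_simps)
  define j where "j = nat \<lfloor>u\<rfloor>"
  have j: "1 \<le> j" "real j \<le> u" "u / 2 \<le> real j" 
  proof -
    have fl: "1 \<le> \<lfloor>u\<rfloor>" "real_of_int \<lfloor>u\<rfloor> \<le> u" "u < real_of_int \<lfloor>u\<rfloor> + 1" using u(1) by linarith+
    then have "real j = real_of_int \<lfloor>u\<rfloor>" "1 \<le> real_of_int \<lfloor>u\<rfloor>" by (auto simp: j_def)
    with fl show "1 \<le> j" "real j \<le> u" "u / 2 \<le> real j" by linarith+
  qed
  have "sqrt j / 2 \<le> ?E"
  proof (rule expectation_op_norm_ge_column)
    show "N \<ge> 2" by fact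
    show "\<rho> = 1 / N" using N0 by (simp add: \<rho> powr_minus divide_inverse)
    show "1 \<le> j" by fact
    show "j \<le> N" using j u x by linarith
    have "real j * ln j \<le> u * ln x"
      using j u x by (intro mult_mono) (auto intro!: ln_ge_zero)
    also have "\<dots> = x / 2" using x by (simp add: u_def)
    finally have "real j * ln j + 2 \<le> x" using x by linarith
    then have "exp (real j * ln j + 2) \<le> exp x" by simp
    then show "real j ^ j * exp 2 \<le> N"
      using j N0 by (simp add: exp_add exp_of_nat_mult x_def)
  qed
  moreover have "1 / 4 * sqrt (x / ln x) \<le> sqrt j / 2"
  proof -
    have "x / ln x / 4 \<le> real j" using j(3) x by (simp add: u_def)
    then have "sqrt (x / ln x / 4) \<le> sqrt (real j)" by (rule real_sqrt_le_mono)
    moreover have "sqrt (x / ln x / 4) = sqrt (x / ln x) / 2"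
      unfolding real_sqrt_divide[of "x / ln x" 4] by simp
    ultimately show ?thesis by linarith
  qed
  ultimately show "1 / 4 * (ln N / ln (ln N)) powr (1 / 2) \<le> ?E" unfolding sq by linarith
qed

text \<open>
  The density of the auxiliary matrix can be as small as \<open>N powr (1 - \<beta>)\<close>, so that L is of order
  \<open>ln N\<close>, like p: the bound \<open>sqrt (p / L)\<close> is a constant. It deteriorates as \<open>\<beta>\<close> decreases to 1.
\<close>
lemma (in sparse_sign_matrix) expectation_sparse_bounds:
  fixes \<beta> :: real
  assumes \<beta>: "1 < \<beta>" "\<beta> \<le> 2" and \<rho>: "\<rho> = N powr - \<beta>" and N: "1 \<le> ln N"
  shows "1 / 2 \<le> expectation (\<lambda>\<omega>. op_norm N (realised \<omega>))"
    "expectation (\<lambda>\<omega>. op_norm N (realised \<omega>)) \<le> 2 * sqrt (upper_const * (4 / (\<beta> - 1)))"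
proof -
  let ?E = "expectation (\<lambda>\<omega>. op_norm N (realised \<omega>))"
  define x where "x = ln (real N)"
  have N1: "N \<ge> 1"
  proof (rule ccontr)
    assume "\<not> N \<ge> 1"
    then have "N = 0" by simp
    with N show False by simp
  qed
  then have N0: "real N > 0" by simp
  have x: "x \<ge> 1" using N by (simp add: x_def)
  obtain k where k: "x \<le> real (2 ^ Suc k)" "real (2 ^ Suc k) \<le> 2 * x"
    using power_of_two_between[OF x] .
  define L where "L = (\<beta> - 1) / 2 * x"
  have L: "L > 0" using \<beta> x by (simp add: L_def)
  have L2: "2 * L = (\<beta> - 1) * x" by (simp add: L_def)
  have q: "N powr (1 - \<beta>) = exp (- (2 * L))"
    unfolding L2 using N0 by (simp add: powr_def x_def algebra_simps)
  have qL: "N powr (1 - \<beta>) * L * exp L \<le> 2"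
  proof -
    have "N powr (1 - \<beta>) * L * exp L = L * exp (- L)"
      unfolding q by (simp add: mult_ac flip: exp_add)
    also have "\<dots> \<le> exp L * exp (- L)"
    proof (rule mult_right_mono)
      show "L \<le> exp L" using exp_ge_add_one_self[of L] by linarith
    qed simp
    finally show ?thesis by (simp flip: exp_add)
  qed
  have "?E \<le> 2 * sqrt (upper_const * (real (2 ^ Suc k) / L))"
  proof (rule expectation_op_norm_le[OF refl _ _ _ _ _ _ _ L qL])
    show "N * \<rho> \<le> 1 * N powr (1 - \<beta>)"
      using N0 by (simp add: \<rho> powr_diff powr_minus divide_inverse)
    show "N powr (1 - \<beta>) \<le> 1" unfolding q using L by simp
  qed (use k x N1 in \<open>simp_all add: x_def\<close>)
  also have "\<dots> \<le> 2 * sqrt (upper_const * (4 / (\<beta> - 1)))"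
  proof -
    have "real (2 ^ Suc k) / L \<le> 2 * x / L" using k L by (intro divide_right_mono) auto
    also have "\<dots> = 4 / (\<beta> - 1)" using x \<beta> by (simp add: L_def field_simps)
    finally show ?thesis
      by (intro mult_left_mono real_sqrt_le_mono) (auto simp: upper_const_def)
  qed
  finally show "?E \<le> 2 * sqrt (upper_const * (4 / (\<beta> - 1)))" .
  define \<mu> where "\<mu> = (real N)\<^sup>2 * \<rho>"
  have "\<mu> = N powr (2 - \<beta>)" using N0 by (simp add: \<mu>_def \<rho> powr_diff powr_minus divide_inverse)
  then have "\<mu> \<ge> 1" using N1 \<beta> by (simp add: ge_one_powr_ge_zero)
  then have "1 / 2 \<le> \<mu> / (\<mu> + 1)" by (simp add: field_simps)
  also have "\<dots> \<le> ?E" unfolding \<mu>_def by (rule expectation_op_norm_ge_entry)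
  finally show "1 / 2 \<le> ?E" .
qed

lemma (in sparse_sign_matrix) expectation_very_sparse_bounds:
  fixes \<beta> :: real
  assumes \<beta>: "2 < \<beta>" and \<rho>: "\<rho> = N powr - \<beta>" and N: "N \<ge> 1"
  shows "1 / 2 * N powr (2 - \<beta>) \<le> expectation (\<lambda>\<omega>. op_norm N (realised \<omega>))"
    "expectation (\<lambda>\<omega>. op_norm N (realised \<omega>)) \<le> 1 * N powr (2 - \<beta>)"
proof -
  let ?E = "expectation (\<lambda>\<omega>. op_norm N (realised \<omega>))"
  have N0: "real N > 0" using N by simp
  define \<mu> where "\<mu> = (real N)\<^sup>2 * \<rho>"
  have \<mu>: "\<mu> = N powr (2 - \<beta>)" using N0 by (simp add: \<mu>_def \<rho> powr_diff powr_minus divide_inverse)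
  have "\<mu> \<le> 1" unfolding \<mu> using powr_mono[of "2 - \<beta>" 0 N] N \<beta> by simp
  moreover have "\<mu> \<ge> 0" by (simp add: \<mu>)
  ultimately have "1 / 2 * \<mu> \<le> \<mu> / (\<mu> + 1)"
    using frac_le[of \<mu> \<mu> "\<mu> + 1" 2] by simp
  also have "\<dots> \<le> ?E" unfolding \<mu>_def by (rule expectation_op_norm_ge_entry)
  finally show "1 / 2 * N powr (2 - \<beta>) \<le> ?E" by (simp add: \<mu>)
  show "?E \<le> 1 * N powr (2 - \<beta>)"
    using expectation_op_norm_le_sum by (simp add: \<mu>[symmetric] \<mu>_def)
qed

text \<open>
  The normalisation \<open>\<rho> powr (- 1 / 2) = n powr (\<beta> / 2)\<close> is split off, and h is the growth
  rate of the expected norm of the matrix with entries in \<open>{-1, 0, 1}\<close>.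
\<close>
lemma growth_transfer:
  fixes \<beta> c C :: real and h :: "nat \<Rightarrow> real"
  assumes \<beta>: "\<beta> \<ge> 0"
    and rate: "\<And>n. n > 0 \<Longrightarrow> growth_rate \<beta> n = n powr (\<beta> / 2) * h n"
    and bounds: "\<forall>\<^sub>F n in sequentially. \<forall>(M :: 'a measure) Y. sparse_sign_matrix M n (real n powr - \<beta>) Y \<longrightarrow>
        c * h n \<le> integral\<^sup>L M (\<lambda>\<omega>. op_norm n (\<lambda>a b. Y a b \<omega>)) \<and>
        integral\<^sup>L M (\<lambda>\<omega>. op_norm n (\<lambda>a b. Y a b \<omega>)) \<le> C * h n"
  shows "\<forall>\<^sub>F n in sequentially. \<forall>(M :: 'a measure) \<epsilon> B.
      signs_and_selectors M n (real n powr (- \<beta>)) \<epsilon> B \<longrightarrow>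
        c * growth_rate \<beta> n
          \<le> prob_space.expectation M (\<lambda>\<omega>. op_norm n (sparse_matrix (real n powr (- \<beta>)) \<epsilon> B \<omega>)) \<and>
        prob_space.expectation M (\<lambda>\<omega>. op_norm n (sparse_matrix (real n powr (- \<beta>)) \<epsilon> B \<omega>))
          \<le> C * growth_rate \<beta> n"
  using bounds eventually_gt_at_top[of 0]
proof eventually_elim
  case (elim n)
  show ?case
  proof (intro allI impI)
    fix M :: "'a measure" and \<epsilon> B
    assume S: "signs_and_selectors M n (real n powr - \<beta>) \<epsilon> B"
    define Y where "Y i j \<omega> = \<epsilon> i j \<omega> * B i j \<omega>" for i j \<omega>
    have "real n powr - \<beta> \<le> 1" using powr_mono[of "- \<beta>" 0 n] elim \<beta> by simp
    with S have Y: "sparse_sign_matrix M n (real n powr - \<beta>) Y"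
      unfolding Y_def by (intro signs_and_selectors_sparse_sign_matrix) auto
    have "sparse_matrix (real n powr - \<beta>) \<epsilon> B \<omega> = (\<lambda>i j. n powr (\<beta> / 2) * Y i j \<omega>)" for \<omega>
      by (simp add: sparse_matrix_def Y_def fun_eq_iff powr_powr mult.assoc)
    then have "integral\<^sup>L M (\<lambda>\<omega>. op_norm n (sparse_matrix (real n powr (- \<beta>)) \<epsilon> B \<omega>))
        = n powr (\<beta> / 2) * integral\<^sup>L M (\<lambda>\<omega>. op_norm n (\<lambda>a b. Y a b \<omega>))"
      by (simp add: op_norm_scale)
    moreover have "c * h n \<le> integral\<^sup>L M (\<lambda>\<omega>. op_norm n (\<lambda>a b. Y a b \<omega>))"
      "integral\<^sup>L M (\<lambda>\<omega>. op_norm n (\<lambda>a b. Y a b \<omega>)) \<le> C * h n"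
      using elim(1) Y by auto
    then have "n powr (\<beta> / 2) * (c * h n) \<le> n powr (\<beta> / 2) * integral\<^sup>L M (\<lambda>\<omega>. op_norm n (\<lambda>a b. Y a b \<omega>))"
      "n powr (\<beta> / 2) * integral\<^sup>L M (\<lambda>\<omega>. op_norm n (\<lambda>a b. Y a b \<omega>)) \<le> n powr (\<beta> / 2) * (C * h n)"
      by (auto intro: mult_left_mono)
    ultimately show "c * growth_rate \<beta> n
          \<le> prob_space.expectation M (\<lambda>\<omega>. op_norm n (sparse_matrix (real n powr (- \<beta>)) \<epsilon> B \<omega>)) \<and>
        prob_space.expectation M (\<lambda>\<omega>. op_norm n (sparse_matrix (real n powr (- \<beta>)) \<epsilon> B \<omega>))
          \<le> C * growth_rate \<beta> n"
      using rate[of n] elim(2) by (simp add: mult_ac)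
  qed
qed

theorem proposition5p7:
  fixes \<beta> :: real
  assumes "\<beta> \<ge> 0"
  shows "\<exists>c>0. \<exists>C>0. \<forall>\<^sub>F n in sequentially.
    \<forall>(M :: 'a measure) \<epsilon> B.
      signs_and_selectors M n (real n powr (- \<beta>)) \<epsilon> B \<longrightarrow>
        c * growth_rate \<beta> n
          \<le> prob_space.expectation M (\<lambda>\<omega>. op_norm n (sparse_matrix (real n powr (- \<beta>)) \<epsilon> B \<omega>)) \<and>
        prob_space.expectation M (\<lambda>\<omega>. op_norm n (sparse_matrix (real n powr (- \<beta>)) \<epsilon> B \<omega>))
          \<le> C * growth_rate \<beta> n"
proof -
  have K: "upper_const > 0" by (simp add: upper_const_def)
  consider "\<beta> < 1" | "\<beta> = 1" | "1 < \<beta>" "\<beta> \<le> 2" | "2 < \<beta>" by linarith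
  then show ?thesis
  proof cases
    case 1
    have "\<forall>\<^sub>F n in sequentially. ln (real n) \<le> real n powr (1 - \<beta>)"
      using 1 by real_asymp
    then have "\<forall>\<^sub>F n in sequentially. \<forall>(M :: 'a measure) Y. sparse_sign_matrix M n (real n powr - \<beta>) Y \<longrightarrow>
        1 / 4 * n powr ((1 - \<beta>) / 2) \<le> integral\<^sup>L M (\<lambda>\<omega>. op_norm n (\<lambda>a b. Y a b \<omega>)) \<and>
        integral\<^sup>L M (\<lambda>\<omega>. op_norm n (\<lambda>a b. Y a b \<omega>)) \<le> 4 * sqrt upper_const * n powr ((1 - \<beta>) / 2)"
      using eventually_ge_at_top[of 1]
      by eventually_elim
        (use 1 assms in \<open>auto intro: sparse_sign_matrix.expectation_dense_bounds simp del: times_divide_eq_left\<close>)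
    from growth_transfer[OF assms _ this] 1 K show ?thesis
      by (intro exI[of _ "1 / 4"] exI[of _ "4 * sqrt upper_const"] conjI)
        (auto simp: growth_rate_def field_simps simp flip: powr_add)
  next
    case 2
    have "\<forall>\<^sub>F n in sequentially. 4 \<le> ln (real n)" "\<forall>\<^sub>F n in sequentially. 2 * ln (real n) \<le> real n"
      "\<forall>\<^sub>F n in sequentially. 1 \<le> ln (ln (real n))" "\<forall>\<^sub>F n in sequentially. 2 * ln (ln (real n)) \<le> ln (real n)"
      by real_asymp+
    then have "\<forall>\<^sub>F n in sequentially. \<forall>(M :: 'a measure) Y. sparse_sign_matrix M n (real n powr - \<beta>) Y \<longrightarrow>
        1 / 4 * (ln n / ln (ln n)) powr (1 / 2) \<le> integral\<^sup>L M (\<lambda>\<omega>. op_norm n (\<lambda>a b. Y a b \<omega>)) \<and>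
        integral\<^sup>L M (\<lambda>\<omega>. op_norm n (\<lambda>a b. Y a b \<omega>)) \<le> 2 * sqrt (8 * upper_const) * (ln n / ln (ln n)) powr (1 / 2)"
      unfolding 2
      by eventually_elim
        (blast intro: sparse_sign_matrix.expectation_critical_bounds)
    from growth_transfer[OF assms _ this] 2 K show ?thesis
      by (intro exI[of _ "1 / 4"] exI[of _ "2 * sqrt (8 * upper_const)"] conjI)
        (auto simp: growth_rate_def)
  next
    case 3
    let ?C = "2 * sqrt (upper_const * (4 / (\<beta> - 1)))"
    have "\<forall>\<^sub>F n in sequentially. 1 \<le> ln (real n)" by real_asymp
    then have "\<forall>\<^sub>F n in sequentially. \<forall>(M :: 'a measure) Y. sparse_sign_matrix M n (real n powr - \<beta>) Y \<longrightarrow>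
        1 / 2 * 1 \<le> integral\<^sup>L M (\<lambda>\<omega>. op_norm n (\<lambda>a b. Y a b \<omega>)) \<and>
        integral\<^sup>L M (\<lambda>\<omega>. op_norm n (\<lambda>a b. Y a b \<omega>)) \<le> ?C * 1"
      unfolding mult_1_right
      by eventually_elim
        (use 3 sparse_sign_matrix.expectation_sparse_bounds in blast)
    from growth_transfer[OF assms _ this] 3 K show ?thesis
      by (intro exI[of _ "1 / 2"] exI[of _ ?C] conjI) (auto simp: growth_rate_def)
  next
    case 4
    have "\<forall>\<^sub>F n in sequentially. \<forall>(M :: 'a measure) Y. sparse_sign_matrix M n (real n powr - \<beta>) Y \<longrightarrow>
        1 / 2 * n powr (2 - \<beta>) \<le> integral\<^sup>L M (\<lambda>\<omega>. op_norm n (\<lambda>a b. Y a b \<omega>)) \<and>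
        integral\<^sup>L M (\<lambda>\<omega>. op_norm n (\<lambda>a b. Y a b \<omega>)) \<le> 1 * n powr (2 - \<beta>)"
      using eventually_ge_at_top[of 1]
      by eventually_elim
        (use 4 sparse_sign_matrix.expectation_very_sparse_bounds in blast)
    from growth_transfer[OF assms _ this] 4 show ?thesis
      by (intro exI[of _ "1 / 2"] exI[of _ 1] conjI)
        (auto simp: growth_rate_def field_simps simp flip: powr_add)
  qed
qed

end
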